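(* Let $F$ be a probability distribution with support $\mathsf{X}$ and let $\{X_t\}_{t\ge1}$ be an $F$-invariant Harris recurrent Markov chain on $\mathsf{X}$. Let $g:\mathsf{X}\to\mathbb{R}^p$ satisfy $\mathrm{E}_F\|g\|^{2+\delta}<\infty$ for some $\delta>0$, and suppose the chain is polynomially ergodic of order $m>(1+\epsilon_1)(1+2/\delta)$ for some $\epsilon_1>0$. Put $Y_t=g(X_t)$, $\theta=\mathrm{E}_F g$, $\theta_n=n^{-1}\sum_{t=1}^nY_t$, and let $\Sigma$ be the (positive definite) covariance matrix in the central limit theorem $\sqrt n(\theta_n-\theta)\overset{d}{\to}N_p(0,\Sigma)$. Let $K(Y,p)>0$ be a constant, let $K_n(Y,p)>0$ be estimators of it, and let $\Sigma_n$ be estimators of $\Sigma$, such that, with probability 1, as $n\to\infty$, $K_n(Y,p)\to K(Y,p)$ and $\Sigma_n\to\Sigma$. Fix $\alpha\in(0,1)$ and $n^*\ge0$, and for $\epsilon>0$ define $$T^*(\epsilon)=\inf\left\{n\ge0:\ \mathrm{Vol}(C_\alpha(n))^{1/p}+\epsilon K_n(Y,p)\,I(n<n^* )+n^{-1}\le\epsilon K_n(Y,p)\right\},$$ where $C_\alpha(n)$ is the confidence ellipsoid for $\theta$ based on $\theta_n$ and $\Sigma_n$ defined in the context. Then, as $\epsilon\to0$, $T^*(\epsilon)\to\infty$ (with probability 1) and $$\Pr\left[\theta\in C_\alpha(T^*(\epsilon))\right]\to1-\alpha .$$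
   Context: $\|\cdot\|$ is the Euclidean norm, $|\cdot|$ applied to a matrix is the determinant, $I(\cdot)$ is the indicator function, and $\mathrm{E}_F$ is expectation under $F$. Polynomial ergodicity of order $m>0$: with $P^n$ the $n$-step transition kernel, there is a function $M:\mathsf{X}\to[0,\infty)$ with $\mathrm{E}_FM<\infty$ such that $\|P^n(x,\cdot)-F(\cdot)\|_{TV}\le M(x)\,n^{-m}$ for all $x\in\mathsf{X}$ and $n\ge1$. Confidence region: $$C_\alpha(n)=\{\vartheta\in\mathbb{R}^p:\ n(\theta_n-\vartheta)^T\Sigma_n^{-1}(\theta_n-\vartheta)<T^2_{1-\alpha,p,q}\},$$ with volume $$\mathrm{Vol}(C_\alpha(n))=\frac{2\pi^{p/2}}{p\,\Gamma(p/2)}\left(\frac{T^2_{1-\alpha,p,q}}{n}\right)^{p/2}|\Sigma_n|^{1/2}.$$ Here $\Sigma_n$ is a symmetric nonnegative definite $p\times p$ matrix computed from $Y_1,\dots,Y_n$, and $T^2_{1-\alpha,p,q}$ is the $1-\alpha$ quantile of Hotelling's $T$-squared distribution, i.e. of the law of $\frac{p(q+p-1)}{q}W$ with $W$ having the $F$-distribution with $(p,q)$ degrees of freedom. The degrees of freedom $q=q_n$ are positive integers determined by the choice of $\Sigma_n$, defined for $n\ge n^*$, with $q_n\to\infty$ as $n\to\infty$, so that $T^2_{1-\alpha,p,q_n}\to\chi^2_{1-\alpha,p}$, the $1-\alpha$ quantile of the $\chi^2_p$ distribution. For $n<n^*$ the stopping inequality cannot hold whatever nonnegative value is given to $\mathrm{Vol}(C_\alpha(n))$;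 at $n=0$, $n^{-1}$ is read as $+\infty$. If $\Sigma_n$ is singular, $\mathrm{Vol}(C_\alpha(n))$ is still given by the displayed formula and $C_\alpha(n)$ may be taken to be any fixed measurable choice. *)

theory Defs
  imports "HOL-Probability.Probability"
begin

section \<open>Markov chains on a general state space\<close>

text \<open>
  A measurable space \<open>S\<close> is represented, as usual, by a measure whose sigma-algebra is used.
  A transition kernel on \<open>S\<close> is a measurable map \<open>P \<in> S \<rightarrow>\<^sub>M prob_algebra S\<close>.
\<close>

primrec kernel_pow :: "'a measure \<Rightarrow> ('a \<Rightarrow> 'a measure) \<Rightarrow> nat \<Rightarrow> 'a \<Rightarrow> 'a measure" where
  "kernel_pow S P 0 x = return S x"
| "kernel_pow S P (Suc n) x = kernel_pow S P n x \<bind> P"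

definition invariant_dist :: "'a measure \<Rightarrow> ('a \<Rightarrow> 'a measure) \<Rightarrow> bool" where
  "invariant_dist F P \<longleftrightarrow> F \<bind> P = F"

text \<open>
  Time starts at \<open>1\<close>; the value \<open>X 0\<close> is never used, and the law of \<open>X 1\<close> is arbitrary.
  The conditioning sigma-algebra is the one generated by \<open>X 1, \<dots>, X t\<close>.
\<close>

definition markov_chain ::
  "'w measure \<Rightarrow> 'a measure \<Rightarrow> ('a \<Rightarrow> 'a measure) \<Rightarrow> (nat \<Rightarrow> 'w \<Rightarrow> 'a) \<Rightarrow> bool" where
  "markov_chain M S P X \<longleftrightarrow>
     (\<forall>t\<ge>1. X t \<in> M \<rightarrow>\<^sub>M S) \<and>
     (\<forall>t\<ge>1. \<forall>A\<in>sets S. AE w in M.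
        real_cond_exp M
          (vimage_algebra (space M) (\<lambda>w. \<lambda>s\<in>{1..t}. X s w) (PiM {1..t} (\<lambda>_. S)))
          (indicator (X (Suc t) -` A)) w
        = measure (P (X t w)) A)"

text \<open>
  The Ionescu-Tulcea law, on the space of sequences, of the chain with kernel \<open>P\<close> started at \<open>x\<close>
  (coordinate \<open>0\<close> is the starting point).
\<close>

definition path_step :: "'a measure \<Rightarrow> ('a \<Rightarrow> 'a measure) \<Rightarrow> 'a \<Rightarrow> nat \<Rightarrow> (nat \<Rightarrow> 'a) \<Rightarrow> 'a measure" where
  "path_step S P x n h = (if n = 0 then return S x else P (h (n - 1)))"

definition path_law :: "'a measure \<Rightarrow> ('a \<Rightarrow> 'a measure) \<Rightarrow> 'a \<Rightarrow> (nat \<Rightarrow> 'a) measure" where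
  "path_law S P x =
     projective_family.lim UNIV (Ionescu_Tulcea.CI (path_step S P x) (\<lambda>_. S)) (\<lambda>_. S)"

lemma Ionescu_Tulcea_path_step:
  assumes P: "P \<in> S \<rightarrow>\<^sub>M prob_algebra S" and x: "x \<in> space S"
  shows "Ionescu_Tulcea (path_step S P x) (\<lambda>_. S)"
proof (rule Ionescu_Tulcea.intro)
  show "path_step S P x i \<in> PiM {0..<i} (\<lambda>_. S) \<rightarrow>\<^sub>M subprob_algebra S" for i
  proof (cases i)
    case 0
    then show ?thesis using x
      by (simp add: path_step_def[abs_def] space_subprob_algebra subprob_space_return measurable_const)
  next
    case (Suc j)
    have "(\<lambda>h. h j) \<in> PiM {0..<Suc j} (\<lambda>_. S) \<rightarrow>\<^sub>M S"
      by (rule measurable_component_singleton) simp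
    then have "(\<lambda>h. P (h j)) \<in> PiM {0..<Suc j} (\<lambda>_. S) \<rightarrow>\<^sub>M subprob_algebra S"
      by (rule measurable_compose[OF _ measurable_prob_algebraD[OF P]])
    then show ?thesis using Suc by (simp add: path_step_def[abs_def])
  qed
  show "prob_space (path_step S P x i h)" if h: "h \<in> space (PiM {0..<i} (\<lambda>_. S))" for i h
  proof (cases i)
    case 0
    with x show ?thesis by (simp add: path_step_def prob_space_return)
  next
    case (Suc j)
    then have "h j \<in> space S" using h by (auto simp: space_PiM PiE_iff)
    then show ?thesis
      using Suc measurable_space[OF P] by (auto simp: path_step_def space_prob_algebra)
  qed
qed

lemma emeasure_path_law:
  assumes "P \<in> S \<rightarrow>\<^sub>M prob_algebra S" and "x \<in> space S"
    and "finite J" and "A \<in> sets (PiM J (\<lambda>_. S))"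
  shows "emeasure (path_law S P x) (prod_emb UNIV (\<lambda>_. S) J A)
           = emeasure (Ionescu_Tulcea.CI (path_step S P x) (\<lambda>_. S) J) A"
  unfolding path_law_def
  by (rule Ionescu_Tulcea.lim[OF Ionescu_Tulcea_path_step[OF assms(1,2)] assms(3,4)])

text \<open>
  Harris recurrence: for some nontrivial sigma-finite measure \<open>\<phi>\<close>, from every starting point
  every set of positive \<open>\<phi>\<close>-measure is visited infinitely often almost surely.
\<close>

definition Harris_recurrent :: "'a measure \<Rightarrow> ('a \<Rightarrow> 'a measure) \<Rightarrow> bool" where
  "Harris_recurrent S P \<longleftrightarrow>
     (\<exists>\<phi>. sigma_finite_measure \<phi> \<and> sets \<phi> = sets S \<and> emeasure \<phi> (space S) > 0 \<and>
        (\<forall>A\<in>sets S. emeasure \<phi> A > 0 \<longrightarrow>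
           (\<forall>x\<in>space S. AE h in path_law S P x. \<exists>\<^sub>\<infinity>n. h n \<in> A)))"

definition tv_dist :: "'a measure \<Rightarrow> 'a measure \<Rightarrow> real" where
  "tv_dist \<mu> \<nu> = (SUP A\<in>sets \<nu>. \<bar>measure \<mu> A - measure \<nu> A\<bar>)"

definition polynomially_ergodic :: "'a measure \<Rightarrow> ('a \<Rightarrow> 'a measure) \<Rightarrow> real \<Rightarrow> bool" where
  "polynomially_ergodic F P m \<longleftrightarrow> m > 0 \<and>
     (\<exists>V. (\<forall>x\<in>space F. 0 \<le> V x) \<and> integrable F V \<and>
        (\<forall>x\<in>space F. \<forall>n\<ge>1. tv_dist (kernel_pow F P n x) F \<le> V x * real n powr (- m)))"


section \<open>Matrices, Gaussian laws and weak convergence\<close>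

definition nonneg_definite :: "real^'p^'p \<Rightarrow> bool" where
  "nonneg_definite A \<longleftrightarrow> transpose A = A \<and> (\<forall>v. 0 \<le> v \<bullet> (A *v v))"

definition pos_definite :: "real^'p^'p \<Rightarrow> bool" where
  "pos_definite A \<longleftrightarrow> transpose A = A \<and> (\<forall>v. v \<noteq> 0 \<longrightarrow> 0 < v \<bullet> (A *v v))"

text \<open>\<open>N\<^sub>p(0, A)\<close>, for positive definite \<open>A\<close> only.\<close>

definition centered_normal :: "real^'p^'p \<Rightarrow> (real^'p) measure" where
  "centered_normal A = density lborel
     (\<lambda>v. ennreal (exp (- (v \<bullet> (matrix_inv A *v v)) / 2) / sqrt ((2 * pi) ^ CARD('p) * det A)))"

definition weakly_converges :: "(nat \<Rightarrow> (real^'p) measure) \<Rightarrow> (real^'p) measure \<Rightarrow> bool" where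
  "weakly_converges \<mu> \<nu> \<longleftrightarrow>
     (\<forall>f :: real^'p \<Rightarrow> real. continuous_on UNIV f \<longrightarrow> bounded (range f) \<longrightarrow>
        (\<lambda>n. \<integral>v. f v \<partial>\<mu> n) \<longlonglongrightarrow> (\<integral>v. f v \<partial>\<nu>))"


section \<open>Hotelling quantiles, confidence ellipsoids and the stopping time\<close>

definition F_density :: "nat \<Rightarrow> nat \<Rightarrow> real \<Rightarrow> real" where
  "F_density a b x =
     (if x \<le> 0 then 0
      else (real a / real b) powr (real a / 2) * x powr (real a / 2 - 1)
           * (1 + real a / real b * x) powr (- (real a + real b) / 2)
           / Beta (real a / 2) (real b / 2))"

definition Hotelling_law :: "nat \<Rightarrow> nat \<Rightarrow> real measure" where
  "Hotelling_law p q =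
     distr (density lborel (\<lambda>x. ennreal (F_density p q x))) borel
       (\<lambda>w. real p * (real q + real p - 1) / real q * w)"

definition quantile :: "real measure \<Rightarrow> real \<Rightarrow> real" where
  "quantile \<mu> u = Inf {x. u \<le> cdf \<mu> x}"

definition Hotelling_quantile :: "real \<Rightarrow> nat \<Rightarrow> nat \<Rightarrow> real" where
  "Hotelling_quantile u p q = quantile (Hotelling_law p q) u"

definition sample_mean :: "(nat \<Rightarrow> real^'p) \<Rightarrow> nat \<Rightarrow> real^'p" where
  "sample_mean y n = (1 / real n) *\<^sub>R (\<Sum>t = 1..n. y t)"

text \<open>
  In the next two definitions \<open>c\<close> is the estimate of the mean, \<open>A\<close> that of the covariance matrix,
  and \<open>q\<close> the degrees of freedom. For singular \<open>A\<close> the ellipsoid is not meaningful.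
\<close>

definition conf_ellipsoid ::
  "real \<Rightarrow> nat \<Rightarrow> nat \<Rightarrow> real^'p \<Rightarrow> real^'p^'p \<Rightarrow> (real^'p) set" where
  "conf_ellipsoid \<alpha> q n c A =
     {v. real n * ((c - v) \<bullet> (matrix_inv A *v (c - v))) < Hotelling_quantile (1 - \<alpha>) CARD('p) q}"

definition conf_volume :: "real \<Rightarrow> nat \<Rightarrow> nat \<Rightarrow> real^'p^'p \<Rightarrow> real" where
  "conf_volume \<alpha> q n A =
     2 * pi powr (real CARD('p) / 2) / (real CARD('p) * Gamma (real CARD('p) / 2))
     * (Hotelling_quantile (1 - \<alpha>) CARD('p) q / real n) powr (real CARD('p) / 2)
     * sqrt (det A)"

text \<open>
  \<open>vol n\<close> and \<open>K n\<close> are the realised volume and the realised estimate of the constant.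
  The inequality is read in the extended reals because \<open>inverse (0::ereal) = \<infinity>\<close>, so that
  \<open>n = 0\<close> never qualifies; the infimum of the empty set is \<open>\<infinity>\<close>.
\<close>

definition fixed_volume_stop ::
  "nat \<Rightarrow> nat \<Rightarrow> (nat \<Rightarrow> real) \<Rightarrow> (nat \<Rightarrow> real) \<Rightarrow> real \<Rightarrow> enat" where
  "fixed_volume_stop p nstar vol K \<epsilon> =
     Inf {enat n | n.
       ereal (vol n powr (1 / real p) + \<epsilon> * K n * indicator {..<nstar} n) + inverse (ereal (real n))
         \<le> ereal (\<epsilon> * K n)}"

end

theory Submission
  imports Defs "HOL-Real_Asymp.Real_Asymp"
begin

text \<open>
  Almost surely \<open>\<epsilon>\<^sup>2 T\<^sup>*(\<epsilon>)\<close> tends to a constant, so only the central limit theorem at the random time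
  \<open>T\<^sup>*(\<epsilon>)\<close> is at stake. By Anscombe's criterion it follows from the assumed central limit theorem at
  fixed times once the partial sums oscillate little over short windows. This is Ottaviani's maximal
  inequality, applied to blocks of length \<open>b = n\<^sup>\<gamma>\<close> with one block left out after the first exceedance so that the
  Markov chain forgets its past. Summed over the \<open>n / b\<close> blocks, the mixing error is of order
  \<open>n b\<^sup>-\<^sup>(\<^sup>1\<^sup>+\<^sup>m\<^sup>)\<close> and the probability that the sum of norms over some block is comparable to the
  square root of \<open>n\<close> is of order \<open>b\<^sup>1\<^sup>+\<^sup>\<delta> n\<^sup>-\<^sup>\<delta>\<^sup>/\<^sup>2\<close>; both vanish for a
  suitable \<open>\<gamma>\<close> because \<open>m > 1 + 2 / \<delta>\<close>. The initial law being arbitrary, everything is done on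
  the event that the bound of polynomial ergodicity at \<open>X\<^sub>1\<close> is at most a large constant, on which the law of
  \<open>X\<^sub>t\<close> approaches \<open>F\<close> at rate \<open>t\<^sup>-\<^sup>m\<close>. Finally the quadratic form of the Gaussian
  limit has the chi-squared law, whose quantiles are the limits of the Hotelling quantiles.
\<close>

section \<open>The Markov property\<close>

text \<open>The stopping time may depend on the sums in any way, through \<open>\<Sigma>n\<close>
  and \<open>Kn\<close>, so conditioning on it gives nothing. What can be used is only that it lies
  in a deterministic window around some n, of width proportional to n, and the normalized sum must
  be nearly constant there. Ottaviani's argument needs to know that the increment remaining after
  the first exceedance is rarely large. The only source for this is tightness, which the limit
  theorem gives for the chain as started; hence probabilities make a detour: from the conditional
  law given the past to \<open>F\<close>, and from \<open>F\<close> back to the actual chain at some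
  other time \<open>u\<close>. Total variation controls functions with values in [0,1] only, while
  the moments and \<open>V\<close> are integrable under \<open>F\<close> but possibly not under the
  law of \<open>X t\<close>. So both the power bound for a block and the ergodicity bound are cut
  off at 1 before they are transported to \<open>F\<close>, and the cut-off is removed only under
  \<open>F\<close>.\<close>

locale kernel_chain = prob_space M for M :: "'w measure" +
  fixes F :: "'a measure" and P :: "'a \<Rightarrow> 'a measure" and X :: "nat \<Rightarrow> 'w \<Rightarrow> 'a"
  assumes P: "P \<in> F \<rightarrow>\<^sub>M prob_algebra F" and chain: "markov_chain M F P X"
begin

text \<open>Only the sigma-algebra of this measure matters. It is spelled as in
  \<open>markov_chain\<close>, so that the conditional expectation there is literally one given
  \<open>past t\<close>.\<close>

definition past :: "nat \<Rightarrow> 'w measure" where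
  "past t = vimage_algebra (space M) (\<lambda>w. \<lambda>s\<in>{1..t}. X s w) (PiM {1..t} (\<lambda>_. F))"

lemma space_past [simp]: "space (past t) = space M"
  by (simp add: past_def)

lemma P_subprob [measurable]: "P \<in> F \<rightarrow>\<^sub>M subprob_algebra F"
  using P by (rule measurable_prob_algebraD)

lemma P_space:
  assumes "x \<in> space F" shows "prob_space (P x)" "sets (P x) = sets F"
  using measurable_space[OF P assms] by (auto simp: space_prob_algebra)

lemma X_measurable: "t \<ge> 1 \<Longrightarrow> X t \<in> M \<rightarrow>\<^sub>M F"
  using chain by (simp add: markov_chain_def)

lemma X_Suc_measurable [measurable]: "X (Suc t) \<in> M \<rightarrow>\<^sub>M F"
  by (rule X_measurable) simp

lemma X_1_measurable [measurable]: "X 1 \<in> M \<rightarrow>\<^sub>M F"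
  by (rule X_measurable) simp

lemma history_measurable: "(\<lambda>w. \<lambda>s\<in>{1..t}. X s w) \<in> M \<rightarrow>\<^sub>M PiM {1..t} (\<lambda>_. F)"
  by (rule measurable_restrict) (simp add: X_measurable)

lemma subalgebra_past: "subalgebra M (past t)"
proof -
  have "(\<lambda>w. w) \<in> M \<rightarrow>\<^sub>M past t"
    unfolding past_def by (rule measurable_vimage_algebra2) (use history_measurable[of t] in auto)
  from measurable_sets[OF this] show ?thesis
    using sets.sets_into_space[of _ "past t"] by (auto simp: subalgebra_def Int_absorb2)
qed

lemma sets_past: "A \<in> sets (past t) \<Longrightarrow> A \<in> sets M"
  using subalgebra_past[of t] by (auto simp: subalgebra_def)

lemma measurable_past: "f \<in> past t \<rightarrow>\<^sub>M N \<Longrightarrow> f \<in> M \<rightarrow>\<^sub>M N"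
  using subalgebra_past measurable_from_subalg by blast

lemma X_past: "1 \<le> s \<Longrightarrow> s \<le> t \<Longrightarrow> X s \<in> past t \<rightarrow>\<^sub>M F"
proof -
  assume s: "1 \<le> s" "s \<le> t"
  have "(\<lambda>w. \<lambda>s\<in>{1..t}. X s w) \<in> past t \<rightarrow>\<^sub>M PiM {1..t} (\<lambda>_. F)"
    unfolding past_def using history_measurable[of t, THEN measurable_space]
    by (intro measurable_vimage_algebra1) auto
  then have "(\<lambda>w. (\<lambda>s\<in>{1..t}. X s w) s) \<in> past t \<rightarrow>\<^sub>M F"
    by (rule measurable_compose) (use s in \<open>simp add: measurable_component_singleton\<close>)
  then show ?thesis using s by simp
qed

lemma measurable_past_ident: "s \<le> t \<Longrightarrow> (\<lambda>w. w) \<in> past t \<rightarrow>\<^sub>M past s"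
  unfolding past_def[of s]
  by (rule measurable_vimage_algebra2) (auto intro!: measurable_restrict X_past)

lemma past_mono: "s \<le> t \<Longrightarrow> f \<in> past s \<rightarrow>\<^sub>M N \<Longrightarrow> f \<in> past t \<rightarrow>\<^sub>M N"
  by (rule measurable_compose[OF measurable_past_ident])

lemma sets_past_mono: "s \<le> t \<Longrightarrow> A \<in> sets (past s) \<Longrightarrow> A \<in> sets (past t)"
  using measurable_sets[OF measurable_past_ident, of s t A] sets.sets_into_space[of A "past s"]
  by (simp add: Int_absorb2)

text \<open>Integrating the Markov property over \<open>A\<close> removes the conditional
  expectation: this is its defining identity, moved from real to extended nonnegative integrals,
  where no integrability has to be carried along.\<close>

lemma one_step_set:
  assumes t: "t \<ge> 1" and A: "A \<in> sets (past t)" and B: "B \<in> sets F"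
  shows "emeasure M (A \<inter> X (Suc t) -` B) = (\<integral>\<^sup>+w. indicator A w * emeasure (P (X t w)) B \<partial>M)"
proof -
  interpret S: sigma_finite_subalgebra M "past t"
    by (intro finite_measure_subalgebra_is_sigma_finite finite_measure_subalgebra.intro
        finite_measure_subalgebra_axioms.intro subalgebra_past finite_measure_axioms)
  note X_measurable[measurable] X_measurable[OF t, measurable] B[measurable] sets_past[OF A, measurable]
  have Xs [measurable]: "X (Suc t) \<in> M \<rightarrow>\<^sub>M F" by (simp add: X_measurable)
  have eq: "indicator (X (Suc t) -` B) w = (indicator B (X (Suc t) w) :: real)" for w
    by (simp add: indicator_def)
  have int: "integrable M (indicator (X (Suc t) -` B) :: 'w \<Rightarrow> real)"
    by (subst eq[abs_def]) (rule integrable_const_bound[where B=1], auto)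
  have ae: "AE w in M. real_cond_exp M (past t) (indicator (X (Suc t) -` B)) w = measure (P (X t w)) B"
    using chain t B unfolding markov_chain_def past_def by auto
  have "(\<integral>w. indicator A w * indicator B (X (Suc t) w) \<partial>M) = (\<integral>w. indicator A w * measure (P (X t w)) B \<partial>M)"
  proof -
    have "(\<integral>w. indicator A w * indicator B (X (Suc t) w) \<partial>M)
       = (\<integral>w. indicator A w * real_cond_exp M (past t) (indicator (X (Suc t) -` B)) w \<partial>M)"
      using S.real_cond_exp_intA[OF int A] by (simp add: set_lebesgue_integral_def eq)
    also have "\<dots> = (\<integral>w. indicator A w * measure (P (X t w)) B \<partial>M)"
      using ae by (intro integral_cong_AE) (auto intro: borel_measurable_cond_exp2)
    finally show ?thesis .
  qed
  moreover have "emeasure M (A \<inter> X (Suc t) -` B) = (\<integral>\<^sup>+w. ennreal (indicator A w * indicator B (X (Suc t) w)) \<partial>M)"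
  proof -
    have "A \<inter> X (Suc t) -` B = A \<inter> (X (Suc t) -` B \<inter> space M)"
      using sets.sets_into_space[OF sets_past[OF A]] by auto
    then have "emeasure M (A \<inter> X (Suc t) -` B) = emeasure M (A \<inter> (X (Suc t) -` B \<inter> space M))"
      by simp
    also have "\<dots> = (\<integral>\<^sup>+w. indicator (A \<inter> (X (Suc t) -` B \<inter> space M)) w \<partial>M)"
      by (intro nn_integral_indicator[symmetric]) auto
    also have "\<dots> = (\<integral>\<^sup>+w. ennreal (indicator A w * indicator B (X (Suc t) w)) \<partial>M)"
      by (intro nn_integral_cong) (auto simp: indicator_def)
    finally show ?thesis .
  qed
  moreover have "\<dots> = ennreal (\<integral>w. indicator A w * indicator B (X (Suc t) w) \<partial>M)"
    by (intro nn_integral_eq_integral integrable_const_bound[where B=1])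
      (auto simp: indicator_def)
  moreover have "(\<integral>\<^sup>+w. indicator A w * emeasure (P (X t w)) B \<partial>M)
     = (\<integral>\<^sup>+w. ennreal (indicator A w * measure (P (X t w)) B) \<partial>M)"
  proof (intro nn_integral_cong)
    fix w assume "w \<in> space M"
    then interpret Pw: prob_space "P (X t w)"
      using P_space(1) measurable_space[OF X_measurable[OF t]] by blast
    show "indicator A w * emeasure (P (X t w)) B = ennreal (indicator A w * measure (P (X t w)) B)"
      by (simp add: Pw.emeasure_eq_measure indicator_def)
  qed
  moreover have "\<dots> = ennreal (\<integral>w. indicator A w * measure (P (X t w)) B \<partial>M)"
  proof (intro nn_integral_eq_integral integrable_const_bound[where B=1] AE_I2)
    fix w assume "w \<in> space M"
    then interpret Pw: prob_space "P (X t w)"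
      using P_space(1) measurable_space[OF X_measurable[OF t]] by blast
    show "norm (indicator A w * measure (P (X t w)) B) \<le> 1" by (simp add: indicator_def)
  qed (auto simp: indicator_def)
  ultimately show ?thesis by simp
qed

text \<open>The law of the pair (past, \<open>X (Suc t)\<close>) and the law obtained by drawing
  from \<open>P (X t w)\<close> agree on rectangles by \<open>one_step_set\<close>; rectangles are
  stable under intersection and generate, so the laws agree. The past is carried by \<open>w\<close>
  itself, seen through \<open>past t\<close>.\<close>

lemma one_step:
  assumes t: "t \<ge> 1" and k: "case_prod k \<in> borel_measurable (past t \<Otimes>\<^sub>M F)"
  shows "(\<integral>\<^sup>+w. k w (X (Suc t) w) \<partial>M) = (\<integral>\<^sup>+w. \<integral>\<^sup>+z. k w z \<partial>P (X t w) \<partial>M)"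
proof -
  let ?N = "past t \<Otimes>\<^sub>M F"
  have id: "(\<lambda>w. w) \<in> M \<rightarrow>\<^sub>M past t" by (rule measurable_past[of _ t]) simp
  have Xs [measurable]: "X (Suc t) \<in> M \<rightarrow>\<^sub>M F" by (simp add: X_measurable)
  have Xt [measurable]: "X t \<in> M \<rightarrow>\<^sub>M F" by (rule X_measurable[OF t])
  have J [measurable]: "(\<lambda>w. (w, X (Suc t) w)) \<in> M \<rightarrow>\<^sub>M ?N" using id by measurable
  have PX: "(\<lambda>w. P (X t w)) \<in> M \<rightarrow>\<^sub>M subprob_algebra F" by measurable
  have Kp: "(\<lambda>w. distr (P (X t w)) ?N (Pair w)) \<in> M \<rightarrow>\<^sub>M subprob_algebra ?N"
  proof (rule measurable_distr2[where M=F])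
    show "(\<lambda>(w, z). (w, z)) \<in> M \<Otimes>\<^sub>M F \<rightarrow>\<^sub>M ?N" using id by measurable
  qed (rule PX)
  let ?B = "M \<bind> (\<lambda>w. distr (P (X t w)) ?N (Pair w))"
  have sB: "sets ?B = sets ?N" by (rule sets_bind[OF _ not_empty]) simp
  have k': "k w \<in> borel_measurable F" if "w \<in> space M" for w
    using measurable_compose[OF measurable_Pair1' k, of w] that by simp
  have Pair_m: "Pair w \<in> P (X t w) \<rightarrow>\<^sub>M ?N" if "w \<in> space M" for w
    using that P_space(2)[OF measurable_space[OF Xt that]] by (simp cong: measurable_cong_sets)
  have "distr M ?N (\<lambda>w. (w, X (Suc t) w)) = ?B"
  proof (rule measure_eqI_generator_eq[OF Int_stable_pair_measure_generator, of "past t" F "space ?N"])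
    show "{a \<times> b |a b. a \<in> sets (past t) \<and> b \<in> sets F} \<subseteq> Pow (space ?N)"
      using pair_measure_closed[of "past t" F] by (simp add: space_pair_measure)
    show "sets (distr M ?N (\<lambda>w. (w, X (Suc t) w))) = sigma_sets (space ?N) {a \<times> b |a b. a \<in> sets (past t) \<and> b \<in> sets F}"
      by (simp add: sets_pair_measure space_pair_measure)
    show "sets ?B = sigma_sets (space ?N) {a \<times> b |a b. a \<in> sets (past t) \<and> b \<in> sets F}"
      unfolding sB by (simp add: sets_pair_measure space_pair_measure)
    show "range (\<lambda>_::nat. space ?N) \<subseteq> {a \<times> b |a b. a \<in> sets (past t) \<and> b \<in> sets F}"
      using sets.top[of "past t"] sets.top[of F] by (auto simp: space_pair_measure)
    show "(\<Union>i::nat. space ?N) = space ?N" by simp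
    show "emeasure (distr M ?N (\<lambda>w. (w, X (Suc t) w))) (space ?N) \<noteq> \<infinity>"
      by (simp add: emeasure_distr emeasure_eq_measure)
    fix C assume "C \<in> {a \<times> b |a b. a \<in> sets (past t) \<and> b \<in> sets F}"
    then obtain A B where C: "C = A \<times> B" and A: "A \<in> sets (past t)" and B: "B \<in> sets F" by auto
    have CN: "C \<in> sets ?N" using A B C by auto
    have "emeasure (distr M ?N (\<lambda>w. (w, X (Suc t) w))) C = emeasure M (A \<inter> X (Suc t) -` B)"
      using sets.sets_into_space[OF sets_past[OF A]] unfolding C
      by (subst emeasure_distr) (use CN C in \<open>auto intro!: arg_cong[where f="emeasure M"]\<close>)
    also have "\<dots> = (\<integral>\<^sup>+w. indicator A w * emeasure (P (X t w)) B \<partial>M)"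
      by (rule one_step_set[OF t A B])
    also have "\<dots> = (\<integral>\<^sup>+w. emeasure (distr (P (X t w)) ?N (Pair w)) C \<partial>M)"
    proof (rule nn_integral_cong)
      fix w assume w: "w \<in> space M"
      have "Pair w -` C \<inter> space (P (X t w)) = (if w \<in> A then B else {})"
        using sets.sets_into_space[OF B] sets_eq_imp_space_eq[OF P_space(2)[OF measurable_space[OF Xt w]]]
        by (auto simp: C)
      then show "indicator A w * emeasure (P (X t w)) B = emeasure (distr (P (X t w)) ?N (Pair w)) C"
        by (simp add: emeasure_distr[OF Pair_m[OF w] CN])
    qed
    also have "\<dots> = emeasure ?B C"
      by (rule emeasure_bind[OF not_empty Kp CN, symmetric])
    finally show "emeasure (distr M ?N (\<lambda>w. (w, X (Suc t) w))) C = emeasure ?B C" .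
  qed
  then have "(\<integral>\<^sup>+y. case_prod k y \<partial>distr M ?N (\<lambda>w. (w, X (Suc t) w))) = (\<integral>\<^sup>+y. case_prod k y \<partial>?B)"
    by simp
  also have "(\<integral>\<^sup>+y. case_prod k y \<partial>distr M ?N (\<lambda>w. (w, X (Suc t) w))) = (\<integral>\<^sup>+w. k w (X (Suc t) w) \<partial>M)"
    by (subst nn_integral_distr[OF J]) (use k in simp_all)
  also have "(\<integral>\<^sup>+y. case_prod k y \<partial>?B) = (\<integral>\<^sup>+w. \<integral>\<^sup>+y. case_prod k y \<partial>distr (P (X t w)) ?N (Pair w) \<partial>M)"
    by (rule nn_integral_bind[OF k Kp])
  also have "\<dots> = (\<integral>\<^sup>+w. \<integral>\<^sup>+z. k w z \<partial>P (X t w) \<partial>M)"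
    by (intro nn_integral_cong) (subst nn_integral_distr[OF Pair_m], use k in simp_all)
  finally show ?thesis .
qed

lemma kernel_pow_measurable [measurable]: "kernel_pow F P n \<in> F \<rightarrow>\<^sub>M prob_algebra F"
proof (induction n)
  case 0
  have "return F \<in> F \<rightarrow>\<^sub>M prob_algebra F"
    by (intro measurable_prob_algebraI return_measurable prob_space_return)
  then show ?case by (simp cong: measurable_cong)
next
  case (Suc n)
  show ?case using measurable_bind_prob_space[OF Suc P] by simp
qed

text \<open>The last step is peeled off, as in the recursion of \<open>kernel_pow\<close>; hence
  \<open>h\<close> is arbitrary in the induction and gets replaced by its integral under
  \<open>P\<close>.\<close>

lemma n_step:
  assumes t: "t \<ge> 1" and A: "A \<in> sets (past t)" and h: "h \<in> borel_measurable F"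
  shows "(\<integral>\<^sup>+w. indicator A w * h (X (t + n) w) \<partial>M)
       = (\<integral>\<^sup>+w. indicator A w * (\<integral>\<^sup>+z. h z \<partial>kernel_pow F P n (X t w)) \<partial>M)"
  using h
proof (induction n arbitrary: h)
  case 0
  then show ?case
    by (intro nn_integral_cong) (simp add: nn_integral_return measurable_space[OF X_measurable[OF t]])
next
  case (Suc n)
  note Suc.prems[measurable]
  have A': "A \<in> sets (past (t + n))" by (rule sets_past_mono[OF _ A]) simp
  note A'[measurable]
  have "(\<integral>\<^sup>+w. indicator A w * h (X (t + Suc n) w) \<partial>M)
      = (\<integral>\<^sup>+w. \<integral>\<^sup>+z. indicator A w * h z \<partial>P (X (t + n) w) \<partial>M)"
    using one_step[of "t + n" "\<lambda>w z. indicator A w * h z"] t by simp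
  also have "\<dots> = (\<integral>\<^sup>+w. indicator A w * (\<integral>\<^sup>+z. h z \<partial>P (X (t + n) w)) \<partial>M)"
    by (intro nn_integral_cong) (simp add: indicator_def)
  also have "\<dots> = (\<integral>\<^sup>+w. indicator A w * (\<integral>\<^sup>+y. \<integral>\<^sup>+z. h z \<partial>P y \<partial>kernel_pow F P n (X t w)) \<partial>M)"
    by (rule Suc.IH) measurable
  also have "\<dots> = (\<integral>\<^sup>+w. indicator A w * (\<integral>\<^sup>+z. h z \<partial>kernel_pow F P (Suc n) (X t w)) \<partial>M)"
  proof (intro nn_integral_cong arg_cong2[where f="(*)"] refl)
    fix w assume "w \<in> space M"
    then have "X t w \<in> space F" using measurable_space[OF X_measurable[OF t]] by blast
    then have s: "sets (kernel_pow F P n (X t w)) = sets F"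
      using measurable_space[OF kernel_pow_measurable] by (auto simp: space_prob_algebra)
    have "P \<in> kernel_pow F P n (X t w) \<rightarrow>\<^sub>M subprob_algebra F"
      using P_subprob s by (simp cong: measurable_cong_sets)
    then show "(\<integral>\<^sup>+y. \<integral>\<^sup>+z. h z \<partial>P y \<partial>kernel_pow F P n (X t w)) = (\<integral>\<^sup>+z. h z \<partial>kernel_pow F P (Suc n) (X t w))"
      by (simp add: nn_integral_bind[OF Suc.prems])
  qed
  finally show ?case .
qed

text \<open>The accumulated value \<open>W\<close> is an extra argument because the sum is consumed one summand at a time.\<close>

lemma future_functional:
  fixes f :: "'a \<Rightarrow> 'v::euclidean_space" and \<phi> :: "'v \<Rightarrow> ennreal"
  assumes f [measurable]: "f \<in> borel_measurable F" and phi [measurable]: "\<phi> \<in> borel_measurable borel"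
    and le: "\<And>v. \<phi> v \<le> 1"
  shows "\<exists>h. case_prod h \<in> borel_measurable (borel \<Otimes>\<^sub>M F) \<and> (\<forall>a. \<forall>y\<in>space F. h a y \<le> 1) \<and>
           (\<forall>t\<ge>1. \<forall>W::'w \<Rightarrow> 'v\<in>borel_measurable (past t). \<forall>A\<in>sets (past t).
             (\<integral>\<^sup>+w. indicator A w * \<phi> (W w + (\<Sum>i\<in>{t<..t+N}. f (X i w))) \<partial>M)
           = (\<integral>\<^sup>+w. indicator A w * h (W w) (X t w) \<partial>M))"
proof (induction N)
  case 0
  show ?case by (rule exI[of _ "\<lambda>a x. \<phi> a"]) (simp add: le)
next
  case (Suc N)
  then obtain h where h [measurable]: "case_prod h \<in> borel_measurable (borel \<Otimes>\<^sub>M F)"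
    and h1: "\<And>a y. y \<in> space F \<Longrightarrow> h a y \<le> 1"
    and IH: "\<And>t (W::'w \<Rightarrow> 'v) A. t \<ge> 1 \<Longrightarrow> W \<in> borel_measurable (past t) \<Longrightarrow> A \<in> sets (past t) \<Longrightarrow>
      (\<integral>\<^sup>+w. indicator A w * \<phi> (W w + (\<Sum>i\<in>{t<..t+N}. f (X i w))) \<partial>M)
           = (\<integral>\<^sup>+w. indicator A w * h (W w) (X t w) \<partial>M)" by blast
  let ?h = "\<lambda>a y. \<integral>\<^sup>+z. h (a + f z) z \<partial>P y"
  have m: "(\<lambda>(u, z). h (fst u + f z) z) \<in> borel_measurable ((borel \<Otimes>\<^sub>M F) \<Otimes>\<^sub>M F)"
    by measurable
  have "(\<lambda>u. \<integral>\<^sup>+z. h (fst u + f z) z \<partial>P (snd u)) \<in> borel_measurable (borel \<Otimes>\<^sub>M F)"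
    by (rule nn_integral_measurable_subprob_algebra2[OF m]) measurable
  then have hm: "case_prod ?h \<in> borel_measurable (borel \<Otimes>\<^sub>M F)" by (simp add: split_beta')
  have h1': "?h a y \<le> 1" if y: "y \<in> space F" for a y
  proof -
    interpret Py: prob_space "P y" by (rule P_space(1)[OF y])
    have "space (P y) = space F" by (rule sets_eq_imp_space_eq[OF P_space(2)[OF y]])
    then have "?h a y \<le> (\<integral>\<^sup>+z. 1 \<partial>P y)" by (intro nn_integral_mono) (simp add: h1)
    then show ?thesis by (simp add: Py.emeasure_space_1)
  qed
  show ?case
  proof (intro exI[of _ ?h] conjI hm allI impI ballI h1')
    fix t and W :: "'w \<Rightarrow> 'v" and A
    assume t: "1 \<le> t" and W [measurable]: "W \<in> borel_measurable (past t)" and A [measurable]: "A \<in> sets (past t)"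
    have "{t<..t + Suc N} = insert (Suc t) {Suc t<..Suc t + N}" by auto
    then have eq: "W w + (\<Sum>i\<in>{t<..t + Suc N}. f (X i w)) = (W w + f (X (Suc t) w)) + (\<Sum>i\<in>{Suc t<..Suc t+N}. f (X i w))" for w
      by (simp add: add_ac)
    have [measurable]: "X (Suc t) \<in> past (Suc t) \<rightarrow>\<^sub>M F" by (rule X_past) auto
    have [measurable]: "W \<in> borel_measurable (past (Suc t))" by (rule past_mono[OF _ W]) simp
    have "(\<integral>\<^sup>+w. indicator A w * \<phi> (W w + (\<Sum>i\<in>{t<..t + Suc N}. f (X i w))) \<partial>M)
       = (\<integral>\<^sup>+w. indicator A w * h (W w + f (X (Suc t) w)) (X (Suc t) w) \<partial>M)"
      unfolding eq by (rule IH) (auto intro: sets_past_mono[OF _ A])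
    also have "\<dots> = (\<integral>\<^sup>+w. \<integral>\<^sup>+z. indicator A w * h (W w + f z) z \<partial>P (X t w) \<partial>M)"
      by (rule one_step[OF t]) measurable
    also have "\<dots> = (\<integral>\<^sup>+w. indicator A w * ?h (W w) (X t w) \<partial>M)"
      by (intro nn_integral_cong) (simp add: indicator_def)
    finally show "(\<integral>\<^sup>+w. indicator A w * \<phi> (W w + (\<Sum>i\<in>{t<..t + Suc N}. f (X i w))) \<partial>M)
        = (\<integral>\<^sup>+w. indicator A w * ?h (W w) (X t w) \<partial>M)" .
  qed
qed

text \<open>Time homogeneity: one \<open>H\<close> serves all \<open>t\<close> and \<open>A\<close>.
  This lets \<open>decoupling\<close> compare the same future event started at two different
  times.\<close>

lemma future_probability:
  fixes f :: "'a \<Rightarrow> 'v::euclidean_space"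
  assumes f [measurable]: "f \<in> borel_measurable F" and B [measurable]: "B \<in> sets borel"
  obtains H :: "'a \<Rightarrow> real" where "H \<in> borel_measurable F" "\<And>y. 0 \<le> H y" "\<And>y. H y \<le> 1"
    "\<And>t A. t \<ge> 1 \<Longrightarrow> A \<in> sets (past t) \<Longrightarrow>
       \<P>(w in M. w \<in> A \<and> (\<Sum>i\<in>{t<..t+N}. f (X i w)) \<in> B) = expectation (\<lambda>w. indicator A w * H (X t w))"
proof -
  have le1: "indicator B v \<le> (1::ennreal)" for v by (simp add: indicator_def)
  obtain h where h [measurable]: "case_prod h \<in> borel_measurable (borel \<Otimes>\<^sub>M F)"
    and h1: "\<And>a y. y \<in> space F \<Longrightarrow> h a y \<le> 1"
    and IH: "\<And>t (W::'w \<Rightarrow> 'v) A. t \<ge> 1 \<Longrightarrow> W \<in> borel_measurable (past t) \<Longrightarrow> A \<in> sets (past t) \<Longrightarrow>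
      (\<integral>\<^sup>+w. indicator A w * indicator B (W w + (\<Sum>i\<in>{t<..t+N}. f (X i w))) \<partial>M)
           = (\<integral>\<^sup>+w. indicator A w * h (W w) (X t w) \<partial>M)"
    using future_functional[OF f borel_measurable_indicator[OF B] le1, of N] by blast
  \<comment> \<open>The bound on \<open>h\<close> holds on \<open>space F\<close> only; the minimum
    makes \<open>H\<close> bounded by 1 everywhere without changing it there.\<close>
  define H where "H y = min 1 (enn2real (h 0 y))" for y
  have Hm [measurable]: "H \<in> borel_measurable F" unfolding H_def by measurable
  have H01: "0 \<le> H y" "H y \<le> 1" for y by (simp_all add: H_def)
  have hH: "h 0 y = ennreal (H y)" if "y \<in> space F" for y
  proof -
    have "h 0 y \<le> 1" by (rule h1[OF that])
    then have "h 0 y < top" by (rule order_le_less_trans) simp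
    then have e: "ennreal (enn2real (h 0 y)) = h 0 y" by simp
    then have "enn2real (h 0 y) \<le> 1" using \<open>h 0 y \<le> 1\<close> by (metis ennreal_1 ennreal_le_iff zero_le_one)
    then show ?thesis using e by (simp add: H_def min_absorb2)
  qed
  show ?thesis
  proof (rule that[OF Hm H01])
    fix t A assume t: "(1::nat) \<le> t" and A: "A \<in> sets (past t)"
    have [measurable]: "A \<in> sets M" by (rule sets_past[OF A])
    have [measurable]: "X t \<in> M \<rightarrow>\<^sub>M F" by (rule X_measurable[OF t])
    have Xi: "X i \<in> M \<rightarrow>\<^sub>M F" if "i \<in> {t<..t+N}" for i using that by (intro X_measurable) auto
    have [measurable]: "(\<lambda>w. \<Sum>i\<in>{t<..t+N}. f (X i w)) \<in> borel_measurable M"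
      by (intro borel_measurable_sum measurable_compose[OF Xi f])
    have "ennreal (\<P>(w in M. w \<in> A \<and> (\<Sum>i\<in>{t<..t+N}. f (X i w)) \<in> B))
      = emeasure M {w \<in> space M. w \<in> A \<and> (\<Sum>i\<in>{t<..t+N}. f (X i w)) \<in> B}" by (simp add: emeasure_eq_measure)
    also have "\<dots> = (\<integral>\<^sup>+w. indicator {w \<in> space M. w \<in> A \<and> (\<Sum>i\<in>{t<..t+N}. f (X i w)) \<in> B} w \<partial>M)"
      by (intro nn_integral_indicator[symmetric]) measurable
    also have "\<dots> = (\<integral>\<^sup>+w. indicator A w * indicator B (0 + (\<Sum>i\<in>{t<..t+N}. f (X i w))) \<partial>M)"
      by (intro nn_integral_cong) (auto simp: indicator_def)
    also have "\<dots> = (\<integral>\<^sup>+w. indicator A w * h 0 (X t w) \<partial>M)"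
      by (rule IH[OF t _ A]) simp
    also have "\<dots> = (\<integral>\<^sup>+w. ennreal (indicator A w * H (X t w)) \<partial>M)"
      by (intro nn_integral_cong) (simp add: hH measurable_space[OF X_measurable[OF t]] indicator_def)
    also have "\<dots> = ennreal (expectation (\<lambda>w. indicator A w * H (X t w)))"
      by (intro nn_integral_eq_integral integrable_const_bound[where B=1])
        (auto simp: indicator_def H01)
    finally show "\<P>(w in M. w \<in> A \<and> (\<Sum>i\<in>{t<..t+N}. f (X i w)) \<in> B) = expectation (\<lambda>w. indicator A w * H (X t w))"
      by (subst (asm) ennreal_inj) (auto intro!: integral_nonneg_AE simp: H01)
  qed
qed

end

section \<open>Mixing\<close>

lemma tv_dist_upper:
  assumes "prob_space \<mu>" "prob_space \<nu>" "A \<in> sets \<nu>"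
  shows "\<bar>measure \<mu> A - measure \<nu> A\<bar> \<le> tv_dist \<mu> \<nu>"
  unfolding tv_dist_def
proof (rule cSUP_upper[OF assms(3)])
  interpret m: prob_space \<mu> by fact
  interpret n: prob_space \<nu> by fact
  have "\<bar>measure \<mu> A - measure \<nu> A\<bar> \<le> 1" for A
    using m.prob_le_1[of A] n.prob_le_1[of A] measure_nonneg[of \<mu> A] measure_nonneg[of \<nu> A] by linarith
  then show "bdd_above ((\<lambda>A. \<bar>measure \<mu> A - measure \<nu> A\<bar>) ` sets \<nu>)"
    by (intro bdd_aboveI[where M=1]) auto
qed

text \<open>Layer cake: up to 1/K, \<open>h\<close> is the average of the indicators of the sets
  where \<open>K * h\<close> is at least j, for j = 1..K. Each set changes its measure by at most
  \<open>tv_dist\<close>, so the average does too. As \<open>tv_dist\<close> is a supremum over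
  events, no factor 2 appears.\<close>

lemma integral_diff_le_tv_dist:
  fixes h :: "'a \<Rightarrow> real"
  assumes mu: "prob_space \<mu>" and nu: "prob_space \<nu>" and s: "sets \<mu> = sets \<nu>"
    and h [measurable]: "h \<in> borel_measurable \<nu>" and h01: "\<And>x. 0 \<le> h x" "\<And>x. h x \<le> 1"
  shows "(\<integral>x. h x \<partial>\<mu>) \<le> (\<integral>x. h x \<partial>\<nu>) + tv_dist \<mu> \<nu>"
proof -
  interpret m: prob_space \<mu> by fact
  interpret n: prob_space \<nu> by fact
  have hm [measurable]: "h \<in> borel_measurable \<mu>" using h s by (simp cong: measurable_cong_sets)
  have sp: "space \<mu> = space \<nu>" by (rule sets_eq_imp_space_eq[OF s])
  have intm: "integrable \<mu> h" and intn: "integrable \<nu> h"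
    by (auto intro!: m.integrable_const_bound[where B=1] n.integrable_const_bound[where B=1] simp: h01)
  have key: "(\<integral>x. h x \<partial>\<mu>) \<le> (\<integral>x. h x \<partial>\<nu>) + tv_dist \<mu> \<nu> + 1 / real (Suc k)" for k
  proof -
    define K where "K = real (Suc k)"
    have K: "K > 0" by (simp add: K_def)
    define A where "A j = {x \<in> space \<nu>. real j \<le> K * h x}" for j :: nat
    have A [measurable]: "A j \<in> sets \<nu>" for j unfolding A_def by measurable
    have A' [measurable]: "A j \<in> sets \<mu>" for j using A s by simp
    define g where "g x = (\<Sum>j = 1..Suc k. indicator (A j) x) / K" for x
    have gx: "g x \<le> h x" "h x \<le> g x + 1 / K" if x: "x \<in> space \<nu>" for x
    proof -
      define n where "n = nat \<lfloor>K * h x\<rfloor>"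
      have Kh: "0 \<le> K * h x" "K * h x \<le> K" using K h01[of x] by (simp_all add: mult_left_le)
      have n: "real n \<le> K * h x" "K * h x < real n + 1" using Kh unfolding n_def by linarith+
      have nk: "n \<le> Suc k"
      proof -
        have "real n \<le> K" using n Kh by linarith
        then show ?thesis unfolding K_def by (simp only: of_nat_le_iff)
      qed
      have "(\<Sum>j = 1..Suc k. indicator (A j) x :: real) = (\<Sum>j = 1..Suc k. if j \<le> n then 1 else 0)"
      proof (rule sum.cong[OF refl])
        fix j
        have "real j \<le> K * h x \<longleftrightarrow> j \<le> n" using n by linarith
        then show "(indicator (A j) x :: real) = (if j \<le> n then 1 else 0)" using x by (simp add: A_def indicator_def)
      qed
      also have "\<dots> = real (card {j \<in> {1..Suc k}. j \<le> n})"
      proof -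
        have "(\<Sum>j\<in>S. if j \<le> n then 1 else 0 :: real) = real (card {j \<in> S. j \<le> n})" if "finite S" for S
          using that by (simp flip: sum.inter_filter)
        then show ?thesis by blast
      qed
      also have "{j \<in> {1..Suc k}. j \<le> n} = {1..n}" using nk by auto
      finally have "g x = real n / K" by (simp add: g_def)
      moreover have "h x = K * h x / K" using K by simp
      ultimately show "g x \<le> h x" "h x \<le> g x + 1 / K"
        using n K divide_right_mono[of "real n" "K * h x" K] divide_right_mono[of "K * h x" "real n + 1" K]
        by (simp_all only: add_divide_distrib[symmetric])
    qed
    have intg: "(\<integral>x. g x \<partial>M) = (\<Sum>j = 1..Suc k. measure M (A j)) / K"
      if "prob_space M" "sets M = sets \<nu>" for M
    proof -
      interpret prob_space M by fact
      have "\<And>j. A j \<in> sets M" using that(2) by simp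
      then show ?thesis unfolding g_def by (simp add: Int_absorb1 sets.sets_into_space emeasure_eq_measure)
    qed
    have gi: "integrable \<mu> g" "integrable \<nu> g" unfolding g_def by (auto simp: m.emeasure_eq_measure n.emeasure_eq_measure)
    have "(\<integral>x. h x \<partial>\<mu>) \<le> (\<integral>x. g x + 1 / K \<partial>\<mu>)"
      using gi intm by (intro integral_mono) (auto simp: sp gx)
    also have "\<dots> = (\<Sum>j = 1..Suc k. measure \<mu> (A j)) / K + 1 / K"
      using gi intg[OF mu s] by (simp add: m.prob_space)
    also have "(\<Sum>j = 1..Suc k. measure \<mu> (A j)) \<le> (\<Sum>j = 1..Suc k. measure \<nu> (A j) + tv_dist \<mu> \<nu>)"
    proof (rule sum_mono)
      fix j show "measure \<mu> (A j) \<le> measure \<nu> (A j) + tv_dist \<mu> \<nu>"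
        using tv_dist_upper[OF mu nu A, of j] by linarith
    qed
    also have "\<dots> = (\<Sum>j = 1..Suc k. measure \<nu> (A j)) + K * tv_dist \<mu> \<nu>"
      by (simp only: sum.distrib sum_constant) (simp add: K_def)
    finally have "(\<integral>x. h x \<partial>\<mu>) \<le> ((\<Sum>j = 1..Suc k. measure \<nu> (A j)) + K * tv_dist \<mu> \<nu>) / K + 1 / K"
      using K by (simp add: divide_right_mono)
    also have "\<dots> = (\<integral>x. g x \<partial>\<nu>) + tv_dist \<mu> \<nu> + 1 / K"
      using K intg[OF nu] by (simp add: add_divide_distrib)
    also have "(\<integral>x. g x \<partial>\<nu>) \<le> (\<integral>x. h x \<partial>\<nu>)"
      using gi intn by (intro integral_mono) (auto simp: gx)
    finally show ?thesis by (simp add: K_def)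
  qed
  have "(\<lambda>k. (\<integral>x. h x \<partial>\<nu>) + tv_dist \<mu> \<nu> + 1 / real (Suc k)) \<longlonglongrightarrow> (\<integral>x. h x \<partial>\<nu>) + tv_dist \<mu> \<nu> + 0"
    using lim_1_over_n by (intro tendsto_add tendsto_const LIMSEQ_Suc[of "\<lambda>n. 1 / real n"])
  then show ?thesis using key by (intro LIMSEQ_le_const) auto
qed

text \<open>Power mean inequality \<open>(sum a)^rho <= b^(rho-1) * sum a^rho\<close>, divided by
  \<open>x^rho\<close> so as to play the role of Markov's inequality for block sums. It is Young's
  inequality for each summand against \<open>x / b\<close>, the average value at which the sum
  reaches \<open>x\<close>.\<close>

lemma powr_sum_lower:
  fixes a :: "'i \<Rightarrow> real"
  assumes I: "finite I" "card I = b" "b > 0" and a: "\<And>i. i \<in> I \<Longrightarrow> 0 \<le> a i" and x: "0 < x" and S: "x < (\<Sum>i\<in>I. a i)"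
    and \<rho>: "\<rho> > 1"
  shows "1 < (\<Sum>i\<in>I. real b powr (\<rho> - 1) / x powr \<rho> * a i powr \<rho>)"
proof -
  define y where "y = x / real b"
  have y: "y > 0" using x I by (simp add: y_def)
  let ?q = "\<rho> / (\<rho> - 1)"
  have "y powr (\<rho> - 1) * a i \<le> a i powr \<rho> / \<rho> + y powr \<rho> * ((\<rho> - 1) / \<rho>)" if "i \<in> I" for i
  proof (cases "a i = 0")
    case False
    then have "a i > 0" using a[OF that] by simp
    then have "a i * y powr (\<rho> - 1) \<le> a i powr \<rho> / \<rho> + (y powr (\<rho> - 1)) powr ?q / ?q"
      using \<rho> y by (intro Youngs_inequality) (auto simp: field_simps)
    also have "(y powr (\<rho> - 1)) powr ?q = y powr \<rho>" using \<rho> by (simp add: powr_powr)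
    finally show ?thesis by (simp add: mult.commute)
  qed (use \<rho> y in simp)
  then have "(\<Sum>i\<in>I. y powr (\<rho> - 1) * a i) \<le> (\<Sum>i\<in>I. a i powr \<rho> / \<rho> + y powr \<rho> * ((\<rho> - 1) / \<rho>))"
    by (rule sum_mono)
  then have "y powr (\<rho> - 1) * (\<Sum>i\<in>I. a i) \<le> (\<Sum>i\<in>I. a i powr \<rho>) / \<rho> + real b * (y powr \<rho> * ((\<rho> - 1) / \<rho>))"
    using I by (simp add: sum.distrib sum_distrib_left sum_divide_distrib)
  moreover have "y powr (\<rho> - 1) * x < y powr (\<rho> - 1) * (\<Sum>i\<in>I. a i)"
    using S y by simp
  moreover have "y powr (\<rho> - 1) * x = real b * y powr \<rho>"
    using y x I by (simp add: powr_diff y_def)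
  ultimately have "real b * y powr \<rho> < (\<Sum>i\<in>I. a i powr \<rho>) / \<rho> + real b * (y powr \<rho> * ((\<rho> - 1) / \<rho>))" by linarith
  then have "\<rho> * (real b * y powr \<rho>) < (\<Sum>i\<in>I. a i powr \<rho>) + real b * (y powr \<rho> * (\<rho> - 1))"
    using \<rho> by (simp add: field_simps)
  then have "real b * y powr \<rho> < (\<Sum>i\<in>I. a i powr \<rho>)" by (simp add: algebra_simps)
  also have "real b * y powr \<rho> = x powr \<rho> / real b powr (\<rho> - 1)"
    using x I by (simp add: y_def powr_divide powr_diff)
  finally show ?thesis
    using x I by (subst sum_distrib_left[symmetric]) (simp add: field_simps)
qed

section \<open>Mixing of a polynomially ergodic chain\<close>

locale poly_chain = kernel_chain M F P X + F: prob_space F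
  for M :: "'w measure" and F :: "'a measure" and P :: "'a \<Rightarrow> 'a measure" and X :: "nat \<Rightarrow> 'w \<Rightarrow> 'a" +
  fixes V :: "'a \<Rightarrow> real" and m :: real
  assumes V0: "\<And>x. x \<in> space F \<Longrightarrow> 0 \<le> V x" and V_int: "integrable F V" and m0: "m > 0"
    and ergodic: "\<And>x n. x \<in> space F \<Longrightarrow> n \<ge> 1 \<Longrightarrow> tv_dist (kernel_pow F P n x) F \<le> V x * real n powr - m"
begin

lemma V_meas [measurable]: "V \<in> borel_measurable F" using V_int by simp

text \<open>The cut-off at 1 is harmless for probabilities and keeps the error integrable under
  every law, whereas \<open>V (X t)\<close> need not be; it also makes the error itself an
  admissible \<open>h\<close> in the lemmas below. \<open>max 0\<close> is for points outside
  \<open>space F\<close>.\<close>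

definition mix_error :: "nat \<Rightarrow> 'a \<Rightarrow> real" where "mix_error n x = min 1 (max 0 (V x) * real n powr - m)"

lemma mix_error_measurable [measurable]: "mix_error n \<in> borel_measurable F" unfolding mix_error_def by measurable
lemma mix_error_bounds: "0 \<le> mix_error n x" "mix_error n x \<le> 1" by (simp_all add: mix_error_def)

lemma kernel_pow_integral_le:
  fixes h :: "'a \<Rightarrow> real"
  assumes x: "x \<in> space F" and n: "n \<ge> 1" and [measurable]: "h \<in> borel_measurable F" and h01: "\<And>x. 0 \<le> h x" "\<And>x. h x \<le> 1"
  shows "(\<integral>z. h z \<partial>kernel_pow F P n x) \<le> (\<integral>z. h z \<partial>F) + mix_error n x"
proof -
  let ?K = "kernel_pow F P n x"
  have K: "prob_space ?K" "sets ?K = sets F"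
    using measurable_space[OF kernel_pow_measurable x] by (auto simp: space_prob_algebra)
  interpret K: prob_space ?K by fact
  have hK [measurable]: "h \<in> borel_measurable ?K" using K(2) by (simp cong: measurable_cong_sets)
  have "(\<integral>z. h z \<partial>?K) \<le> (\<integral>z. h z \<partial>F) + tv_dist ?K F"
    by (rule integral_diff_le_tv_dist[OF K(1) F.prob_space_axioms K(2)]) (auto simp: h01)
  also have "tv_dist ?K F \<le> V x * real n powr - m" by (rule ergodic[OF x n])
  finally have 1: "(\<integral>z. h z \<partial>?K) \<le> (\<integral>z. h z \<partial>F) + V x * real n powr - m" by simp
  have "(\<integral>z. h z \<partial>?K) \<le> (\<integral>z. 1 \<partial>?K)"
    by (intro integral_mono K.integrable_const_bound[where B=1]) (auto simp: h01)
  then have 2: "(\<integral>z. h z \<partial>?K) \<le> 1" by (simp add: K.prob_space)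
  have "0 \<le> (\<integral>z. h z \<partial>F)" by (simp add: h01)
  then show ?thesis using 1 2 V0[OF x] by (simp add: mix_error_def min_def)
qed

lemma mixing:
  fixes h :: "'a \<Rightarrow> real"
  assumes t: "t \<ge> 1" and A: "A \<in> sets (past t)" and n: "n \<ge> 1"
    and h [measurable]: "h \<in> borel_measurable F" and h01: "\<And>x. 0 \<le> h x" "\<And>x. h x \<le> 1"
  shows "expectation (\<lambda>w. indicator A w * h (X (t + n) w))
     \<le> prob A * (\<integral>x. h x \<partial>F) + expectation (\<lambda>w. indicator A w * mix_error n (X t w))"
proof -
  have [measurable]: "A \<in> sets M" by (rule sets_past[OF A])
  have [measurable]: "X t \<in> M \<rightarrow>\<^sub>M F" "X (t + n) \<in> M \<rightarrow>\<^sub>M F" using t by (auto intro: X_measurable)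
  have K: "prob_space (kernel_pow F P n (X t w))" "sets (kernel_pow F P n (X t w)) = sets F" if "w \<in> space M" for w
    using measurable_space[OF kernel_pow_measurable measurable_space[OF X_measurable[OF t] that]]
    by (auto simp: space_prob_algebra)
  have ii: "integrable M (\<lambda>w. indicator A w * g (X s w))"
    if "g \<in> borel_measurable F" "\<And>x. 0 \<le> g x" "\<And>x. g x \<le> 1" "s \<ge> 1" for s and g :: "'a \<Rightarrow> real"
    using that X_measurable[OF that(4)] by (intro integrable_const_bound[where B=1]) (auto simp: indicator_def)
  have F0: "0 \<le> (\<integral>x. h x \<partial>F)" by (simp add: h01)
  have F1: "(\<integral>x. h x \<partial>F) \<le> 1"
    using F.integral_le_const[of h 1] by (simp add: h01 F.integrable_const_bound[where B=1])
  have "ennreal (expectation (\<lambda>w. indicator A w * h (X (t + n) w)))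
     = (\<integral>\<^sup>+w. ennreal (indicator A w * h (X (t + n) w)) \<partial>M)"
    using t by (intro nn_integral_eq_integral[symmetric] ii) (auto simp: h01)
  also have "\<dots> = (\<integral>\<^sup>+w. indicator A w * ennreal (h (X (t + n) w)) \<partial>M)"
    by (intro nn_integral_cong) (simp add: indicator_def)
  also have "\<dots> = (\<integral>\<^sup>+w. indicator A w * (\<integral>\<^sup>+z. ennreal (h z) \<partial>kernel_pow F P n (X t w)) \<partial>M)"
    by (rule n_step[OF t A]) simp
  also have "\<dots> \<le> (\<integral>\<^sup>+w. ennreal (indicator A w * (\<integral>x. h x \<partial>F) + indicator A w * mix_error n (X t w)) \<partial>M)"
  proof (intro nn_integral_mono)
    fix w assume w: "w \<in> space M"
    interpret K: prob_space "kernel_pow F P n (X t w)" by (rule K(1)[OF w])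
    have [measurable]: "h \<in> borel_measurable (kernel_pow F P n (X t w))" using K(2)[OF w] by (simp cong: measurable_cong_sets)
    have "(\<integral>\<^sup>+z. ennreal (h z) \<partial>kernel_pow F P n (X t w)) = ennreal (\<integral>z. h z \<partial>kernel_pow F P n (X t w))"
      by (intro nn_integral_eq_integral K.integrable_const_bound[where B=1]) (auto simp: h01)
    also have "\<dots> \<le> ennreal ((\<integral>x. h x \<partial>F) + mix_error n (X t w))"
      by (intro ennreal_leI kernel_pow_integral_le n measurable_space[OF X_measurable[OF t] w]) (auto simp: h01)
    finally show "indicator A w * (\<integral>\<^sup>+z. ennreal (h z) \<partial>kernel_pow F P n (X t w))
       \<le> ennreal (indicator A w * (\<integral>x. h x \<partial>F) + indicator A w * mix_error n (X t w))"
      by (simp add: indicator_def)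
  qed
  also have "\<dots> = ennreal (expectation (\<lambda>w. indicator A w * (\<integral>x. h x \<partial>F) + indicator A w * mix_error n (X t w)))"
    using t F0 F1 by (intro nn_integral_eq_integral Bochner_Integration.integrable_add ii)
      (auto simp: mix_error_bounds emeasure_eq_measure)
  also have "expectation (\<lambda>w. indicator A w * (\<integral>x. h x \<partial>F) + indicator A w * mix_error n (X t w))
     = prob A * (\<integral>x. h x \<partial>F) + expectation (\<lambda>w. indicator A w * mix_error n (X t w))"
    using t by (subst Bochner_Integration.integral_add) (auto intro!: ii simp: mix_error_bounds emeasure_eq_measure Int_absorb1 sets.sets_into_space)
  finally show ?thesis
    using F0 by (subst (asm) ennreal_le_iff) (auto intro!: add_nonneg_nonneg integral_nonneg_AE mult_nonneg_nonneg simp: mix_error_bounds)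
qed

definition mean_mix_error :: "nat \<Rightarrow> real" where "mean_mix_error n = expectation (\<lambda>w. mix_error n (X 1 w))"

lemma mean_mix_error_nonneg: "0 \<le> mean_mix_error n" unfolding mean_mix_error_def by (intro integral_nonneg_AE) (simp add: mix_error_bounds)

text \<open>\<open>mixing\<close> for \<open>1 - h\<close> gives the converse direction:
  probabilities under \<open>F\<close> are bounded by those of the actual chain, the only ones that
  the limit theorem controls.\<close>

lemma stationary_le:
  fixes h :: "'a \<Rightarrow> real"
  assumes n: "n \<ge> 1" and h [measurable]: "h \<in> borel_measurable F" and h01: "\<And>x. 0 \<le> h x" "\<And>x. h x \<le> 1"
  shows "(\<integral>x. h x \<partial>F) \<le> expectation (\<lambda>w. h (X (1 + n) w)) + mean_mix_error n"
proof -
  have [measurable]: "X (1 + n) \<in> M \<rightarrow>\<^sub>M F" by (auto intro: X_measurable)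
  have sp: "space M \<in> sets (past 1)" using sets.top[of "past 1"] by simp
  have i1: "integrable M (\<lambda>w. h (X (1 + n) w))"
    by (intro integrable_const_bound[where B=1]) (auto simp: h01)
  have i2: "integrable F h" by (intro F.integrable_const_bound[where B=1]) (auto simp: h01)
  have "expectation (\<lambda>w. indicator (space M) w * (1 - h (X (1 + n) w)))
     \<le> prob (space M) * (\<integral>x. 1 - h x \<partial>F) + expectation (\<lambda>w. indicator (space M) w * mix_error n (X 1 w))"
    by (rule mixing[OF _ sp n]) (auto simp: h01)
  moreover have "expectation (\<lambda>w. indicator (space M) w * (1 - h (X (1 + n) w))) = 1 - expectation (\<lambda>w. h (X (1 + n) w))"
    using i1 by (subst Bochner_Integration.integral_cong[OF refl, of _ _ "\<lambda>w. 1 - h (X (1 + n) w)"]) (auto simp: prob_space)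
  moreover have "expectation (\<lambda>w. indicator (space M) w * mix_error n (X 1 w)) = mean_mix_error n"
    unfolding mean_mix_error_def by (intro Bochner_Integration.integral_cong) auto
  moreover have "(\<integral>x. 1 - h x \<partial>F) = 1 - (\<integral>x. h x \<partial>F)" using i2 by (simp add: F.prob_space)
  ultimately show ?thesis by (simp add: prob_space)
qed

text \<open>Dominated convergence, hence without a rate: \<open>V (X 1)\<close> may fail to be
  integrable under the initial law. Where a rate is needed, \<open>low\<close> takes over.\<close>

lemma mean_mix_error_tendsto: "mean_mix_error \<longlonglongrightarrow> 0"
proof -
  have "(\<lambda>n. expectation (\<lambda>w. mix_error n (X 1 w))) \<longlonglongrightarrow> expectation (\<lambda>w. 0)"
  proof (rule integral_dominated_convergence[where w="\<lambda>_. 1"])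
    show "AE w in M. (\<lambda>n. mix_error n (X 1 w)) \<longlonglongrightarrow> 0"
    proof (rule AE_I2)
      fix w
      have "(\<lambda>n. real n powr - m) \<longlonglongrightarrow> 0"
        by (rule tendsto_neg_powr[OF _ filterlim_real_sequentially]) (simp add: m0)
      then have "(\<lambda>n. min 1 (max 0 (V (X 1 w)) * real n powr - m)) \<longlonglongrightarrow> min 1 (max 0 (V (X 1 w)) * 0)"
        by (intro tendsto_min tendsto_const tendsto_mult)
      then show "(\<lambda>n. mix_error n (X 1 w)) \<longlonglongrightarrow> 0" by (simp add: mix_error_def)
    qed
  qed (auto simp: mix_error_bounds)
  then show ?thesis by (simp add: mean_mix_error_def[abs_def])
qed

section \<open>Events on which the initial constant is bounded\<close>

definition low :: "real \<Rightarrow> 'w set" where "low R = {w \<in> space M. V (X 1 w) \<le> R}"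

lemma low_past: "low R \<in> sets (past t)" if "t \<ge> 1"
proof -
  have [measurable]: "X 1 \<in> past t \<rightarrow>\<^sub>M F" using that by (intro X_past) auto
  have "{w \<in> space (past t). V (X 1 w) \<le> R} \<in> sets (past t)" by measurable
  then show ?thesis by (simp add: low_def)
qed

lemma low_measurable [measurable]: "low R \<in> sets M"
  using low_past[of 1] by (auto intro: sets_past)

text \<open>On \<open>low R\<close> the error of mixing from time 1 is at most
  \<open>R * real n powr - m\<close>, which supplies the rate that \<open>mean_mix_error\<close>
  lacks.\<close>

lemma low_expectation:
  fixes h :: "'a \<Rightarrow> real"
  assumes n: "n \<ge> 1" and h [measurable]: "h \<in> borel_measurable F" and h01: "\<And>x. 0 \<le> h x" "\<And>x. h x \<le> 1" and R: "R \<ge> 0"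
  shows "expectation (\<lambda>w. indicator (low R) w * h (X (1 + n) w)) \<le> (\<integral>x. h x \<partial>F) + R * real n powr - m"
proof -
  have "expectation (\<lambda>w. indicator (low R) w * h (X (1 + n) w))
     \<le> prob (low R) * (\<integral>x. h x \<partial>F) + expectation (\<lambda>w. indicator (low R) w * mix_error n (X 1 w))"
    by (rule mixing[OF _ low_past n]) (auto simp: h01)
  also have "prob (low R) * (\<integral>x. h x \<partial>F) \<le> 1 * (\<integral>x. h x \<partial>F)"
    by (intro mult_right_mono) (auto simp: h01)
  also have "expectation (\<lambda>w. indicator (low R) w * mix_error n (X 1 w)) \<le> expectation (\<lambda>w. R * real n powr - m)"
  proof (intro integral_mono)
    show "integrable M (\<lambda>w. indicator (low R) w * mix_error n (X 1 w))"
      by (rule integrable_const_bound[where B=1]) (auto simp: mix_error_bounds indicator_def)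
    fix w assume "w \<in> space M"
    show "indicator (low R) w * mix_error n (X 1 w) \<le> R * real n powr - m"
    proof (cases "w \<in> low R")
      case True
      then have "max 0 (V (X 1 w)) \<le> R" using R by (simp add: low_def)
      then have "max 0 (V (X 1 w)) * real n powr - m \<le> R * real n powr - m" by (intro mult_right_mono) auto
      then show ?thesis using True by (simp add: mix_error_def)
    qed (use R in simp)
  qed simp
  finally show ?thesis by (simp add: prob_space)
qed

lemma low_exhausts: "\<epsilon> > 0 \<Longrightarrow> \<exists>R\<ge>0. prob (space M - low R) < \<epsilon>"
proof -
  assume eps: "\<epsilon> > 0"
  have "(\<lambda>n. prob (low (real n))) \<longlonglongrightarrow> prob (\<Union>n. low (real n))"
  proof (rule finite_Lim_measure_incseq)
    show "range (\<lambda>n. low (real n)) \<subseteq> sets M" by auto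
    show "incseq (\<lambda>n. low (real n))"
      unfolding incseq_def low_def by (auto intro: order_trans)
  qed
  moreover have "(\<Union>n. low (real n)) = space M"
    using real_arch_simple by (auto simp: low_def)
  ultimately have "(\<lambda>n. prob (low (real n))) \<longlonglongrightarrow> 1" by (simp add: prob_space)
  then have "\<forall>\<^sub>F n in sequentially. prob (low (real n)) > 1 - \<epsilon>"
    using eps by (intro order_tendstoD) auto
  then obtain n where "prob (low (real n)) > 1 - \<epsilon>" by (auto simp: eventually_sequentially)
  then show ?thesis using prob_compl[OF low_measurable, of "real n"] by (intro exI[of _ "real n"]) simp
qed

text \<open>The gap of \<open>b\<close> steps brings the chain close to \<open>F\<close>, whatever
  the past event; from \<open>F\<close> one returns to the actual chain at time \<open>u\<close>.
  The time \<open>u\<close> is free, so that the increment can be studied where its size is known;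
  \<open>u \<ge> 2\<close> leaves at least one step for mixing from time 1.\<close>

lemma decoupling:
  fixes f :: "'a \<Rightarrow> 'v::euclidean_space"
  assumes f [measurable]: "f \<in> borel_measurable F" and B [measurable]: "B \<in> sets borel"
    and t: "t \<ge> 1" and A: "A \<in> sets (past t)" and b: "b \<ge> 1" and u: "u \<ge> 2"
  shows "\<P>(w in M. w \<in> A \<and> (\<Sum>i\<in>{t+b<..t+b+N}. f (X i w)) \<in> B)
     \<le> prob A * (\<P>(w in M. (\<Sum>i\<in>{u<..u+N}. f (X i w)) \<in> B) + mean_mix_error (u - 1))
        + expectation (\<lambda>w. indicator A w * mix_error b (X t w))"
proof -
  obtain H :: "'a \<Rightarrow> real" where H [measurable]: "H \<in> borel_measurable F" and H01: "\<And>y. 0 \<le> H y" "\<And>y. H y \<le> 1"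
    and HH: "\<And>t A. t \<ge> 1 \<Longrightarrow> A \<in> sets (past t) \<Longrightarrow>
       \<P>(w in M. w \<in> A \<and> (\<Sum>i\<in>{t<..t+N}. f (X i w)) \<in> B) = expectation (\<lambda>w. indicator A w * H (X t w))"
    by (rule future_probability[OF f B, of N]) (rule that, assumption+)
  have sp: "space M \<in> sets (past u)" using sets.top[of "past u"] by simp
  have "\<P>(w in M. w \<in> A \<and> (\<Sum>i\<in>{t+b<..t+b+N}. f (X i w)) \<in> B) = expectation (\<lambda>w. indicator A w * H (X (t + b) w))"
    using t by (intro HH sets_past_mono[OF _ A]) auto
  also have "\<dots> \<le> prob A * (\<integral>x. H x \<partial>F) + expectation (\<lambda>w. indicator A w * mix_error b (X t w))"
    by (rule mixing[OF t A b H H01])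
  also have "(\<integral>x. H x \<partial>F) \<le> expectation (\<lambda>w. H (X (1 + (u - 1)) w)) + mean_mix_error (u - 1)"
    using u by (intro stationary_le H H01) auto
  also have "expectation (\<lambda>w. H (X (1 + (u - 1)) w)) = expectation (\<lambda>w. indicator (space M) w * H (X u w))"
    using u by (intro Bochner_Integration.integral_cong) auto
  also have "\<dots> = \<P>(w in M. w \<in> space M \<and> (\<Sum>i\<in>{u<..u+N}. f (X i w)) \<in> B)"
    using u by (intro HH[OF _ sp, symmetric]) auto
  finally show ?thesis by (simp add: mult_left_mono)
qed

end

section \<open>Maximal inequalities and the condition of Anscombe\<close>

text \<open>The event in Anscombe's condition. The window is two-sided and proportional to
  \<open>n\<close>, since the stopping time is known only up to a factor close to 1.\<close>

abbreviation oscillates :: "(nat \<Rightarrow> 'w \<Rightarrow> 'v::real_normed_vector) \<Rightarrow> real \<Rightarrow> nat \<Rightarrow> real \<Rightarrow> 'w \<Rightarrow> bool" where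
  "oscillates Z d n y w \<equiv> \<exists>k. \<bar>real k - real n\<bar> \<le> d * real n \<and> norm (Z k w - Z n w) > y"

section \<open>Increments over blocks and their maxima\<close>

context poly_chain begin

definition inc :: "('a \<Rightarrow> 'v::euclidean_space) \<Rightarrow> nat \<Rightarrow> nat \<Rightarrow> 'w \<Rightarrow> 'v" where
  "inc f s n w = (\<Sum>i\<in>{s<..s+n}. f (X i w))"

lemma inc_0 [simp]: "inc f s 0 w = 0" by (simp add: inc_def)

lemma inc_add: "inc f s (n + k) w = inc f s n w + inc f (s + n) k w"
proof -
  have "{s<..s+(n+k)} = {s<..s+n} \<union> {s+n<..s+n+k}" by auto
  then show ?thesis unfolding inc_def by (simp add: sum.union_disjoint[of "{s<..s+n}"] ivl_disj_int)
qed

lemma inc_measurable [measurable]: "f \<in> borel_measurable F \<Longrightarrow> inc f s n \<in> borel_measurable M"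
  unfolding inc_def[abs_def]
  by (intro borel_measurable_sum, rule measurable_compose[OF X_measurable]) auto

lemma inc_past: "f \<in> borel_measurable F \<Longrightarrow> s + n \<le> t \<Longrightarrow> inc f s n \<in> borel_measurable (past t)"
  unfolding inc_def[abs_def]
  by (intro borel_measurable_sum, rule measurable_compose[OF X_past]) auto

text \<open>Inside a block no cancellation is used. This is affordable because a block will be much
  shorter than the square root of the sample size.\<close>

lemma norm_inc_le:
  assumes "j \<le> b"
  shows "norm (inc f s j w) \<le> inc (\<lambda>x. norm (f x)) s b w"
proof -
  have "norm (inc f s j w) \<le> (\<Sum>i\<in>{s<..s+j}. norm (f (X i w)))" unfolding inc_def by (rule norm_sum)
  also have "\<dots> \<le> (\<Sum>i\<in>{s<..s+b}. norm (f (X i w)))" using assms by (intro sum_mono2) auto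
  finally show ?thesis by (simp add: inc_def)
qed

text \<open>By \<open>powr_sum_lower\<close> a large block sum forces the sum of the scaled powers
  above 1, and it stays at least 1 after each term is cut off at 1. The cut-off terms may be
  compared with \<open>F\<close>, at cost \<open>R * real s powr - m\<close> each, and under
  \<open>F\<close> the moment bound replaces the cut-off.\<close>

lemma block_bound:
  fixes f :: "'a \<Rightarrow> 'v::euclidean_space"
  assumes f [measurable]: "f \<in> borel_measurable F" and \<rho>: "\<rho> > 1" and int: "integrable F (\<lambda>x. norm (f x) powr \<rho>)"
    and t: "s \<le> t" "s \<ge> 1" and b: "b \<ge> 1" and x: "x > 0" and R: "R \<ge> 0"
  shows "\<P>(w in M. w \<in> low R \<and> inc (\<lambda>x. norm (f x)) t b w > x)
     \<le> real b * (real b powr (\<rho> - 1) / x powr \<rho> * (\<integral>x. norm (f x) powr \<rho> \<partial>F) + R * real s powr - m)"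
proof -
  define c where "c = real b powr (\<rho> - 1) / x powr \<rho>"
  define h where "h y = min 1 (c * norm (f y) powr \<rho>)" for y
  have c: "c \<ge> 0" by (simp add: c_def)
  have h01: "0 \<le> h y" "h y \<le> 1" for y using c by (auto simp: h_def)
  have hm [measurable]: "h \<in> borel_measurable F" unfolding h_def by measurable
  have Xi [measurable]: "X i \<in> M \<rightarrow>\<^sub>M F" if "i \<in> {t<..t+b}" for i using that by (intro X_measurable) auto
  have ii: "integrable M (\<lambda>w. indicator (low R) w * h (X i w))" if "i \<in> {t<..t+b}" for i
    using Xi[OF that] by (intro integrable_const_bound[where B=1]) (auto simp: h01 indicator_def)
  let ?E = "{w \<in> space M. w \<in> low R \<and> inc (\<lambda>x. norm (f x)) t b w > x}"
  have E [measurable]: "?E \<in> sets M" by measurable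
  have "prob ?E = expectation (indicator ?E)" by simp
  also have "\<dots> \<le> expectation (\<lambda>w. \<Sum>i\<in>{t<..t+b}. indicator (low R) w * h (X i w))"
  proof (rule integral_mono)
    show "integrable M (indicator ?E :: _ \<Rightarrow> real)" by (simp add: emeasure_eq_measure)
    show "integrable M (\<lambda>w. \<Sum>i\<in>{t<..t+b}. indicator (low R) w * h (X i w))" by (intro Bochner_Integration.integrable_sum ii)
    fix w assume "w \<in> space M"
    show "indicator ?E w \<le> (\<Sum>i\<in>{t<..t+b}. indicator (low R) w * h (X i w))"
    proof (cases "w \<in> ?E")
      case True
      then have "x < (\<Sum>i\<in>{t<..t+b}. norm (f (X i w)))" by (simp add: inc_def)
      then have "1 < (\<Sum>i\<in>{t<..t+b}. c * norm (f (X i w)) powr \<rho>)"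
        unfolding c_def by (intro powr_sum_lower) (use b x \<rho> in auto)
      \<comment> \<open>Either some term reaches 1 by itself or the cut-off changes nothing.\<close>
      moreover have "1 \<le> (\<Sum>i\<in>I. min 1 (a i))" if "finite I" "1 < (\<Sum>i\<in>I. a i)" "\<And>i. i \<in> I \<Longrightarrow> 0 \<le> a i" for I :: "nat set" and a :: "nat \<Rightarrow> real"
      proof (cases "\<exists>i\<in>I. 1 \<le> a i")
        case True
        then obtain i where i: "i \<in> I" "1 \<le> a i" by auto
        have "min 1 (a i) \<le> (\<Sum>i\<in>I. min 1 (a i))" using that i by (intro member_le_sum) auto
        then show ?thesis using i by simp
      next
        case False
        then have "(\<Sum>i\<in>I. min 1 (a i)) = (\<Sum>i\<in>I. a i)" by (intro sum.cong) auto
        then show ?thesis using that by simp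
      qed
      ultimately have "1 \<le> (\<Sum>i\<in>{t<..t+b}. h (X i w))" unfolding h_def using c by auto
      then show ?thesis using True by simp
    qed (auto intro!: sum_nonneg simp: h01 indicator_def)
  qed
  also have "\<dots> = (\<Sum>i\<in>{t<..t+b}. expectation (\<lambda>w. indicator (low R) w * h (X i w)))"
    by (intro Bochner_Integration.integral_sum ii)
  also have "\<dots> \<le> (\<Sum>i\<in>{t<..t+b}. c * (\<integral>x. norm (f x) powr \<rho> \<partial>F) + R * real s powr - m)"
  proof (rule sum_mono)
    fix i assume i: "i \<in> {t<..t+b}"
    have "expectation (\<lambda>w. indicator (low R) w * h (X (1 + (i - 1)) w)) \<le> (\<integral>x. h x \<partial>F) + R * real (i - 1) powr - m"
      using i t by (intro low_expectation R hm h01) auto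
    also have "(\<integral>x. h x \<partial>F) \<le> (\<integral>x. c * norm (f x) powr \<rho> \<partial>F)"
      by (intro integral_mono integrable_mult_right int F.integrable_const_bound[where B=1 and f=h])
        (auto simp: h01, auto simp: h_def)
    also have "\<dots> = c * (\<integral>x. norm (f x) powr \<rho> \<partial>F)" by simp
    also have "R * real (i - 1) powr - m \<le> R * real s powr - m"
      using i t R m0 by (intro mult_left_mono powr_mono2') auto
    finally show "expectation (\<lambda>w. indicator (low R) w * h (X i w)) \<le> c * (\<integral>x. norm (f x) powr \<rho> \<partial>F) + R * real s powr - m"
      using i by simp
  qed
  also have "\<dots> = real b * (c * (\<integral>x. norm (f x) powr \<rho> \<partial>F) + R * real s powr - m)" by simp
  finally show ?thesis by (simp add: c_def)
qed

text \<open>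
  Ottaviani's inequality for block end points: after the first exceedance one block is skipped,
  and the remaining increment is nearly independent of the past.
\<close>

lemma maximal_inequality:
  fixes f :: "'a \<Rightarrow> 'v::euclidean_space"
  assumes f [measurable]: "f \<in> borel_measurable F" and s: "s \<ge> 1" and b: "b \<ge> 1" and x: "x > 0"
    and A: "A \<in> sets (past s)"
    and p0: "\<And>N. N \<le> L * b \<Longrightarrow> \<exists>u\<ge>2. \<P>(w in M. norm (inc f u N w) > x) + mean_mix_error (u - 1) \<le> p\<^sub>0"
  shows "\<P>(w in M. w \<in> A \<and> (\<exists>k\<le>L * b. norm (inc f s k w) > 4 * x))
     \<le> \<P>(w in M. norm (inc f s (L * b) w) > x) + p\<^sub>0
      + (\<Sum>i<L. \<P>(w in M. w \<in> A \<and> inc (\<lambda>x. norm (f x)) (s + i * b) b w > x)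
               + expectation (\<lambda>w. indicator A w * mix_error b (X (s + i * b) w)))"
proof -
  note sets_past[OF A, measurable]
  have p0_nonneg: "p\<^sub>0 \<ge> 0"
  proof -
    obtain u where "\<P>(w in M. norm (inc f u 0 w) > x) + mean_mix_error (u - 1) \<le> p\<^sub>0" using p0[of 0] by auto
    then show ?thesis using mean_mix_error_nonneg[of "u - 1"] measure_nonneg[of M "{w \<in> space M. norm (inc f u 0 w) > x}"] by linarith
  qed
  define U where "U = {w \<in> space M. norm (inc f s (L * b) w) > x}"
  define B where "B i = {w \<in> space M. w \<in> A \<and> inc (\<lambda>x. norm (f x)) (s + i * b) b w > x}" for i
  \<comment> \<open>First exceedance at block ends, with level \<open>3 * x\<close>: one
    \<open>x\<close> is lost from an arbitrary index to the preceding block end, hence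
    \<open>4 * x\<close> in the claim. If the final sum, the skipped block and the remaining
    increment are all at most \<open>x\<close>, the sum at the exceedance is at most
    \<open>3 * x\<close>, a contradiction.\<close>
  define E where "E i = {w \<in> space M. w \<in> A \<and> norm (inc f s (i * b) w) > 3 * x \<and> (\<forall>j<i. norm (inc f s (j * b) w) \<le> 3 * x)}" for i
  define G where "G i = {w \<in> space M. w \<in> E i \<and> norm (inc f (s + i * b + b) ((L - 1 - i) * b) w) > x}" for i
  have [measurable]: "U \<in> sets M" "B i \<in> sets M" "E i \<in> sets M" "G i \<in> sets M" for i
    unfolding U_def B_def E_def G_def by measurable
  have Ep: "E i \<in> sets (past (s + i * b))" for i
  proof -
    \<comment> \<open>\<open>min j i\<close> equals \<open>j\<close> where it is used, but makes the
      statement true for every \<open>j\<close>, as the automatic measurability proof of the bounded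
      quantifier requires.\<close>
    have [measurable]: "inc f s (min j i * b) \<in> borel_measurable (past (s + i * b))" for j
      by (intro inc_past f) auto
    have [measurable]: "inc f s (i * b) \<in> borel_measurable (past (s + i * b))"
      by (intro inc_past f) auto
    have [measurable]: "A \<in> sets (past (s + i * b))" by (rule sets_past_mono[OF _ A]) simp
    have "E i = {w \<in> space (past (s + i * b)). w \<in> A \<and> norm (inc f s (i * b) w) > 3 * x \<and> (\<forall>j<i. norm (inc f s (min j i * b) w) \<le> 3 * x)}"
      by (auto simp: E_def)
    also have "\<dots> \<in> sets (past (s + i * b))" by measurable
    finally show ?thesis .
  qed
  have "{w \<in> space M. w \<in> A \<and> (\<exists>k\<le>L * b. norm (inc f s k w) > 4 * x)} \<subseteq> U \<union> ((\<Union>i<L. B i) \<union> (\<Union>i<L. G i))"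
  proof (intro subsetI, rule ccontr)
    fix w assume w: "w \<in> {w \<in> space M. w \<in> A \<and> (\<exists>k\<le>L * b. norm (inc f s k w) > 4 * x)}"
      and n: "w \<notin> U \<union> ((\<Union>i<L. B i) \<union> (\<Union>i<L. G i))"
    then obtain k where k: "k \<le> L * b" "norm (inc f s k w) > 4 * x" and wM: "w \<in> space M" "w \<in> A" by auto
    have nU: "norm (inc f s (L * b) w) \<le> x" using n wM by (auto simp: U_def)
    have nB: "inc (\<lambda>x. norm (f x)) (s + i * b) b w \<le> x" if "i < L" for i using n wM that by (auto simp: B_def not_less)
    define i0 j where "i0 = k div b" and "j = k mod b"
    have kk: "k = i0 * b + j" "j < b" using b by (simp_all add: i0_def j_def)
    have i0L: "i0 < L"
    proof (rule ccontr)
      assume "\<not> i0 < L"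
      then have "L * b \<le> i0 * b" by simp
      then have "k = L * b" using k kk by linarith
      then show False using k nU x by simp
    qed
    have "norm (inc f s k w) \<le> norm (inc f s (i0 * b) w) + norm (inc f (s + i0 * b) j w)"
      unfolding kk(1) inc_add by (rule norm_triangle_ineq)
    moreover have "norm (inc f (s + i0 * b) j w) \<le> x"
      using norm_inc_le[of j b f "s + i0 * b" w] nB[OF i0L] kk by linarith
    ultimately have ex: "norm (inc f s (i0 * b) w) > 3 * x" using k by linarith
    define i where "i = (LEAST i. norm (inc f s (i * b) w) > 3 * x)"
    have i1: "norm (inc f s (i * b) w) > 3 * x" unfolding i_def using ex by (rule LeastI)
    have i2: "norm (inc f s (j * b) w) \<le> 3 * x" if "j < i" for j using not_less_Least[of j "\<lambda>i. norm (inc f s (i * b) w) > 3 * x"] that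
      unfolding i_def by auto
    have "i \<le> i0" unfolding i_def using ex by (rule Least_le)
    then have iL: "i < L" using i0L by simp
    have wE: "w \<in> E i" using i1 i2 wM by (auto simp: E_def)
    then have nG: "norm (inc f (s + i * b + b) ((L - 1 - i) * b) w) \<le> x" using n wM iL by (auto simp: G_def not_less)
    have Lb: "L * b = i * b + (b + (L - 1 - i) * b)" 
    proof -
      have "L = i + (1 + (L - 1 - i))" using iL by simp
      then have "L * b = (i + (1 + (L - 1 - i))) * b" by (rule arg_cong)
      then show ?thesis by (simp only: add_mult_distrib mult_1)
    qed
    have "inc f s (L * b) w = inc f s (i * b) w + (inc f (s + i * b) b w + inc f (s + i * b + b) ((L - 1 - i) * b) w)"
      unfolding Lb inc_add ..
    then have eq: "inc f s (i * b) w = inc f s (L * b) w - (inc f (s + i * b) b w + inc f (s + i * b + b) ((L - 1 - i) * b) w)"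
      by (simp add: algebra_simps)
    have "norm (inc f s (i * b) w) \<le> norm (inc f s (L * b) w) + (norm (inc f (s + i * b) b w) + norm (inc f (s + i * b + b) ((L - 1 - i) * b) w))"
      by (subst eq) (rule order_trans[OF norm_triangle_ineq4 add_left_mono[OF norm_triangle_ineq]])
    moreover have "norm (inc f (s + i * b) b w) \<le> x"
      using norm_inc_le[of b b f "s + i * b" w] nB[OF iL] by linarith
    ultimately show False using i1 nU nG by linarith
  qed
  then have "\<P>(w in M. w \<in> A \<and> (\<exists>k\<le>L * b. norm (inc f s k w) > 4 * x)) \<le> prob (U \<union> ((\<Union>i<L. B i) \<union> (\<Union>i<L. G i)))"
    by (intro finite_measure_mono) auto
  also have "\<dots> \<le> prob U + (prob (\<Union>i<L. B i) + prob (\<Union>i<L. G i))"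
    by (intro order_trans[OF measure_Un_le] add_left_mono measure_Un_le) auto
  also have "prob (\<Union>i<L. B i) \<le> (\<Sum>i<L. prob (B i))"
    by (intro finite_measure_subadditive_finite) auto
  also have "prob (\<Union>i<L. G i) \<le> (\<Sum>i<L. prob (G i))"
    by (intro finite_measure_subadditive_finite) auto
  also have "(\<Sum>i<L. prob (G i)) \<le> (\<Sum>i<L. prob (E i) * p\<^sub>0 + expectation (\<lambda>w. indicator A w * mix_error b (X (s + i * b) w)))"
  proof (rule sum_mono)
    fix i assume i: "i \<in> {..<L}"
    have "(L - 1 - i) * b \<le> L * b" by simp
    from p0[OF this] obtain u where u: "u \<ge> 2" "\<P>(w in M. norm (inc f u ((L - 1 - i) * b) w) > x) + mean_mix_error (u - 1) \<le> p\<^sub>0" by auto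
    have [measurable]: "X (s + i * b) \<in> M \<rightarrow>\<^sub>M F" using s by (intro X_measurable) auto
    have "prob (G i) \<le> prob (E i) * (\<P>(w in M. norm (inc f u ((L - 1 - i) * b) w) > x) + mean_mix_error (u - 1))
        + expectation (\<lambda>w. indicator (E i) w * mix_error b (X (s + i * b) w))"
      unfolding G_def inc_def
      using decoupling[OF f _ _ Ep b u(1), where B = "{v. norm v > x}" and N = "(L - 1 - i) * b"] s by simp
    also have "\<dots> \<le> prob (E i) * p\<^sub>0 + expectation (\<lambda>w. indicator A w * mix_error b (X (s + i * b) w))"
      by (intro add_mono mult_left_mono u integral_mono integrable_const_bound[where B=1])
        (auto simp: mix_error_bounds indicator_def E_def)
    finally show "prob (G i) \<le> prob (E i) * p\<^sub>0 + expectation (\<lambda>w. indicator A w * mix_error b (X (s + i * b) w))" .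
  qed
  also have "\<dots> = (\<Sum>i<L. prob (E i)) * p\<^sub>0 + (\<Sum>i<L. expectation (\<lambda>w. indicator A w * mix_error b (X (s + i * b) w)))"
    by (simp add: sum.distrib sum_distrib_right)
  \<comment> \<open>The events of first exceedance are disjoint, so \<open>p\<^sub>0\<close> is paid
    once and not \<open>L\<close> times.\<close>
  also have "(\<Sum>i<L. prob (E i)) * p\<^sub>0 \<le> 1 * p\<^sub>0"
  proof (rule mult_right_mono[OF _ p0_nonneg])
    have "disjoint_family_on E {..<L}"
      unfolding disjoint_family_on_def
    proof (intro ballI impI)
      fix i j :: nat assume "i \<noteq> j"
      then show "E i \<inter> E j = {}" by (cases i j rule: linorder_cases) (force simp: E_def)+
    qed
    then have "(\<Sum>i<L. prob (E i)) = prob (\<Union>i<L. E i)"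
      by (intro finite_measure_finite_Union[symmetric]) auto
    then show "(\<Sum>i<L. prob (E i)) \<le> 1" by simp
  qed
  finally show ?thesis unfolding U_def B_def by (simp add: sum.distrib)
qed

text \<open>The error is itself a [0,1]-valued function of \<open>X t\<close>, so
  \<open>low_expectation\<close> applies to it; under \<open>F\<close> the cut-off is dropped and
  the integral of \<open>V\<close> appears.\<close>

lemma low_mix_error_bound:
  assumes t: "s \<le> t" "s \<ge> 2" and b: "b \<ge> 1" and R: "R \<ge> 0"
  shows "expectation (\<lambda>w. indicator (low R) w * mix_error b (X t w)) \<le> (\<integral>x. V x \<partial>F) * real b powr - m + R * real (s - 1) powr - m"
proof -
  have "expectation (\<lambda>w. indicator (low R) w * mix_error b (X (1 + (t - 1)) w)) \<le> (\<integral>x. mix_error b x \<partial>F) + R * real (t - 1) powr - m"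
    using t by (intro low_expectation R mix_error_measurable mix_error_bounds) auto
  also have "(\<integral>x. mix_error b x \<partial>F) \<le> (\<integral>x. V x * real b powr - m \<partial>F)"
    by (intro integral_mono integrable_mult_left V_int F.integrable_const_bound[where B=1 and f="mix_error b"])
      (auto simp: mix_error_bounds, auto simp: mix_error_def V0)
  also have "\<dots> = (\<integral>x. V x \<partial>F) * real b powr - m" by simp
  also have "R * real (t - 1) powr - m \<le> R * real (s - 1) powr - m"
    using t R m0 by (intro mult_left_mono powr_mono2') auto
  finally show ?thesis using t by simp
qed

text \<open>\<open>p\<^sub>0\<close> occurs twice: once for the increments after an exceedance, once
  for the full increment over all \<open>L\<close> blocks.\<close>

lemma maximal_bound:
  fixes f :: "'a \<Rightarrow> 'v::euclidean_space"
  assumes f [measurable]: "f \<in> borel_measurable F" and \<rho>: "\<rho> > 1" and int: "integrable F (\<lambda>x. norm (f x) powr \<rho>)"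
    and s: "s \<ge> 2" and b: "b \<ge> 1" and x: "x > 0" and R: "R \<ge> 0"
    and p0: "\<And>N. N \<le> L * b \<Longrightarrow> \<exists>u\<ge>2. \<P>(w in M. norm (inc f u N w) > x) + mean_mix_error (u - 1) \<le> p\<^sub>0"
  shows "\<P>(w in M. \<exists>k\<le>L * b. norm (inc f s k w) > 4 * x)
     \<le> prob (space M - low R) + 2 * p\<^sub>0 + mean_mix_error (s - 1)
      + real L * (real b * (real b powr (\<rho> - 1) / x powr \<rho> * (\<integral>x. norm (f x) powr \<rho> \<partial>F) + R * real (s - 1) powr - m)
                  + ((\<integral>x. V x \<partial>F) * real b powr - m + R * real (s - 1) powr - m))"
proof -
  have "\<P>(w in M. \<exists>k\<le>L * b. norm (inc f s k w) > 4 * x)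
     \<le> prob ((space M - low R) \<union> {w \<in> space M. w \<in> low R \<and> (\<exists>k\<le>L * b. norm (inc f s k w) > 4 * x)})"
    by (intro finite_measure_mono) auto
  also have "\<dots> \<le> prob (space M - low R) + \<P>(w in M. w \<in> low R \<and> (\<exists>k\<le>L * b. norm (inc f s k w) > 4 * x))"
    by (intro measure_Un_le) auto
  also have "\<P>(w in M. w \<in> low R \<and> (\<exists>k\<le>L * b. norm (inc f s k w) > 4 * x))
    \<le> \<P>(w in M. norm (inc f s (L * b) w) > x) + p\<^sub>0
      + (\<Sum>i<L. \<P>(w in M. w \<in> low R \<and> inc (\<lambda>x. norm (f x)) (s + i * b) b w > x)
               + expectation (\<lambda>w. indicator (low R) w * mix_error b (X (s + i * b) w)))"
    using s by (intro maximal_inequality f b x low_past p0) auto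
  \<comment> \<open>The bound by \<open>p\<^sub>0\<close> is available at some \<open>u\<close>
    only, not at \<open>s\<close>; decoupling from time 1 with gap \<open>s - 1\<close> moves the
    increment there.\<close>
  also have "\<P>(w in M. norm (inc f s (L * b) w) > x) \<le> p\<^sub>0 + mean_mix_error (s - 1)"
  proof -
    obtain u where u: "u \<ge> 2" "\<P>(w in M. norm (inc f u (L * b) w) > x) + mean_mix_error (u - 1) \<le> p\<^sub>0" using p0[of "L * b"] by auto
    have sp: "space M \<in> sets (past 1)" using sets.top[of "past 1"] by simp
    have "\<P>(w in M. w \<in> space M \<and> (\<Sum>i\<in>{1+(s-1)<..1+(s-1)+L*b}. f (X i w)) \<in> {v. norm v > x})
      \<le> prob (space M) * (\<P>(w in M. (\<Sum>i\<in>{u<..u+L*b}. f (X i w)) \<in> {v. norm v > x}) + mean_mix_error (u - 1))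
        + expectation (\<lambda>w. indicator (space M) w * mix_error (s - 1) (X 1 w))"
      using s u by (intro decoupling f sp) auto
    also have "expectation (\<lambda>w. indicator (space M) w * mix_error (s - 1) (X 1 w)) = mean_mix_error (s - 1)"
      unfolding mean_mix_error_def by (intro Bochner_Integration.integral_cong) auto
    finally show ?thesis using u s by (simp add: prob_space inc_def)
  qed
  also have "(\<Sum>i<L. \<P>(w in M. w \<in> low R \<and> inc (\<lambda>x. norm (f x)) (s + i * b) b w > x)
               + expectation (\<lambda>w. indicator (low R) w * mix_error b (X (s + i * b) w)))
     \<le> (\<Sum>i<L. real b * (real b powr (\<rho> - 1) / x powr \<rho> * (\<integral>x. norm (f x) powr \<rho> \<partial>F) + R * real (s - 1) powr - m)
                  + ((\<integral>x. V x \<partial>F) * real b powr - m + R * real (s - 1) powr - m))"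
    using s by (intro sum_mono add_mono block_bound low_mix_error_bound f \<rho> int b x R) auto
  finally show ?thesis by simp
qed

lemma anscombe:
  fixes f :: "'a \<Rightarrow> 'v::euclidean_space"
  assumes f [measurable]: "f \<in> borel_measurable F" and \<delta>: "\<delta> > 0" and int: "integrable F (\<lambda>x. norm (f x) powr (2 + \<delta>))"
    and m: "m > 1 + 2 / \<delta>"
    and tight: "\<And>\<epsilon>. \<epsilon> > 0 \<Longrightarrow> \<exists>a>0. \<forall>n. \<P>(w in M. norm (inc f 0 n w) > a * sqrt (real n)) \<le> \<epsilon>"
    and \<eta>: "\<eta> > 0" and \<epsilon>: "\<epsilon> > 0"
  shows "\<exists>d>0. d < 1 \<and> (\<forall>\<^sub>F n in sequentially.
     \<P>(w in M. oscillates (inc f 0) d n (\<eta> * sqrt (real n)) w) \<le> \<epsilon>)"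
proof -
  \<comment> \<open>Nine errors in all: one for the complement of \<open>low R\<close>, six from
    \<open>2 * p\<^sub>0\<close> with \<open>p\<^sub>0 = 3 * \<epsilon>'\<close>, one for
    \<open>mean_mix_error\<close>, one for \<open>rem\<close>.\<close>
  define \<epsilon>' where "\<epsilon>' = \<epsilon> / 9"
  have e': "\<epsilon>' > 0" using \<epsilon> by (simp add: \<epsilon>'_def)
  obtain a where a: "a > 0" "\<And>n. \<P>(w in M. norm (inc f 0 n w) > a * sqrt (real n)) \<le> \<epsilon>'"
    using tight[OF e'] by blast
  obtain R where R: "R \<ge> 0" "prob (space M - low R) < \<epsilon>'" using low_exhausts[OF e'] by blast
  have "\<forall>\<^sub>F n in sequentially. mean_mix_error n < \<epsilon>'" using mean_mix_error_tendsto e' by (rule order_tendstoD)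
  then obtain U0 where U0: "\<And>n. n \<ge> U0 \<Longrightarrow> mean_mix_error n < \<epsilon>'" by (auto simp: eventually_sequentially)
  define U where "U = U0 + 2"
  have m1: "m > 1" using m \<delta> by (smt (verit) divide_pos_pos)
  \<comment> \<open>Equivalent to \<open>m > 1 + 2 / \<delta>\<close>. For exponents above the left
    side the mixing error summed over blocks vanishes, for those below the right side the
    exceedances of single blocks do.\<close>
  have "1 / (m + 1) < \<delta> / (2 * (1 + \<delta>))"
    using m \<delta> m1 by (simp add: field_simps)
  then obtain \<gamma> where g: "1 / (m + 1) < \<gamma>" "\<gamma> < \<delta> / (2 * (1 + \<delta>))" using dense by blast
  have g0: "\<gamma> > 0" using g m1 by (smt (verit) divide_pos_pos)
  have gm: "1 - \<gamma> * (m + 1) < 0" using g m1 by (simp add: field_simps)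
  have gd: "\<gamma> * (1 + \<delta>) - \<delta> / 2 < 0" using g \<delta> by (simp add: field_simps)
  have g1: "\<gamma> < 1"
  proof -
    have "\<delta> / (2 * (1 + \<delta>)) < 1" using \<delta> by (simp add: field_simps)
    then show ?thesis using g by simp
  qed
  \<comment> \<open>By tightness, sums of length v are of size \<open>a * sqrt v\<close>. For v up
    to \<open>6 * d * n\<close> this must not exceed \<open>x n / 2 = \<eta> / 16 * sqrt n\<close>,
    which the second bound ensures with room to spare; the bound 1/4 keeps the window away from time
    0.\<close>
  define d where "d = min (1/4) (\<eta>\<^sup>2 / (256 * 8 * a\<^sup>2))"
  have d: "d > 0" "d \<le> 1/4" "8 * (d * a\<^sup>2) \<le> \<eta>\<^sup>2 / 256"
  proof -
    show "d > 0" using \<eta> a by (simp add: d_def)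
    show "d \<le> 1/4" by (simp add: d_def)
    have "d \<le> \<eta>\<^sup>2 / (256 * 8 * a\<^sup>2)" by (simp add: d_def)
    then show "8 * (d * a\<^sup>2) \<le> \<eta>\<^sup>2 / 256" using a by (simp add: field_simps)
  qed
  define b where "b n = nat \<lceil>real n powr \<gamma>\<rceil>" for n
  define rr where "rr n = nat \<lfloor>d * real n\<rfloor>" for n
  \<comment> \<open>The window from \<open>n - rr n\<close> to \<open>n + rr n\<close> has length
    \<open>2 * rr n\<close>; one extra block covers the remainder of the division.\<close>
  define L where "L n = 2 * rr n div b n + 1" for n
  \<comment> \<open>Two sums in the window differ by a difference of two increments from its left
    end \<open>s n\<close>; if both increments are at most \<open>4 * x n\<close>, the difference is
    at most \<open>\<eta> * sqrt n\<close>.\<close>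
  define x where "x n = \<eta> / 8 * sqrt (real n)" for n
  define s where "s n = n - rr n" for n
  define Ef where "Ef = (\<integral>x. norm (f x) powr (2 + \<delta>) \<partial>F)"
  define EV where "EV = (\<integral>x. V x \<partial>F)"
  have Ef: "Ef \<ge> 0" by (simp add: Ef_def)
  have EV: "EV \<ge> 0" unfolding EV_def by (intro integral_nonneg_AE AE_I2 V0)
  \<comment> \<open>Bounds the errors added over the \<open>L n\<close> blocks, using
    \<open>L n * b n \<le> n\<close>: exceedances of single blocks, the comparison of the initial
    law with \<open>F\<close> (twice, with \<open>s n - 1 \<ge> n / 4\<close>), and the mixing error
    across a skipped block.\<close>
  define rem where "rem n = 2 powr (1 + \<delta>) / (\<eta> / 8) powr (2 + \<delta>) * Ef * real n powr (\<gamma> * (1 + \<delta>) - \<delta> / 2)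
      + 2 * R * (1/4) powr - m * real n powr (1 - m) + EV * real n powr (1 - \<gamma> * (m + 1))" for n
  have "rem \<longlonglongrightarrow> 2 powr (1 + \<delta>) / (\<eta> / 8) powr (2 + \<delta>) * Ef * 0 + 2 * R * (1/4) powr - m * 0 + EV * 0"
    unfolding rem_def using gm gd m1
    by (intro tendsto_add tendsto_mult tendsto_const tendsto_neg_powr filterlim_real_sequentially) auto
  then have ev1: "\<forall>\<^sub>F n in sequentially. rem n < \<epsilon>'" using e' by (intro order_tendstoD(2)[of rem 0]) auto
  have "(\<lambda>n. real n powr (\<gamma> - 1)) \<longlonglongrightarrow> 0" using g1 by (intro tendsto_neg_powr filterlim_real_sequentially) auto
  then have ev2: "\<forall>\<^sub>F n in sequentially. real n powr (\<gamma> - 1) < d / 2" using d by (intro order_tendstoD(2)) auto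
  \<comment> \<open>The first summand is what makes \<open>a * sqrt (2 * U)\<close> at most
    \<open>x n / 2\<close>.\<close>
  have ev3: "\<forall>\<^sub>F n in sequentially. n \<ge> nat \<lceil>a\<^sup>2 * 512 * real U / \<eta>\<^sup>2\<rceil> + 2 * U + 4"
    by (rule eventually_ge_at_top)
  have "\<forall>\<^sub>F n in sequentially.
     \<P>(w in M. oscillates (inc f 0) d n (\<eta> * sqrt (real n)) w) \<le> \<epsilon>"
    using ev1 ev2 ev3
  proof eventually_elim
    case (elim n)
    have n: "n \<ge> 4" "n \<ge> 2 * U" and na: "a\<^sup>2 * 512 * real U / \<eta>\<^sup>2 \<le> real n" using elim(3) by linarith+
    have ngam: "real n powr \<gamma> \<ge> 1" using n g0 by (intro ge_one_powr_ge_zero) auto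
    have bn: "real n powr \<gamma> \<le> real (b n)" "real (b n) \<le> 2 * real n powr \<gamma>" "b n \<ge> 1"
      using ngam unfolding b_def by linarith+
    have "real n powr \<gamma> = real n powr (\<gamma> - 1) * real n" using n by (simp add: powr_diff)
    also have "\<dots> \<le> d / 2 * real n" using elim(2) by (intro mult_right_mono) auto
    finally have bd: "real (b n) \<le> d * real n" using bn by linarith
    have rn: "real (rr n) \<le> d * real n" using d by (simp add: rr_def)
    have rn4: "real (rr n) \<le> real n / 4"
      using rn mult_right_mono[OF d(2), of "real n"] by linarith
    have Lb1: "L n * b n \<le> 2 * rr n + b n" by (simp add: L_def)
    have Lb2: "2 * rr n \<le> L n * b n"
      using bn(3) mod_less_divisor[of "b n" "2 * rr n"] div_mult_mod_eq[of "2 * rr n" "b n"] unfolding L_def add_mult_distrib by linarith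
    have "real (L n * b n) \<le> real (2 * rr n + b n)" using Lb1 by (simp only: of_nat_le_iff)
    then have Lb3: "real (L n * b n) \<le> 3 * d * real n" using rn bd by simp
    then have Lb4: "real (L n) * real (b n) \<le> real n"
      using mult_right_mono[OF d(2), of "real n"] by simp
    have sn: "real (s n) = real n - real (rr n)" using rn4 by (simp add: s_def of_nat_diff)
    have s2: "s n \<ge> 2" using sn rn4 n by linarith
    have s4: "real (s n - 1) \<ge> real n / 4" using sn rn4 n s2 by (simp add: of_nat_diff)
    have sU: "s n - 1 \<ge> U0"
    proof -
      have "real (2 * (U0 + 2)) \<le> real n" using n(2) unfolding U_def by (simp only: of_nat_le_iff)
      then have "real (U0 + 1) \<le> real (s n)" using sn rn4 by simp
      then have "U0 + 1 \<le> s n" by (simp only: of_nat_le_iff)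
      then show ?thesis by simp
    qed
    have x0: "x n > 0" using n \<eta> by (simp add: x_def)
    have p0: "\<exists>u\<ge>2. \<P>(w in M. norm (inc f u N w) > x n) + mean_mix_error (u - 1) \<le> 3 * \<epsilon>'" if N: "N \<le> L n * b n" for N
    proof (intro exI conjI)
      \<comment> \<open>The increment is the difference of the sums up to \<open>u + N\<close> and
        up to \<open>u\<close>, to which tightness applies. Taking \<open>u\<close> at least
        \<open>U\<close> makes the mixing error small; taking it at least \<open>N\<close>, but no
        larger than these two require, keeps both lengths below \<open>2 * u\<close> and so of the
        order of the window.\<close>
      define u where "u = max U N"
      show "u \<ge> 2" by (simp add: u_def U_def)
      have small: "a * sqrt (real v) \<le> x n / 2" if v: "v \<le> 2 * u" for v
      proof (rule power2_le_imp_le)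
        have "real N \<le> 3 * d * real n" using N Lb3 by linarith
        moreover have "real v \<le> real (2 * u)" using v by (simp only: of_nat_le_iff)
        ultimately have v': "real v \<le> 2 * max (real U) (3 * d * real n)" unfolding u_def by (auto simp: max_def split: if_splits)
        have "a\<^sup>2 * real v \<le> a\<^sup>2 * (2 * max (real U) (3 * d * real n))"
          by (intro mult_left_mono v') simp
        also have "\<dots> \<le> \<eta>\<^sup>2 / 256 * real n"
        proof (cases "real U \<le> 3 * d * real n")
          case True
          have "a\<^sup>2 * (2 * (3 * d * real n)) \<le> 8 * (d * a\<^sup>2) * real n" using d a by (simp add: algebra_simps)
          also have "\<dots> \<le> \<eta>\<^sup>2 / 256 * real n" using d by (intro mult_right_mono) auto
          finally show ?thesis using True by (simp add: max_def)
        next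
          case False
          have "a\<^sup>2 * 512 * real U \<le> real n * \<eta>\<^sup>2" using na \<eta> by (simp add: field_simps)
          then show ?thesis using False by (simp add: max_def field_simps)
        qed
        finally show "(a * sqrt (real v))\<^sup>2 \<le> (x n / 2)\<^sup>2"
          by (simp add: power_mult_distrib power_divide x_def)
      qed (use x0 in simp)
      have "{w \<in> space M. norm (inc f u N w) > x n} \<subseteq>
         {w \<in> space M. norm (inc f 0 (u + N) w) > a * sqrt (real (u + N))} \<union> {w \<in> space M. norm (inc f 0 u w) > a * sqrt (real u)}"
      proof (intro subsetI, rule ccontr)
        fix w assume w: "w \<in> {w \<in> space M. norm (inc f u N w) > x n}"
          and "w \<notin> {w \<in> space M. norm (inc f 0 (u + N) w) > a * sqrt (real (u + N))} \<union> {w \<in> space M. norm (inc f 0 u w) > a * sqrt (real u)}"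
        then have "norm (inc f 0 (u + N) w) \<le> x n / 2" "norm (inc f 0 u w) \<le> x n / 2"
          using small[of "u + N"] small[of u] by (force simp: u_def)+
        moreover have eq: "inc f u N w = inc f 0 (u + N) w - inc f 0 u w" by (simp add: inc_add)
        have "norm (inc f u N w) \<le> norm (inc f 0 (u + N) w) + norm (inc f 0 u w)"
          unfolding eq by (rule norm_triangle_ineq4)
        ultimately have "norm (inc f u N w) \<le> x n" by linarith
        then show False using w by simp
      qed
      then have "\<P>(w in M. norm (inc f u N w) > x n) \<le>
        prob ({w \<in> space M. norm (inc f 0 (u + N) w) > a * sqrt (real (u + N))} \<union> {w \<in> space M. norm (inc f 0 u w) > a * sqrt (real u)})"
        by (intro finite_measure_mono) auto
      also have "\<dots> \<le> \<P>(w in M. norm (inc f 0 (u + N) w) > a * sqrt (real (u + N))) + \<P>(w in M. norm (inc f 0 u w) > a * sqrt (real u))"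
        by (intro measure_Un_le) auto
      also have "\<dots> \<le> \<epsilon>' + \<epsilon>'" by (intro add_mono a)
      finally have "\<P>(w in M. norm (inc f u N w) > x n) \<le> \<epsilon>' + \<epsilon>'" .
      moreover have "U0 \<le> u - 1" unfolding u_def U_def by linarith
      then have "mean_mix_error (u - 1) < \<epsilon>'" by (rule U0)
      ultimately show "\<P>(w in M. norm (inc f u N w) > x n) + mean_mix_error (u - 1) \<le> 3 * \<epsilon>'" by linarith
    qed
    have main: "\<P>(w in M. \<exists>k\<le>L n * b n. norm (inc f (s n) k w) > 4 * x n)
     \<le> prob (space M - low R) + 2 * (3 * \<epsilon>') + mean_mix_error (s n - 1)
      + real (L n) * (real (b n) * (real (b n) powr (2 + \<delta> - 1) / x n powr (2 + \<delta>) * Ef + R * real (s n - 1) powr - m)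
                  + (EV * real (b n) powr - m + R * real (s n - 1) powr - m))"
      unfolding Ef_def EV_def using \<delta> by (intro maximal_bound f int s2 bn x0 R p0) auto
    also have "real (L n) * (real (b n) * (real (b n) powr (2 + \<delta> - 1) / x n powr (2 + \<delta>) * Ef + R * real (s n - 1) powr - m)
                  + (EV * real (b n) powr - m + R * real (s n - 1) powr - m)) \<le> rem n"
    proof -
      let ?Lb = "real (L n) * real (b n)"
      have nb: "real (b n) > 0" using bn by linarith
      have n0: "real n > 0" using n by simp
      define Q where "Q = R * real (s n - 1) powr - m"
      have Q0: "0 \<le> Q" using R by (simp add: Q_def)
      have Q: "real n * Q \<le> R * (1/4) powr - m * real n powr (1 - m)"
      proof -
        have "Q \<le> R * (real n / 4) powr - m"
          unfolding Q_def using s4 n0 m0 R by (intro mult_left_mono powr_mono2') auto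
        then have "real n * Q \<le> real n * (R * (real n / 4) powr - m)" by (intro mult_left_mono) auto
        also have "(real n / 4) powr - m = real n powr - m * (1/4) powr - m" using powr_mult[of "real n" "1/4" "-m"] by simp
        also have "real n * (R * (real n powr - m * (1/4) powr - m)) = R * (1/4) powr - m * real n powr (1 - m)"
          using n0 by (simp add: powr_diff powr_minus_divide mult_ac)
        finally show ?thesis .
      qed
      have T1: "?Lb * (real (b n) powr (1 + \<delta>) / x n powr (2 + \<delta>) * Ef) \<le> 2 powr (1 + \<delta>) / (\<eta> / 8) powr (2 + \<delta>) * Ef * real n powr (\<gamma> * (1 + \<delta>) - \<delta> / 2)"
      proof -
        have xp: "x n powr (2 + \<delta>) = (\<eta> / 8) powr (2 + \<delta>) * real n powr ((2 + \<delta>) / 2)"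
        proof -
          have "sqrt (real n) powr (2 + \<delta>) = real n powr ((2 + \<delta>) / 2)" by (simp add: powr_half_sqrt[symmetric] powr_powr)
          then show ?thesis by (simp only: x_def powr_mult)
        qed
        have "real (b n) powr (1 + \<delta>) \<le> (2 * real n powr \<gamma>) powr (1 + \<delta>)" using bn nb \<delta> by (intro powr_mono2) auto
        also have "\<dots> = 2 powr (1 + \<delta>) * real n powr (\<gamma> * (1 + \<delta>))" by (simp add: powr_mult powr_powr)
        finally have "?Lb * (real (b n) powr (1 + \<delta>) / x n powr (2 + \<delta>) * Ef) \<le> real n * (2 powr (1 + \<delta>) * real n powr (\<gamma> * (1 + \<delta>)) / x n powr (2 + \<delta>) * Ef)"
          using Lb4 Ef by (intro mult_mono mult_right_mono divide_right_mono) auto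
        also have "\<dots> = real n * (2 powr (1 + \<delta>) * real n powr (\<gamma> * (1 + \<delta>)) / ((\<eta> / 8) powr (2 + \<delta>) * real n powr ((2 + \<delta>) / 2)) * Ef)"
          unfolding xp ..
        also have "real n * (2 powr (1 + \<delta>) * real n powr (\<gamma> * (1 + \<delta>)) / ((\<eta> / 8) powr (2 + \<delta>) * real n powr ((2 + \<delta>) / 2)) * Ef)
           = 2 powr (1 + \<delta>) / (\<eta> / 8) powr (2 + \<delta>) * Ef * (real n powr 1 * real n powr (\<gamma> * (1 + \<delta>)) / real n powr ((2 + \<delta>) / 2))"
          by simp
        also have "real n powr 1 * real n powr (\<gamma> * (1 + \<delta>)) / real n powr ((2 + \<delta>) / 2) = real n powr (\<gamma> * (1 + \<delta>) - \<delta> / 2)"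
          unfolding powr_add[symmetric] powr_diff[symmetric] by (rule arg_cong[where f="(powr) (real n)"]) (simp add: field_simps)
        finally show ?thesis .
      qed
      have T2: "?Lb * Q \<le> R * (1/4) powr - m * real n powr (1 - m)"
        using mult_right_mono[OF Lb4 Q0] Q by linarith
      have T3: "real (L n) * (EV * real (b n) powr - m) \<le> EV * real n powr (1 - \<gamma> * (m + 1))"
      proof -
        have "real (L n) * (EV * real (b n) powr - m) = ?Lb * (EV * real (b n) powr (- (m + 1)))"
          using nb by (simp add: powr_diff powr_minus_divide powr_add)
        also have "\<dots> \<le> real n * (EV * (real n powr \<gamma>) powr (- (m + 1)))"
          using Lb4 EV bn n0 m0 by (intro mult_mono mult_left_mono powr_mono2') auto
        also have "\<dots> = EV * (real n powr 1 * real n powr (- (\<gamma> * (m + 1))))" by (simp add: powr_powr algebra_simps)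
        also have "real n powr 1 * real n powr (- (\<gamma> * (m + 1))) = real n powr (1 - \<gamma> * (m + 1))"
          unfolding powr_add[symmetric] by simp
        finally show ?thesis .
      qed
      have T4: "real (L n) * Q \<le> R * (1/4) powr - m * real n powr (1 - m)"
      proof -
        have "real (L n) * 1 \<le> ?Lb" using bn by (intro mult_left_mono) auto
        then have "real (L n) * Q \<le> ?Lb * Q" using Q0 by (intro mult_right_mono) auto
        then show ?thesis using T2 by linarith
      qed
      have "real (L n) * (real (b n) * (real (b n) powr (2 + \<delta> - 1) / x n powr (2 + \<delta>) * Ef + Q) + (EV * real (b n) powr - m + Q))
         = ?Lb * (real (b n) powr (1 + \<delta>) / x n powr (2 + \<delta>) * Ef) + ?Lb * Q + real (L n) * (EV * real (b n) powr - m) + real (L n) * Q"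
        by (simp add: algebra_simps)
      then show ?thesis unfolding Q_def[symmetric] rem_def using T1 T2 T3 T4 by linarith
    qed
    finally have fin: "\<P>(w in M. \<exists>k\<le>L n * b n. norm (inc f (s n) k w) > 4 * x n) \<le> 9 * \<epsilon>'"
      using R(2) U0[OF sU] elim(1) by linarith
    have "\<P>(w in M. oscillates (inc f 0) d n (\<eta> * sqrt (real n)) w)
       \<le> \<P>(w in M. \<exists>k\<le>L n * b n. norm (inc f (s n) k w) > 4 * x n)"
    proof (intro finite_measure_mono subsetI)
      fix w assume "w \<in> {w \<in> space M. oscillates (inc f 0) d n (\<eta> * sqrt (real n)) w}"
      then obtain k where w: "w \<in> space M" and k: "\<bar>real k - real n\<bar> \<le> d * real n" and big: "norm (inc f 0 k w - inc f 0 n w) > 8 * x n"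
        by (auto simp: x_def)
      have kr: "n - rr n \<le> k" "k \<le> n + rr n"
        using k unfolding rr_def by (auto simp: abs_le_iff) linarith+
      define k' where "k' = k - s n"
      have ks: "k = s n + k'" "k' \<le> 2 * rr n" using kr unfolding k'_def s_def by linarith+
      have ns: "n = s n + rr n" unfolding s_def using rn4 by linarith
      have "inc f 0 k w - inc f 0 n w = inc f (s n) k' w - inc f (s n) (rr n) w"
        using inc_add[of f 0 "s n" k' w] inc_add[of f 0 "s n" "rr n" w] ks ns by simp
      then have "norm (inc f (s n) k' w - inc f (s n) (rr n) w) > 8 * x n" using big by simp
      then have "norm (inc f (s n) k' w) > 4 * x n \<or> norm (inc f (s n) (rr n) w) > 4 * x n"
        using norm_triangle_ineq4[of "inc f (s n) k' w" "inc f (s n) (rr n) w"] by linarith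
      moreover have "k' \<le> L n * b n" "rr n \<le> L n * b n" using ks Lb2 by linarith+
      ultimately show "w \<in> {w \<in> space M. \<exists>k\<le>L n * b n. norm (inc f (s n) k w) > 4 * x n}" using w by blast
    qed measurable
    then show ?case using fin by (simp add: \<epsilon>'_def)
  qed
  then show ?thesis using d by (intro exI[of _ d]) auto
qed

end

section \<open>Chi-squared and Hotelling laws\<close>

lemma Gamma_ratio_LIMSEQ:
  fixes z :: real assumes z: "z > 0"
  shows "(\<lambda>n. Gamma (real n + z) / (Gamma (real n) * real n powr z)) \<longlonglongrightarrow> 1"
proof -
  have Gz: "Gamma z \<noteq> 0" using Gamma_real_pos[OF z] by linarith
  have "(\<lambda>n. Gamma_series' z n / Gamma z) \<longlonglongrightarrow> Gamma z / Gamma z"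
    using Gz by (intro tendsto_divide Gamma_series'_LIMSEQ tendsto_const) auto
  then have "(\<lambda>n. inverse (Gamma_series' z n / Gamma z)) \<longlonglongrightarrow> inverse 1"
    using Gz by (intro tendsto_inverse) auto
  \<comment> \<open>Euler's limit formula for \<open>Gamma z\<close>, read backwards: the Pochhammer
    symbol is a quotient of gamma values.\<close>
  moreover have "\<forall>\<^sub>F n in sequentially. inverse (Gamma_series' z n / Gamma z) = Gamma (real n + z) / (Gamma (real n) * real n powr z)"
    using eventually_gt_at_top[of 0]
  proof eventually_elim
    case (elim n)
    have "z \<notin> \<int>\<^sub>\<le>\<^sub>0" using z by (auto simp: nonpos_Ints_def)
    then have "pochhammer z n = Gamma (z + real n) / Gamma z" by (rule pochhammer_Gamma)
    moreover have "fact (n - 1) = Gamma (real n)" using elim Gamma_fact[of "n - 1", where ?'a=real] by simp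
    ultimately show ?case using elim Gamma_real_pos[OF z]
      by (simp add: Gamma_series'_def powr_def field_simps add.commute)
  qed
  ultimately show ?thesis by (simp add: tendsto_cong)
qed

text \<open>Needed because \<open>q / 2\<close> is an integer only for even
  \<open>q\<close>.\<close>

lemma LIMSEQ_parity:
  fixes u v :: "nat \<Rightarrow> 'a::topological_space"
  assumes "u \<longlonglongrightarrow> l" "v \<longlonglongrightarrow> l"
  shows "(\<lambda>n. if even n then u (n div 2) else v (n div 2)) \<longlonglongrightarrow> l"
proof (rule topological_tendstoI)
  fix S assume "open S" "l \<in> S"
  then have "\<forall>\<^sub>F n in sequentially. u n \<in> S" "\<forall>\<^sub>F n in sequentially. v n \<in> S"
    using assms by (auto dest: topological_tendstoD)
  then have "\<forall>\<^sub>F n in sequentially. u n \<in> S \<and> v n \<in> S" by (rule eventually_conj)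
  then obtain N where N: "\<And>n. n \<ge> N \<Longrightarrow> u n \<in> S \<and> v n \<in> S" by (auto simp: eventually_sequentially)
  show "\<forall>\<^sub>F n in sequentially. (if even n then u (n div 2) else v (n div 2)) \<in> S"
    using eventually_ge_at_top[of "2 * N"] by eventually_elim (use N in auto)
qed

abbreviation Gamma_ratio :: "real \<Rightarrow> nat \<Rightarrow> real" where
  "Gamma_ratio a q \<equiv> Gamma (real q / 2 + a) / (Gamma (real q / 2) * (real q / 2) powr a)"

lemma Gamma_half_ratio_LIMSEQ:
  fixes a :: real assumes a: "a > 0"
  shows "(\<lambda>q. Gamma_ratio a q) \<longlonglongrightarrow> 1"
proof -
  let ?R = "\<lambda>z n. Gamma (real n + z) / (Gamma (real n) * real n powr z)"
  \<comment> \<open>For \<open>q = 2 * n + 1\<close> the base point is \<open>n + 1/2\<close>.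
    Dividing the quotients for the shifts \<open>a + 1/2\<close> and \<open>1/2\<close> cancels
    \<open>Gamma n\<close>, and the last factor exchanges \<open>n powr a\<close> for
    \<open>(n + 1/2) powr a\<close>.\<close>
  let ?v = "\<lambda>n. ?R (a + 1/2) n / ?R (1/2) n * (real n / (real n + 1/2)) powr a"
  have "(\<lambda>n. real n / (real n + 1/2)) \<longlonglongrightarrow> 1" by real_asymp
  then have "?v \<longlonglongrightarrow> 1 / 1 * 1 powr a"
    using a by (intro tendsto_mult tendsto_divide Gamma_ratio_LIMSEQ tendsto_powr tendsto_const) auto
  then have "(\<lambda>q. if even q then ?R a (q div 2) else ?v (q div 2)) \<longlonglongrightarrow> 1"
    using a by (intro LIMSEQ_parity Gamma_ratio_LIMSEQ) auto
  moreover have "\<forall>\<^sub>F q in sequentially. (if even q then ?R a (q div 2) else ?v (q div 2))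
      = Gamma_ratio a q"
    using eventually_ge_at_top[of 2]
  proof eventually_elim
    case (elim q)
    show ?case
    proof (cases "even q")
      case True
      then show ?thesis by (auto elim!: evenE)
    next
      case False
      then obtain n where q: "q = 2 * n + 1" by (rule oddE)
      then have n: "n > 0" using elim by simp
      have q2: "real q / 2 = real n + 1/2" using q by simp
      have G: "Gamma (real n) > 0" "Gamma (real n + 1/2) > 0" using n by (auto intro!: Gamma_real_pos)
      have alg: "A / (G * (x * h)) / (B / (G * h)) * (x / w) = A / (B * w)" if "G > 0" "h > 0" "x > 0" for A B G x h w :: real
        using that by (simp add: field_simps)
      have "?v n = Gamma (real n + (a + 1/2)) / (Gamma (real n) * (real n powr a * real n powr (1/2)))
          / (Gamma (real n + 1/2) / (Gamma (real n) * real n powr (1/2))) * (real n powr a / (real n + 1/2) powr a)"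
        by (simp only: powr_add powr_divide)
      also have "\<dots> = Gamma (real n + (a + 1/2)) / (Gamma (real n + 1/2) * (real n + 1/2) powr a)"
        using n G by (intro alg) auto
      also have "\<dots> = Gamma (real q / 2 + a) / (Gamma (real n + 1/2) * (real n + 1/2) powr a)"
      proof -
        have e: "real n + (a + 1/2) = real q / 2 + a" using q2 by linarith
        show ?thesis by (simp only: e)
      qed
      finally have "?v n = Gamma_ratio a q" unfolding q2 .
      moreover have "q div 2 = n" using q by simp
      ultimately show ?thesis using False by (simp only: if_False)
    qed
  qed
  ultimately show ?thesis by (rule Lim_transform_eventually)
qed

section \<open>The chi-squared law and its quantiles\<close>

definition chi_density :: "nat \<Rightarrow> real \<Rightarrow> real" where
  "chi_density p r = (if r > 0 then r powr (real p / 2 - 1) * exp (- r / 2) / (2 powr (real p / 2) * Gamma (real p / 2)) else 0)"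

lemma chi_density_measurable [measurable]: "chi_density p \<in> borel_measurable borel"
  unfolding chi_density_def[abs_def] by measurable

text \<open>Euler's integral for \<open>Gamma (p / 2)\<close>, with half the variable
  substituted.\<close>

lemma nn_integral_chi_density:
  assumes p: "p > 0"
  shows "(\<integral>\<^sup>+r. ennreal (chi_density p r) \<partial>lborel) = 1"
proof -
  let ?a = "real p / 2"
  have a: "?a > 0" using p by simp
  note G = Gamma_real_pos[OF a]
  have half: "ennreal \<bar>1/2\<bar> * ennreal x = ennreal (1/2 * x)" for x by (subst ennreal_mult') auto
  have "ennreal (Gamma ?a) = (\<integral>\<^sup>+t. ennreal (indicat_real {0..} t * t powr (?a - 1) / exp t) \<partial>lborel)"
    by (rule Gamma_conv_nn_integral_real[OF a])
  also have "\<dots> = ennreal \<bar>1/2\<bar> * (\<integral>\<^sup>+t. ennreal (indicat_real {0..} (0 + 1/2 * t) * (0 + 1/2 * t) powr (?a - 1) / exp (0 + 1/2 * t)) \<partial>lborel)"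
    by (rule nn_integral_real_affine) auto
  also have "\<dots> = (\<integral>\<^sup>+t. ennreal \<bar>1/2\<bar> * ennreal (indicat_real {0..} (0 + 1/2 * t) * (0 + 1/2 * t) powr (?a - 1) / exp (0 + 1/2 * t)) \<partial>lborel)"
    by (rule nn_integral_cmult[symmetric]) measurable
  also have "\<dots> = (\<integral>\<^sup>+t. ennreal (1/2 * (indicat_real {0..} (1/2 * t) * (1/2 * t) powr (?a - 1) / exp (1/2 * t))) \<partial>lborel)"
    unfolding half by simp
  also have "\<dots> = (\<integral>\<^sup>+t. ennreal (Gamma ?a) * ennreal (chi_density p t) \<partial>lborel)"
  proof (intro nn_integral_cong)
    fix t :: real
    have "1/2 * (indicat_real {0..} (1/2 * t) * (1/2 * t) powr (?a - 1) / exp (1/2 * t)) = Gamma ?a * chi_density p t"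
    proof (cases "t > 0")
      case True
      have "(1/2 * t) powr (?a - 1) = t powr (?a - 1) * (1/2) powr (?a - 1)" by (subst powr_mult) (rule mult.commute)
      also have "(1/2) powr (?a - 1) = 2 / 2 powr ?a" by (simp add: powr_diff powr_divide)
      finally show ?thesis using True G by (simp add: chi_density_def exp_minus field_simps)
    qed (auto simp: chi_density_def indicator_def)
    then show "ennreal (1/2 * (indicat_real {0..} (1/2 * t) * (1/2 * t) powr (?a - 1) / exp (1/2 * t))) = ennreal (Gamma ?a) * ennreal (chi_density p t)"
      using G by (simp add: ennreal_mult'[symmetric])
  qed
  also have "\<dots> = ennreal (Gamma ?a) * (\<integral>\<^sup>+t. ennreal (chi_density p t) \<partial>lborel)"
    by (rule nn_integral_cmult) simp
  finally have "ennreal (Gamma ?a) * 1 = ennreal (Gamma ?a) * (\<integral>\<^sup>+t. ennreal (chi_density p t) \<partial>lborel)" by simp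
  then show ?thesis using G by (subst (asm) ennreal_mult_cancel_left) auto
qed

definition chi_law :: "nat \<Rightarrow> real measure" where
  "chi_law p = density lborel (\<lambda>r. ennreal (chi_density p r))"

lemma sets_chi_law [simp, measurable_cong]: "sets (chi_law p) = sets borel"
  and space_chi_law [simp]: "space (chi_law p) = UNIV"
  by (simp_all add: chi_law_def)

lemma prob_space_chi_law: "p > 0 \<Longrightarrow> prob_space (chi_law p)"
  by (rule prob_spaceI) (simp add: chi_law_def emeasure_density nn_integral_chi_density)

lemma real_distribution_chi_law: "p > 0 \<Longrightarrow> real_distribution (chi_law p)"
  by (intro real_distribution.intro prob_space_chi_law real_distribution_axioms.intro) auto

lemma isCont_cdf_chi_law: "p > 0 \<Longrightarrow> isCont (cdf (chi_law p)) x"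
proof -
  assume p: "p > 0"
  interpret real_distribution "chi_law p" by (rule real_distribution_chi_law[OF p])
  have "emeasure (chi_law p) {x} = 0"
    unfolding chi_law_def
    by (subst emeasure_density) (auto simp: nn_integral_0_iff_AE intro!: AE_I[where N="{x}"] split: split_indicator)
  then show ?thesis by (simp add: isCont_cdf measure_def)
qed

lemma cdf_chi_law_strict_mono:
  assumes p: "p > 0" and xy: "0 \<le> x" "x < y"
  shows "cdf (chi_law p) x < cdf (chi_law p) y"
proof -
  interpret real_distribution "chi_law p" by (rule real_distribution_chi_law[OF p])
  have "emeasure (chi_law p) {x<..y} \<noteq> 0"
  proof
    assume "emeasure (chi_law p) {x<..y} = 0"
    then have "(\<integral>\<^sup>+t. ennreal (chi_density p t) * indicator {x<..y} t \<partial>lborel) = 0"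
      by (simp add: chi_law_def emeasure_density)
    then have ae: "AE t in lborel. ennreal (chi_density p t) * indicator {x<..y} t = 0"
      by (subst (asm) nn_integral_0_iff_AE) auto
    have pos: "chi_density p t > 0" if "t > 0" for t
      using that Gamma_real_pos[of "real p / 2"] p by (simp add: chi_density_def)
    have "AE t in lborel. t \<notin> {x<..y}"
      using ae
    proof eventually_elim
      case (elim t)
      show ?case
      proof
        assume t: "t \<in> {x<..y}"
        then have "chi_density p t > 0" using xy by (intro pos) auto
        then show False using elim t by (simp add: ennreal_eq_0_iff)
      qed
    qed
    then have "emeasure lborel {x<..y} = 0"
      using emeasure_eq_0_AE[of "\<lambda>t. t \<in> {x<..y}" lborel]
      by (simp add: greaterThanAtMost_def greaterThan_def atMost_def Int_def)
    then show False using xy by simp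
  qed
  then have "measure (chi_law p) {x<..y} > 0" by (simp add: emeasure_eq_measure zero_less_measure_iff)
  then show ?thesis using cdf_diff_eq[OF xy(2)] by simp
qed

lemma cdf_chi_law_0: assumes p: "p > 0" shows "cdf (chi_law p) 0 = 0"
proof -
  have "emeasure (chi_law p) {..0} = 0"
    unfolding chi_law_def
    by (subst emeasure_density) (auto simp: nn_integral_0_iff_AE chi_density_def split: split_indicator)
  then show ?thesis by (simp add: cdf_def2 measure_def)
qed

text \<open>Existence by continuity of the distribution function, uniqueness by its strict growth on
  the half-line. The two strict inequalities are the form of uniqueness from which convergence of
  quantiles follows.\<close>

lemma chi_quantile:
  assumes p: "p > 0" and u: "0 < u" "u < 1"
  obtains c where "c > 0" "cdf (chi_law p) c = u"
    "\<And>x. x < c \<Longrightarrow> cdf (chi_law p) x < u" "\<And>x. x > c \<Longrightarrow> cdf (chi_law p) x > u"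
proof -
  interpret real_distribution "chi_law p" by (rule real_distribution_chi_law[OF p])
  have "\<forall>\<^sub>F x in at_top. cdf (chi_law p) x > u"
    using cdf_lim_at_top_prob u by (intro order_tendstoD(1)) auto
  then have "\<forall>\<^sub>F x in at_top. cdf (chi_law p) x > u \<and> x \<ge> 0" using eventually_ge_at_top by (rule eventually_conj)
  then obtain b where b: "cdf (chi_law p) b > u" "b \<ge> 0"
    by (auto dest: eventually_happens'[OF trivial_limit_at_top_linorder])
  have "\<exists>c. 0 \<le> c \<and> c \<le> b \<and> cdf (chi_law p) c = u"
    using b u cdf_chi_law_0[OF p] isCont_cdf_chi_law[OF p] by (intro IVT) auto
  then obtain c where c: "0 \<le> c" "cdf (chi_law p) c = u" by blast
  have "c \<noteq> 0" using c u cdf_chi_law_0[OF p] by auto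
  then have c0: "c > 0" using c by simp
  show ?thesis
  proof (rule that[OF c0 c(2)])
    fix x assume x: "x < c"
    have "cdf (chi_law p) x \<le> cdf (chi_law p) (max 0 x)" by (rule cdf_nondecreasing) simp
    also have "\<dots> < cdf (chi_law p) c" using x c0 by (intro cdf_chi_law_strict_mono[OF p]) auto
    finally show "cdf (chi_law p) x < u" using c by simp
  next
    fix x assume "x > c" then show "cdf (chi_law p) x > u" using cdf_chi_law_strict_mono[OF p c(1), of x] c by simp
  qed
qed

section \<open>Hotelling's law through its density\<close>

definition Hotelling_density :: "nat \<Rightarrow> nat \<Rightarrow> real \<Rightarrow> real" where
  "Hotelling_density p q y = (if y \<le> 0 then 0
      else y powr (real p / 2 - 1) * (1 + y / (real q + real p - 1)) powr (- (real p + real q) / 2)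
         * Gamma_ratio (real p / 2) q
         * ((real q / 2) / (real q + real p - 1)) powr (real p / 2) / Gamma (real p / 2))"

lemma Hotelling_density_measurable [measurable]: "Hotelling_density p q \<in> borel_measurable borel"
  unfolding Hotelling_density_def[abs_def] by measurable

lemma F_density_measurable [measurable]: "F_density p q \<in> borel_measurable borel"
  unfolding F_density_def[abs_def] by measurable

text \<open>The right side is the density of the scaled variable, rearranged so that every factor
  has a limit of its own as \<open>q\<close> grows: the power of \<open>1 + y / (q + p - 1)\<close>
  becomes \<open>exp (- y / 2)\<close>, the gamma quotient 1, and the last power
  \<open>(1/2) powr (p / 2)\<close>.\<close>

lemma F_density_scaled:
  assumes p: "p > 0" and q: "q > 0"
  defines "s \<equiv> real p * (real q + real p - 1) / real q"
  shows "F_density p q (y / s) / s = Hotelling_density p q y"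
proof (cases "y > 0")
  case True
  let ?a = "real p / 2" and ?n = "real q + real p - 1"
  have n: "?n > 0" using p q by linarith
  have s: "s > 0" using p q n by (simp add: s_def)
  have rs: "real p / real q = s / ?n" 
  proof -
    have "s / ?n = real p / real q * (?n / ?n)" by (simp add: s_def)
    then show ?thesis using n by simp
  qed
  have pq: "real p / real q * (y / s) = y / ?n" unfolding rs using s n by (simp add: field_simps)
  have "(real p / real q) powr ?a * (y / s) powr (?a - 1) / s = y powr (?a - 1) / ?n powr ?a"
  proof -
    have sa: "s powr ?a = s powr (?a - 1) * s" using s by (simp add: powr_diff)
    show ?thesis unfolding rs powr_divide sa using s by simp
  qed
  moreover have "1 / Beta ?a (real q / 2) = Gamma (real q / 2 + ?a) / (Gamma (real q / 2) * Gamma ?a)"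
    by (simp add: Beta_def add.commute mult.commute)
  moreover have "((real q / 2) / ?n) powr ?a = (real q / 2) powr ?a / ?n powr ?a" by (rule powr_divide)
  moreover have "F_density p q (y / s) / s = ((real p / real q) powr ?a * (y / s) powr (?a - 1) / s)
      * (1 + real p / real q * (y / s)) powr (- (real p + real q) / 2) * (1 / Beta ?a (real q / 2))"
    using divide_pos_pos[OF True s] by (simp add: F_density_def)
  moreover have "(real q / 2) powr ?a > 0" using q by simp
  ultimately show ?thesis using True unfolding pq by (simp add: Hotelling_density_def)
next
  case False
  have "s \<ge> 0" using p by (simp add: s_def)
  then have "y / s \<le> 0" using False by (simp add: divide_nonpos_nonneg)
  then show ?thesis using False by (simp add: F_density_def Hotelling_density_def)
qed

lemma emeasure_Hotelling_law:
  assumes p: "p > 0" and q: "q > 0"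
  shows "emeasure (Hotelling_law p q) {..x} = (\<integral>\<^sup>+y. ennreal (Hotelling_density p q y) * indicator {..x} y \<partial>lborel)"
proof -
  define s where "s = real p * (real q + real p - 1) / real q"
  have s: "s > 0" unfolding s_def using p q by (intro divide_pos_pos mult_pos_pos) auto
  have "emeasure (Hotelling_law p q) {..x} = emeasure (density lborel (\<lambda>x. ennreal (F_density p q x))) {w. s * w \<le> x}"
    unfolding Hotelling_law_def s_def[symmetric] by (subst emeasure_distr) (auto intro!: arg_cong2[where f=emeasure])
  also have "\<dots> = (\<integral>\<^sup>+w. ennreal (F_density p q w) * indicator {w. s * w \<le> x} w \<partial>lborel)"
    by (subst emeasure_density) auto
  also have "\<dots> = ennreal \<bar>1 / s\<bar> * (\<integral>\<^sup>+y. ennreal (F_density p q (0 + 1 / s * y)) * indicator {w. s * w \<le> x} (0 + 1 / s * y) \<partial>lborel)"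
    using s by (intro nn_integral_real_affine) auto
  also have "\<dots> = (\<integral>\<^sup>+y. ennreal \<bar>1 / s\<bar> * (ennreal (F_density p q (0 + 1 / s * y)) * indicator {w. s * w \<le> x} (0 + 1 / s * y)) \<partial>lborel)"
    by (rule nn_integral_cmult[symmetric]) measurable
  also have "\<dots> = (\<integral>\<^sup>+y. ennreal (Hotelling_density p q y) * indicator {..x} y \<partial>lborel)"
  proof (intro nn_integral_cong)
    fix y :: real
    have "Hotelling_density p q y = 1 / s * F_density p q (1 / s * y)"
      using F_density_scaled[OF p q, of y, folded s_def] by simp
    then show "ennreal \<bar>1 / s\<bar> * (ennreal (F_density p q (0 + 1 / s * y)) * indicator {w. s * w \<le> x} (0 + 1 / s * y))
       = ennreal (Hotelling_density p q y) * indicator {..x} y"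
      using s ennreal_mult'[of "1 / s" "F_density p q (1 / s * y)"] by (simp add: indicator_def)
  qed
  finally show ?thesis .
qed

text \<open>Serves twice: for the integrable majorant of the Hotelling densities, which for
  \<open>p = 1\<close> are unbounded at 0, and for the volumes of ellipsoids.\<close>

lemma nn_integral_powr_interval:
  fixes a r :: real assumes a: "a > 0" and r: "r \<ge> 0"
  shows "(\<integral>\<^sup>+y. ennreal (if 0 < y \<and> y \<le> r then a * y powr (a - 1) else 0) \<partial>lborel) = ennreal (r powr a)"
proof -
  have "((\<lambda>x. a * x powr (a - 1)) has_integral a * (r powr (a - 1 + 1) / (a - 1 + 1))) {0..r}"
    using a r by (intro has_integral_mult_right has_integral_powr_from_0) auto
  then have "((\<lambda>y. if y \<in> {0..r} then a * y powr (a - 1) else 0) has_integral r powr a) UNIV"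
    using a by (subst has_integral_restrict_UNIV) simp
  then have "(\<integral>\<^sup>+y. ennreal (if y \<in> {0..r} then a * y powr (a - 1) else 0) \<partial>lborel) = ennreal (r powr a)"
    using a by (intro nn_integral_has_integral_lborel) auto
  also have "(\<integral>\<^sup>+y. ennreal (if y \<in> {0..r} then a * y powr (a - 1) else 0) \<partial>lborel)
     = (\<integral>\<^sup>+y. ennreal (if 0 < y \<and> y \<le> r then a * y powr (a - 1) else 0) \<partial>lborel)"
    by (intro nn_integral_cong) auto
  finally show ?thesis .
qed

lemma Hotelling_density_LIMSEQ:
  assumes p: "p > 0"
  shows "(\<lambda>q. Hotelling_density p q y) \<longlonglongrightarrow> chi_density p y"
proof (cases "y > 0")
  case True
  let ?a = "real p / 2"
  have 1: "(\<lambda>q. Gamma_ratio ?a q) \<longlonglongrightarrow> 1"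
    using p by (intro Gamma_half_ratio_LIMSEQ) auto
  have "(\<lambda>q. (real q / 2) / (real q + real p - 1)) \<longlonglongrightarrow> 1/2" by real_asymp
  then have 2: "(\<lambda>q. ((real q / 2) / (real q + real p - 1)) powr ?a) \<longlonglongrightarrow> (1/2) powr ?a"
    by (intro tendsto_powr tendsto_const) auto
  have 3: "(\<lambda>q. (1 + y / (real q + real p - 1)) powr (- (real p + real q) / 2)) \<longlonglongrightarrow> exp (- y / 2)"
    using True by real_asymp
  have G: "Gamma ?a \<noteq> 0" using Gamma_real_pos[of ?a] p by (intro less_imp_neq[THEN not_sym]) auto
  have "(\<lambda>q. Hotelling_density p q y) \<longlonglongrightarrow> y powr (?a - 1) * exp (- y / 2) * 1 * (1/2) powr ?a / Gamma ?a"
    unfolding Hotelling_density_def using True G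
    by (simp only: not_le if_False not_less[symmetric] simp_thms) (intro tendsto_mult tendsto_divide tendsto_const 1 2 3)
  also have "y powr (?a - 1) * exp (- y / 2) * 1 * (1/2) powr ?a / Gamma ?a = chi_density p y"
    using True by (simp add: chi_density_def powr_divide)
  finally show ?thesis .
qed (simp add: Hotelling_density_def chi_density_def)

text \<open>Dominated convergence of the densities on a half-line; the majorant lives on a bounded
  interval. The second claim guards against a default value: \<open>measure\<close> of an infinite
  mass is 0, so monotonicity of \<open>cdf\<close> needs finiteness.\<close>

lemma cdf_Hotelling_LIMSEQ:
  assumes p: "p > 0"
  shows "(\<lambda>q. cdf (Hotelling_law p q) x) \<longlonglongrightarrow> cdf (chi_law p) x"
    and "\<forall>\<^sub>F q in sequentially. emeasure (Hotelling_law p q) {..x} < \<infinity>"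
proof -
  let ?a = "real p / 2"
  have a: "?a > 0" using p by simp
  note G = Gamma_real_pos[OF a]
  have "\<forall>\<^sub>F q in sequentially. Gamma_ratio ?a q < 2"
    using Gamma_half_ratio_LIMSEQ[OF a] by (rule order_tendstoD) simp
  then obtain q0 where q0: "\<And>q. q \<ge> q0 \<Longrightarrow> Gamma_ratio ?a q < 2"
    by (auto simp: eventually_sequentially)
  \<comment> \<open>From \<open>q0\<close> on the gamma quotient is below 2, and the other two
    factors that depend on \<open>q\<close> are at most 1. The division by \<open>?a\<close> only
    brings the integrand to the form of \<open>nn_integral_powr_interval\<close>.\<close>
  define w where "w y = ennreal (2 / Gamma ?a / ?a) * ennreal (if 0 < y \<and> y \<le> max 0 x then ?a * y powr (?a - 1) else 0)" for y
  have w: "(\<integral>\<^sup>+y. w y \<partial>lborel) < \<infinity>"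
    unfolding w_def using nn_integral_powr_interval[OF a, of "max 0 x"]
    by (subst nn_integral_cmult) (auto simp: ennreal_mult_less_top)
  have bound: "ennreal (Hotelling_density p q y) * indicator {..x} y \<le> w y" if q: "q \<ge> q0 + 1" for q y
  proof (cases "0 < y \<and> y \<le> x")
    case True
    have n: "real q + real p - 1 > 0" using p q by linarith
    have "(1 + y / (real q + real p - 1)) powr (- (real p + real q) / 2) \<le> (1 + y / (real q + real p - 1)) powr 0"
      using True n by (intro powr_mono) auto
    then have b1: "(1 + y / (real q + real p - 1)) powr (- (real p + real q) / 2) \<le> 1"
      using True n by (simp split: if_splits)
    have "((real q / 2) / (real q + real p - 1)) powr ?a \<le> 1 powr ?a"
      using p q n by (intro powr_mono2) auto
    then have b2: "((real q / 2) / (real q + real p - 1)) powr ?a \<le> 1" by simp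
    have g: "0 \<le> Gamma_ratio ?a q" "Gamma_ratio ?a q \<le> 2" using q0[of q] q p by (auto intro!: divide_nonneg_nonneg mult_nonneg_nonneg less_imp_le[OF Gamma_real_pos])
    have "Hotelling_density p q y = y powr (?a - 1) * (1 + y / (real q + real p - 1)) powr (- (real p + real q) / 2)
         * Gamma_ratio ?a q * ((real q / 2) / (real q + real p - 1)) powr ?a / Gamma ?a"
      using True by (simp add: Hotelling_density_def)
    also have "\<dots> \<le> y powr (?a - 1) * 1 * 2 * 1 / Gamma ?a"
      using b1 b2 g G by (intro divide_right_mono mult_mono) auto
    also have "\<dots> = 2 / Gamma ?a / ?a * (?a * y powr (?a - 1))" using p by simp
    finally have "ennreal (Hotelling_density p q y) \<le> ennreal (2 / Gamma ?a / ?a * (?a * y powr (?a - 1)))"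
      by (rule ennreal_leI)
    also have "\<dots> = ennreal (2 / Gamma ?a / ?a) * ennreal (?a * y powr (?a - 1))"
      using G by (intro ennreal_mult) auto
    finally show ?thesis using True unfolding w_def by (simp add: indicator_def max_def)
  next
    case False
    then have "Hotelling_density p q y = 0 \<or> y > x" by (auto simp: Hotelling_density_def not_le)
    then show ?thesis by (auto simp: indicator_def)
  qed
  have conv: "(\<lambda>q. \<integral>\<^sup>+y. ennreal (Hotelling_density p (q + (q0 + 1)) y) * indicator {..x} y \<partial>lborel)
     \<longlonglongrightarrow> (\<integral>\<^sup>+y. ennreal (chi_density p y) * indicator {..x} y \<partial>lborel)"
  proof (rule nn_integral_dominated_convergence[where w=w])
    show "w \<in> borel_measurable lborel" unfolding w_def by measurable
    show "AE y in lborel. ennreal (Hotelling_density p (q + (q0 + 1)) y) * indicator {..x} y \<le> w y" for q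
      by (intro AE_I2 bound) simp
    show "AE y in lborel. (\<lambda>q. ennreal (Hotelling_density p (q + (q0 + 1)) y) * indicator {..x} y) \<longlonglongrightarrow> ennreal (chi_density p y) * indicator {..x} y"
    proof (intro AE_I2)
      fix y
      have "(\<lambda>q. ennreal (Hotelling_density p (q + (q0 + 1)) y)) \<longlonglongrightarrow> ennreal (chi_density p y)"
        by (intro tendsto_ennrealI LIMSEQ_ignore_initial_segment Hotelling_density_LIMSEQ p)
      then show "(\<lambda>q. ennreal (Hotelling_density p (q + (q0 + 1)) y) * indicator {..x} y) \<longlonglongrightarrow> ennreal (chi_density p y) * indicator {..x} y"
        by (cases "y \<le> x") (auto simp: indicator_def)
    qed
  qed (use w in auto)
  have H: "emeasure (Hotelling_law p (q + (q0 + 1))) {..x} = (\<integral>\<^sup>+y. ennreal (Hotelling_density p (q + (q0 + 1)) y) * indicator {..x} y \<partial>lborel)" for q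
    by (rule emeasure_Hotelling_law[OF p]) simp
  have chi: "emeasure (chi_law p) {..x} = (\<integral>\<^sup>+y. ennreal (chi_density p y) * indicator {..x} y \<partial>lborel)"
    unfolding chi_law_def by (subst emeasure_density) auto
  interpret chi: prob_space "chi_law p" by (rule prob_space_chi_law[OF p])
  have "(\<lambda>q. enn2real (emeasure (Hotelling_law p (q + (q0 + 1))) {..x})) \<longlonglongrightarrow> enn2real (emeasure (chi_law p) {..x})"
    using conv unfolding H chi[symmetric] by (intro tendsto_enn2real) (auto simp: chi.emeasure_eq_measure)
  then have "(\<lambda>q. cdf (Hotelling_law p (q + (q0 + 1))) x) \<longlonglongrightarrow> cdf (chi_law p) x"
    unfolding cdf_def2 measure_def .
  then show "(\<lambda>q. cdf (Hotelling_law p q) x) \<longlonglongrightarrow> cdf (chi_law p) x" by (rule LIMSEQ_offset)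
  show "\<forall>\<^sub>F q in sequentially. emeasure (Hotelling_law p q) {..x} < \<infinity>"
    using eventually_ge_at_top[of "q0 + 1"]
  proof eventually_elim
    case (elim q)
    then have "emeasure (Hotelling_law p q) {..x} = (\<integral>\<^sup>+y. ennreal (Hotelling_density p q y) * indicator {..x} y \<partial>lborel)"
      by (intro emeasure_Hotelling_law[OF p]) simp
    also have "\<dots> \<le> (\<integral>\<^sup>+y. w y \<partial>lborel)" by (intro nn_integral_mono bound elim)
    finally show ?case using w by (rule order_le_less_trans)
  qed
qed

text \<open>\<open>quantile\<close> is an infimum of reals, so the lower estimate needs the set to
  be nonempty and the upper one needs it bounded below. Nonemptiness comes from the limit at
  \<open>c + 1\<close>, the lower bound 0 from the absence of mass on the negative
  half-line.\<close>

lemma Hotelling_quantile_LIMSEQ: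
  assumes p: "p > 0" and u: "0 < u"
    and c: "\<And>x. x < c \<Longrightarrow> cdf (chi_law p) x < u" "\<And>x. x > c \<Longrightarrow> cdf (chi_law p) x > u"
  shows "(\<lambda>q. Hotelling_quantile u p q) \<longlonglongrightarrow> c"
proof (rule order_tendstoI)
  have low: "cdf (Hotelling_law p q) x < u" if q: "q > 0" and x: "x \<le> 0" for q x
  proof -
    have "emeasure (Hotelling_law p q) {..x} = 0"
      unfolding emeasure_Hotelling_law[OF p q] using x
      by (auto simp: nn_integral_0_iff_AE Hotelling_density_def split: split_indicator)
    then show ?thesis using u by (simp add: cdf_def2 measure_def)
  qed
  have mono: "cdf (Hotelling_law p q) x \<le> cdf (Hotelling_law p q) y"
    if "x \<le> y" "emeasure (Hotelling_law p q) {..y} < \<infinity>" for q x y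
    unfolding cdf_def2 measure_def using that
    by (intro enn2real_mono emeasure_mono) (auto simp: Hotelling_law_def)
  have ge: "\<forall>\<^sub>F q in sequentially. y \<le> Hotelling_quantile u p q" if y: "y < c" for y
  proof -
    have ne: "\<forall>\<^sub>F q in sequentially. cdf (Hotelling_law p q) (c + 1) > u"
      using cdf_Hotelling_LIMSEQ(1)[OF p] c(2)[of "c + 1"] by (intro order_tendstoD) auto
    have "\<forall>\<^sub>F q in sequentially. cdf (Hotelling_law p q) y < u"
      using cdf_Hotelling_LIMSEQ(1)[OF p] c(1)[OF y] by (intro order_tendstoD) auto
    then show ?thesis using cdf_Hotelling_LIMSEQ(2)[OF p, of y] ne
    proof eventually_elim
      case (elim q)
      show ?case unfolding Hotelling_quantile_def quantile_def
      proof (rule cInf_greatest)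
        show "{x. u \<le> cdf (Hotelling_law p q) x} \<noteq> {}" using elim(3) by (auto intro: less_imp_le)
        fix x assume x: "x \<in> {x. u \<le> cdf (Hotelling_law p q) x}"
        show "y \<le> x"
        proof (rule ccontr)
          assume "\<not> y \<le> x"
          then have "cdf (Hotelling_law p q) x \<le> cdf (Hotelling_law p q) y" using elim by (intro mono) auto
          then show False using elim x by simp
        qed
      qed
    qed
  qed
  show "\<forall>\<^sub>F q in sequentially. y < Hotelling_quantile u p q" if y: "y < c" for y
  proof -
    obtain z where "y < z" "z < c" using dense[OF y] by blast
    then show ?thesis using ge[of z] by (auto elim!: eventually_mono)
  qed
  show "\<forall>\<^sub>F q in sequentially. Hotelling_quantile u p q < y" if y: "y > c" for y
  proof -
    obtain z where z: "c < z" "z < y" using dense[OF y] by blast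
    have "\<forall>\<^sub>F q in sequentially. cdf (Hotelling_law p q) z > u"
      using cdf_Hotelling_LIMSEQ(1)[OF p] c(2)[OF z(1)] by (intro order_tendstoD) auto
    then show ?thesis using eventually_gt_at_top[of 0]
    proof eventually_elim
      case (elim q)
      have "Hotelling_quantile u p q \<le> z" unfolding Hotelling_quantile_def quantile_def
      proof (rule cInf_lower)
        show "bdd_below {x. u \<le> cdf (Hotelling_law p q) x}"
        proof (rule bdd_belowI[of _ 0])
          fix x assume "x \<in> {x. u \<le> cdf (Hotelling_law p q) x}"
          then show "0 \<le> x" using low[OF elim(2), of x] by (cases "x \<le> 0") auto
        qed
      qed (use elim in auto)
      then show ?case using z by simp
    qed
  qed
qed

section \<open>Quadratic forms of Gaussian vectors\<close>

lemma pos_definite_invertible: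
  fixes A :: "real^'p^'p" assumes "pos_definite A" shows "invertible A"
proof -
  have "inj ((*v) A)"
  proof (subst linear_injective_0[OF matrix_vector_mul_linear], intro allI impI)
    fix x assume "A *v x = 0"
    then have "x \<bullet> (A *v x) = 0" by simp
    then show "x = 0" using assms by (force simp: pos_definite_def)
  qed
  then show ?thesis by (simp add: invertible_left_inverse matrix_left_invertible_injective)
qed

lemma matrix_mult_matrix_inv:
  fixes A :: "real^'p^'p" assumes "invertible A" shows "A *v (matrix_inv A *v x) = x"
proof -
  have "A ** matrix_inv A = mat 1"
    using assms unfolding invertible_def matrix_inv_def by (rule someI2_ex) simp
  then show ?thesis by (simp add: matrix_vector_mul_assoc)
qed

text \<open>With \<open>v\<close> written as the image of some \<open>u\<close> under
  \<open>A\<close>, this is the form of \<open>A\<close> itself at \<open>u\<close>.\<close>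

lemma pos_definite_inverse_form:
  fixes A :: "real^'p^'p" assumes A: "pos_definite A" and v: "v \<noteq> 0"
  shows "0 < v \<bullet> (matrix_inv A *v v)"
proof -
  define u where "u = matrix_inv A *v v"
  have Au: "A *v u = v" unfolding u_def by (rule matrix_mult_matrix_inv[OF pos_definite_invertible[OF A]])
  then have "u \<noteq> 0" using v by auto
  then have "0 < u \<bullet> (A *v u)" using A by (auto simp: pos_definite_def)
  then show ?thesis unfolding Au by (simp add: u_def inner_commute)
qed

text \<open>Neither the volume of the ellipsoids nor the sign of \<open>det A\<close> is computed: both are forced by the total mass being \<open>1\<close>.\<close>

lemma distr_centered_normal:
  fixes A :: "real^'p^'p"
  assumes A: "pos_definite A" and mass: "emeasure (centered_normal A) UNIV = 1"
  shows "det A > 0"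
    and "distr (centered_normal A) borel (\<lambda>v. v \<bullet> (matrix_inv A *v v)) = chi_law CARD('p)"
proof -
  let ?p = "CARD('p)" let ?a = "real CARD('p) / 2"
  have a: "?a > 0" by simp
  define Q where "Q v = v \<bullet> (matrix_inv A *v v)" for v :: "real^'p"
  have Qc: "continuous_on UNIV Q" unfolding Q_def
    by (intro continuous_intros linear_continuous_on linear_conv_bounded_linear[THEN iffD1] matrix_vector_mul_linear)
  have Qm [measurable]: "Q \<in> borel_measurable borel" by (rule borel_measurable_continuous_onI[OF Qc])
  have Q0: "Q 0 = 0" by (simp add: Q_def)
  have Qpos: "Q v > 0" if "v \<noteq> 0" for v unfolding Q_def by (rule pos_definite_inverse_form[OF A that])
  have Qnn: "Q v \<ge> 0" for v using Qpos[of v] Q0 by (cases "v = 0") auto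
  have Qs: "Q (c *\<^sub>R v) = c\<^sup>2 * Q v" for c v
    by (simp add: Q_def matrix_vector_mult_scaleR power2_eq_square)
  define k where "k = 1 / sqrt ((2 * pi) ^ ?p * det A)"
  have dens: "exp (- (v \<bullet> (matrix_inv A *v v)) / 2) / sqrt ((2 * pi) ^ ?p * det A) = k * exp (- Q v / 2)" for v
    by (simp add: k_def Q_def)
  have N: "centered_normal A = density lborel (\<lambda>v. ennreal (k * exp (- Q v / 2)))"
    unfolding centered_normal_def dens ..
  show det: "det A > 0"
  proof (rule ccontr)
    \<comment> \<open>\<open>sqrt\<close> of a negative number is negative and division by 0 gives
      0, so \<open>ennreal\<close> would turn the density into 0 and the mass would vanish.\<close>
    assume "\<not> det A > 0"
    then have "(2 * pi) ^ ?p * det A \<le> 0" by (intro mult_nonneg_nonpos) auto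
    then have "k \<le> 0" unfolding k_def by (auto simp: divide_nonneg_nonpos)
    then have "ennreal (k * exp (- Q v / 2)) = 0" for v by (intro ennreal_neg) (simp add: mult_nonpos_nonneg)
    then have "emeasure (centered_normal A) UNIV = 0" unfolding N by (simp add: emeasure_density)
    then show False using mass by simp
  qed
  have k: "k > 0" using det by (simp add: k_def)
  define c0 where "c0 = emeasure lborel {v. Q v \<le> 1}"
  \<comment> \<open>\<open>Q\<close> is homogeneous of degree 2, so the ellipsoid of level
    \<open>r\<close> is the unit one dilated by \<open>sqrt r\<close>.\<close>
  have scale: "emeasure lborel {v. Q v \<le> r} = ennreal (r powr ?a) * c0" if r: "r > 0" for r
  proof -
    have s: "sqrt r \<noteq> 0" using r by simp
    have "emeasure lborel {v. Q v \<le> r} = emeasure (density (distr lborel borel (\<lambda>x::real^'p. 0 + sqrt r *\<^sub>R x)) (\<lambda>_. ennreal (\<bar>sqrt r\<bar> ^ DIM(real^'p)))) {v. Q v \<le> r}"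
      by (subst lborel_affine[OF s, of 0, symmetric]) (rule refl)
    also have "\<dots> = ennreal (\<bar>sqrt r\<bar> ^ DIM(real^'p)) * emeasure (distr lborel borel (\<lambda>x::real^'p. 0 + sqrt r *\<^sub>R x)) {v. Q v \<le> r}"
      by (subst emeasure_density) (auto simp: nn_integral_cmult_indicator)
    also have "emeasure (distr lborel borel (\<lambda>x::real^'p. 0 + sqrt r *\<^sub>R x)) {v. Q v \<le> r} = c0"
      unfolding c0_def using r by (subst emeasure_distr) (auto intro!: arg_cong[where f="emeasure lborel"] simp: Qs)
    also have "\<bar>sqrt r\<bar> ^ DIM(real^'p) = r powr ?a"
      using r by (simp add: powr_half_sqrt[symmetric] powr_powr flip: powr_realpow)
    finally show ?thesis .
  qed
  \<comment> \<open>On the unit ellipsoid the density is at least \<open>k * exp (- 1 / 2)\<close>,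
    and its total mass is 1.\<close>
  have c0fin: "c0 < \<infinity>"
  proof -
    have "ennreal (k * exp (- 1 / 2)) * c0 = (\<integral>\<^sup>+v. ennreal (k * exp (- 1 / 2)) * indicator {v. Q v \<le> 1} v \<partial>lborel)"
      unfolding c0_def by (subst nn_integral_cmult_indicator) auto
    also have "\<dots> \<le> (\<integral>\<^sup>+v. ennreal (k * exp (- Q v / 2)) \<partial>lborel)"
      using k by (intro nn_integral_mono) (auto simp: indicator_def intro!: ennreal_leI)
    also have "\<dots> = 1" using mass unfolding N by (simp add: emeasure_density)
    finally have "ennreal (k * exp (- 1 / 2)) * c0 < \<infinity>" by (rule order_le_less_trans) simp
    then show ?thesis using k by (auto simp: ennreal_mult_less_top)
  qed
  define c where "c = enn2real c0"
  have c: "c0 = ennreal c" "c \<ge> 0" using c0fin by (auto simp: c_def)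
  define g where "g y = (if 0 < y then c * (?a * y powr (?a - 1)) else 0)" for y :: real
  have g0: "g y \<ge> 0" for y using c by (simp add: g_def)
  have gm [measurable]: "g \<in> borel_measurable borel" unfolding g_def by measurable
  \<comment> \<open>The image of Lebesgue measure under \<open>Q\<close> is found from its values on
    half-lines. The Gaussian density is a function of \<open>Q\<close>, so integrating it against
    this image gives a multiple \<open>C\<close> of the chi-squared law.\<close>
  have push: "distr lborel borel Q = density lborel (\<lambda>y. ennreal (g y))"
  proof (rule measure_eqI_generator_eq[where E="range atMost" and \<Omega>=UNIV and A="\<lambda>i. {..real i}"])
    show "Int_stable (range atMost :: real set set)" by (auto simp: Int_stable_def)
    show "sets (distr lborel borel Q) = sigma_sets UNIV (range atMost)" by (simp add: borel_eq_atMost)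
    show "sets (density lborel (\<lambda>y. ennreal (g y))) = sigma_sets UNIV (range atMost)" by (simp add: borel_eq_atMost)
    show "(\<Union>i. {..real i}) = UNIV" using real_arch_simple by auto
    have L: "emeasure (distr lborel borel Q) {..r} = emeasure lborel {v. Q v \<le> r}" for r
      by (subst emeasure_distr) (auto intro!: arg_cong[where f="emeasure lborel"])
    have eq: "emeasure (distr lborel borel Q) {..r} = ennreal (c * max 0 r powr ?a)" for r
    proof (cases "r > 0")
      case True
      then show ?thesis unfolding L scale[OF True] c(1) using c by (simp add: ennreal_mult mult.commute max_def)
    next
      case False
      have "{v. Q v \<le> r} \<subseteq> {0}" using Qpos False by force
      then have "emeasure lborel {v. Q v \<le> r} \<le> emeasure lborel {0::real^'p}" by (intro emeasure_mono) auto
      then show ?thesis using False by (simp add: L max_def)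
    qed
    show "emeasure (distr lborel borel Q) {..real i} \<noteq> \<infinity>" for i unfolding eq by simp
    fix S :: "real set" assume "S \<in> range atMost"
    then obtain r where S: "S = {..r}" by auto
    have "emeasure (density lborel (\<lambda>y. ennreal (g y))) S = (\<integral>\<^sup>+y. ennreal (g y) * indicator {..r} y \<partial>lborel)"
      unfolding S by (subst emeasure_density) auto
    also have "\<dots> = (\<integral>\<^sup>+y. ennreal c * ennreal (if 0 < y \<and> y \<le> max 0 r then ?a * y powr (?a - 1) else 0) \<partial>lborel)"
    proof (intro nn_integral_cong)
      fix y
      have "ennreal (c * (?a * y powr (?a - 1))) = ennreal c * ennreal (?a * y powr (?a - 1))"
        using c(2) by (rule ennreal_mult')
      then show "ennreal (g y) * indicator {..r} y = ennreal c * ennreal (if 0 < y \<and> y \<le> max 0 r then ?a * y powr (?a - 1) else 0)"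
        by (auto simp: g_def indicator_def max_def simp del: times_divide_eq_left)
    qed
    also have "\<dots> = ennreal c * (\<integral>\<^sup>+y. ennreal (if 0 < y \<and> y \<le> max 0 r then ?a * y powr (?a - 1) else 0) \<partial>lborel)"
      by (rule nn_integral_cmult) measurable
    also have "\<dots> = ennreal (c * max 0 r powr ?a)"
      using c by (subst nn_integral_powr_interval[OF a]) (auto simp: ennreal_mult)
    finally show "emeasure (distr lborel borel Q) S = emeasure (density lborel (\<lambda>y. ennreal (g y))) S"
      unfolding S eq by simp
  qed auto
  define C where "C = k * c * ?a * (2 powr ?a * Gamma ?a)"
  have G: "2 powr ?a * Gamma ?a > 0" using Gamma_real_pos[OF a] by simp
  have Gne: "Gamma ?a \<noteq> 0" using Gamma_real_pos[OF a] by linarith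
  have C0: "C \<ge> 0" unfolding C_def using k c G by (intro mult_nonneg_nonneg) auto
  have Cchi: "ennreal (g y) * ennreal (k * exp (- y / 2)) = ennreal C * ennreal (chi_density ?p y)" for y
  proof -
    have "g y * (k * exp (- y / 2)) = C * chi_density ?p y"
      unfolding g_def C_def chi_density_def using G Gne by (simp add: field_simps)
    then show ?thesis using g0[of y] C0 by (simp flip: ennreal_mult')
  qed
  have em: "emeasure (distr (centered_normal A) borel Q) S = ennreal C * emeasure (chi_law ?p) S" if [measurable]: "S \<in> sets borel" for S
  proof -
    have [measurable]: "Q -` S \<in> sets borel" using measurable_sets_borel[OF Qm that] by simp
    have "emeasure (distr (centered_normal A) borel Q) S = (\<integral>\<^sup>+v. ennreal (k * exp (- Q v / 2)) * indicator S (Q v) \<partial>lborel)"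
      unfolding N by (subst emeasure_distr, simp, simp, subst emeasure_density) (auto intro!: nn_integral_cong simp: indicator_def)
    also have "\<dots> = (\<integral>\<^sup>+y. ennreal (k * exp (- y / 2)) * indicator S y \<partial>distr lborel borel Q)"
      by (subst nn_integral_distr) auto
    also have "\<dots> = (\<integral>\<^sup>+y. ennreal (g y) * (ennreal (k * exp (- y / 2)) * indicator S y) \<partial>lborel)"
      unfolding push by (subst nn_integral_density) auto
    also have "\<dots> = (\<integral>\<^sup>+y. ennreal C * (ennreal (chi_density ?p y) * indicator S y) \<partial>lborel)"
      by (simp only: mult.assoc[symmetric] Cchi)
    also have "\<dots> = ennreal C * emeasure (chi_law ?p) S"
      unfolding chi_law_def by (subst emeasure_density) (auto simp: nn_integral_cmult)
    finally show ?thesis .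
  qed
  interpret chi: prob_space "chi_law ?p" by (rule prob_space_chi_law) simp
  have "emeasure (distr (centered_normal A) borel Q) UNIV = 1"
  proof -
    have "Q \<in> borel_measurable (centered_normal A)" "space (centered_normal A) = UNIV" by (simp_all add: N)
    then show ?thesis by (simp add: emeasure_distr mass)
  qed
  then have "ennreal C = 1" using em[of UNIV] chi.emeasure_space_1 by simp
  then show "distr (centered_normal A) borel (\<lambda>v. v \<bullet> (matrix_inv A *v v)) = chi_law ?p"
    using em unfolding Q_def[abs_def] by (intro measure_eqI) auto
qed

section \<open>Inverse quadratic forms through determinants\<close>

lemma continuous_on_det:
  fixes f :: "'a::topological_space \<Rightarrow> real^'n^'n"
  assumes "continuous_on S f" shows "continuous_on S (\<lambda>x. det (f x))"
  unfolding det_def by (intro continuous_intros continuous_on_component assms)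

text \<open>
  By Cramer's rule this is \<open>v \<bullet> A\<^sup>-\<^sup>1 v\<close> for invertible \<open>A\<close>; unlike \<open>matrix_inv\<close>
  it is visibly measurable, and continuous where \<open>det A \<noteq> 0\<close>.
\<close>

definition inv_form :: "real^'n^'n \<Rightarrow> real^'n \<Rightarrow> real" where
  "inv_form A v = v \<bullet> (\<chi> k. det (\<chi> i j. if j = k then v $ i else A $ i $ j) / det A)"

lemma inv_form_eq:
  fixes A :: "real^'n^'n"
  assumes "invertible A" and "A *v x = v" shows "v \<bullet> x = inv_form A v"
  using cramer[of A x v] assms by (simp add: inv_form_def invertible_det_nz)

lemma continuous_on_inv_form:
  fixes f :: "'a::topological_space \<Rightarrow> real^'n^'n"
  assumes f: "continuous_on S f" and g: "continuous_on S g" and d: "\<And>x. x \<in> S \<Longrightarrow> det (f x) \<noteq> 0"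
  shows "continuous_on S (\<lambda>x. inv_form (f x) (g x))"
proof -
  have "continuous_on S (\<lambda>x. if j = k then g x $ i else f x $ i $ j)" for i j k
    by (cases "j = k") (auto intro!: continuous_on_component f g)
  then show ?thesis unfolding inv_form_def
    by (intro continuous_intros continuous_on_det f g ballI d)
qed

lemma measurable_det [measurable]:
  fixes f :: "'w \<Rightarrow> real^'n^'n"
  assumes "f \<in> borel_measurable M" shows "(\<lambda>w. det (f w)) \<in> borel_measurable M"
  using assms borel_measurable_continuous_onI[OF continuous_on_det[OF continuous_on_id]]
  by (rule measurable_compose)

text \<open>The numerator is continuous on all pairs, and real division is measurable with value 0
  at zero denominators; pulling out \<open>det\<close> avoids a case distinction for singular
  matrices.\<close>

lemma measurable_inv_form [measurable]:
  fixes f :: "'w \<Rightarrow> real^'n^'n"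
  assumes f: "f \<in> borel_measurable M" and g: "g \<in> borel_measurable M"
  shows "(\<lambda>w. inv_form (f w) (g w)) \<in> borel_measurable M"
proof -
  have eq: "inv_form A v = v \<bullet> (\<chi> k. det (\<chi> i j. if j = k then v $ i else A $ i $ j)) / det A" for A :: "real^'n^'n" and v
    by (simp add: inv_form_def inner_vec_def sum_divide_distrib)
  have "continuous_on UNIV (\<lambda>p :: (real^'n^'n) \<times> (real^'n). if j = k then snd p $ i else fst p $ i $ j)" for i j k :: 'n
    by (cases "j = k") (auto intro!: continuous_on_component continuous_intros)
  then have "continuous_on UNIV (\<lambda>p :: (real^'n^'n) \<times> (real^'n). snd p \<bullet> (\<chi> k. det (\<chi> i j. if j = k then snd p $ i else fst p $ i $ j)))"
    by (intro continuous_intros continuous_on_det)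
  then have c: "(\<lambda>p :: (real^'n^'n) \<times> (real^'n). snd p \<bullet> (\<chi> k. det (\<chi> i j. if j = k then snd p $ i else fst p $ i $ j))) \<in> borel_measurable borel"
    by (rule borel_measurable_continuous_onI)
  have "(\<lambda>w. (f w, g w)) \<in> borel_measurable M" using f g by measurable
  from measurable_compose[OF this c] have "(\<lambda>w. g w \<bullet> (\<chi> k. det (\<chi> i j. if j = k then g w $ i else f w $ i $ j))) \<in> borel_measurable M"
    unfolding fst_conv snd_conv .
  then show ?thesis unfolding eq using f by measurable
qed

lemma inv_form_scaleR:
  fixes A :: "real^'n^'n"
  assumes A: "invertible A" shows "inv_form A (c *\<^sub>R v) = c\<^sup>2 * inv_form A v"
proof -
  obtain B where B: "A ** B = mat 1" using A by (auto simp: invertible_def)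
  then have "A *v (B *v v) = v" by (simp add: matrix_vector_mul_assoc)
  moreover from this have "A *v (c *\<^sub>R (B *v v)) = c *\<^sub>R v" by (simp add: matrix_vector_mult_scaleR)
  ultimately show ?thesis
    using inv_form_eq[OF A, of "B *v v" v] inv_form_eq[OF A, of "c *\<^sub>R (B *v v)" "c *\<^sub>R v"] by (simp add: power2_eq_square)
qed

text \<open>\<open>\<tau>\<close> must serve all \<open>z\<close> in a ball at once, hence uniform
  continuity on a compact set of matrices and vectors on which the determinant does not
  vanish.\<close>

lemma inv_form_local:
  fixes A :: "real^'n^'n" and R \<eta> :: real
  assumes A: "det A \<noteq> 0" and \<eta>: "\<eta> > 0"
  obtains \<tau> where "\<tau> > 0"
    "\<And>B z z'. norm z \<le> R \<Longrightarrow> norm (z' - z) \<le> \<tau> \<Longrightarrow> norm (B - A) \<le> \<tau> \<Longrightarrow>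
        det B \<noteq> 0 \<and> \<bar>inv_form B z' - inv_form A z\<bar> < \<eta>"
proof -
  have "isCont det A" using continuous_on_det[OF continuous_on_id, of UNIV] by (auto simp: continuous_on_eq_continuous_at)
  then have "\<forall>\<^sub>F B in nhds A. det B \<noteq> 0" using A
    by (intro tendsto_imp_eventually_ne[of det "det A"]) (auto simp: isCont_def tendsto_at_iff_tendsto_nhds)
  then obtain r where r: "r > 0" "\<And>B. dist B A < r \<Longrightarrow> det B \<noteq> 0" by (auto simp: eventually_nhds_metric)
  let ?K = "cball A (r / 2) \<times> cball (0 :: real^'n) (\<bar>R\<bar> + 1)"
  have nz: "det B \<noteq> 0" if "B \<in> cball A (r / 2)" for B using that r by (intro r) (auto simp: dist_commute)
  have "continuous_on ?K (\<lambda>p. inv_form (fst p) (snd p))"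
    by (intro continuous_on_inv_form continuous_intros) (use nz in auto)
  moreover have "compact ?K" by (intro compact_Times compact_cball)
  ultimately have "uniformly_continuous_on ?K (\<lambda>p. inv_form (fst p) (snd p))"
    by (rule compact_uniformly_continuous)
  then obtain d where d: "d > 0" "\<And>p p'. p \<in> ?K \<Longrightarrow> p' \<in> ?K \<Longrightarrow> dist p' p < d \<Longrightarrow>
      dist (inv_form (fst p') (snd p')) (inv_form (fst p) (snd p)) < \<eta>"
    using \<eta> unfolding uniformly_continuous_on_def by metis
  \<comment> \<open>The three bounds keep \<open>B\<close> in the ball of invertible matrices,
    \<open>z'\<close> in the ball of radius \<open>R + 1\<close>, and the joint displacement below
    \<open>d\<close>.\<close>
  define \<tau> where "\<tau> = min (min (r / 2) 1) (d / 3)"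
  show ?thesis
  proof (rule that[of \<tau>])
    show "\<tau> > 0" using r d by (simp add: \<tau>_def)
    fix B and z z' :: "real^'n" assume z: "norm z \<le> R" and z': "norm (z' - z) \<le> \<tau>" and B: "norm (B - A) \<le> \<tau>"
    have "norm z' \<le> R + 1" using z z' norm_triangle_sub[of z' z] by (simp add: \<tau>_def)
    then have p': "(B, z') \<in> ?K" using B by (simp add: \<tau>_def dist_norm norm_minus_commute)
    have p: "(A, z) \<in> ?K" using z r by simp
    have "dist (B, z') (A, z) \<le> norm (B - A) + norm (z' - z)"
      by (simp add: dist_norm norm_Pair sqrt_sum_squares_le_sum)
    also have "\<dots> < d" using B z' d by (simp add: \<tau>_def)
    finally have "dist (inv_form B z') (inv_form A z) < \<eta>" using d(2)[OF p p'] by simp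
    then show "det B \<noteq> 0 \<and> \<bar>inv_form B z' - inv_form A z\<bar> < \<eta>"
      using nz p' by (simp add: dist_real_def)
  qed
qed

section \<open>The stopping time\<close>

text \<open>For positive \<open>n\<close> below \<open>nstar\<close> the indicator term already uses
  up the right side while \<open>1 / n\<close> is positive; at \<open>n = 0\<close> the left side is
  infinite.\<close>

lemma stop_condition_iff:
  fixes v K :: "nat \<Rightarrow> real"
  assumes K: "\<And>n. K n > 0" and \<epsilon>: "\<epsilon> > 0"
  shows "ereal (v n powr a + \<epsilon> * K n * indicator {..<nstar} n) + inverse (ereal (real n)) \<le> ereal (\<epsilon> * K n)
    \<longleftrightarrow> n \<ge> 1 \<and> n \<ge> nstar \<and> v n powr a + 1 / real n \<le> \<epsilon> * K n"
proof (cases "n = 0")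
  case False
  then have inv: "inverse (ereal (real n)) = ereal (1 / real n)" by (simp add: inverse_eq_divide)
  have "0 < 1 / real n" "0 \<le> v n powr a" using False by auto
  then have "0 < v n powr a + 1 / real n" by linarith
  then show ?thesis unfolding inv using False by (auto simp: indicator_def)
qed simp

text \<open>In this form a given value of the stopping time is a finite combination of conditions at
  indices up to that value, hence a measurable event.\<close>

lemma Inf_enat_eq:
  "Inf {enat n | n. Q n} = enat m \<longleftrightarrow> Q m \<and> (\<forall>j<m. \<not> Q j)"
proof -
  have "Inf {enat n | n. Q n} = (if \<exists>n. Q n then enat (LEAST n. Q n) else \<infinity>)"
  proof (cases "\<exists>n. Q n")
    case True
    then have "Q (LEAST n. Q n)" by (rule LeastI_ex)
    then have "Inf {enat n | n. Q n} = enat (LEAST n. Q n)"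
      by (intro antisym Inf_lower Inf_greatest) (auto intro: Least_le)
    then show ?thesis using True by simp
  next
    case False
    then have e: "{enat n | n. Q n} = {}" by auto
    show ?thesis unfolding e using False by (simp add: top_enat_def)
  qed
  moreover have "(\<exists>n. Q n) \<Longrightarrow> (LEAST n. Q n) = m \<longleftrightarrow> Q m \<and> (\<forall>j<m. \<not> Q j)"
    by (metis LeastI_ex Least_equality not_less not_less_Least)
  ultimately show ?thesis by auto
qed

text \<open>The term \<open>1 / n\<close> alone prevents stopping at a fixed \<open>n\<close> once
  \<open>\<epsilon> * K n\<close> is below it.\<close>

lemma fixed_volume_stop_tendsto_infinity:
  fixes K :: "nat \<Rightarrow> real"
  assumes K: "\<And>n. K n > 0"
  shows "((\<lambda>\<epsilon>. fixed_volume_stop p nstar v K \<epsilon>) \<longlongrightarrow> \<infinity>) (at_right 0)"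
proof (rule order_tendstoI)
  fix y :: enat assume "y < \<infinity>"
  then obtain N where N: "y = enat N" by (cases y) auto
  have pos: "\<forall>\<^sub>F \<epsilon> in at_right (0::real). \<epsilon> > 0" by (rule eventually_at_right_less)
  have "\<forall>\<^sub>F \<epsilon> in at_right 0. \<epsilon> * K n < 1 / real n" if "n \<in> {1..N}" for n
  proof -
    have "((\<lambda>\<epsilon>. \<epsilon> * K n) \<longlongrightarrow> 0 * K n) (at_right 0)" by (intro tendsto_intros)
    then show ?thesis using that by (intro order_tendstoD(2)) auto
  qed
  then have "\<forall>\<^sub>F \<epsilon> in at_right 0. \<forall>n\<in>{1..N}. \<epsilon> * K n < 1 / real n" by (intro eventually_ball_finite) auto
  then show "\<forall>\<^sub>F \<epsilon> in at_right 0. y < fixed_volume_stop p nstar v K \<epsilon>" using pos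
  proof eventually_elim
    case (elim \<epsilon>)
    have "enat (Suc N) \<le> fixed_volume_stop p nstar v K \<epsilon>"
      unfolding fixed_volume_stop_def
    proof (rule Inf_greatest)
      fix x assume "x \<in> {enat n |n. ereal (v n powr (1 / real p) + \<epsilon> * K n * indicator {..<nstar} n) + inverse (ereal (real n)) \<le> ereal (\<epsilon> * K n)}"
      then obtain n where x: "x = enat n" and n: "n \<ge> 1" "v n powr (1 / real p) + 1 / real n \<le> \<epsilon> * K n"
        unfolding stop_condition_iff[where K=K, OF K elim(2)] by auto
      have "1 / real n \<le> \<epsilon> * K n" using n(2) powr_ge_zero[of "v n" "1 / real p"] by linarith
      then have "n \<notin> {1..N}" using elim(1) by force
      then show "enat (Suc N) \<le> x" using n x by simp
    qed
    then show ?case unfolding N using less_le_trans[of "enat N" "enat (Suc N)"] by simp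
  qed
qed simp

text \<open>Multiplied by \<open>sqrt n / K n\<close> the stopping inequality becomes
  \<open>g n \<le> \<epsilon> * sqrt n\<close> with \<open>g\<close> tending to
  \<open>s = c / k\<close>, so stopping occurs near \<open>(s / \<epsilon>)\<^sup>2\<close>.\<close>

lemma fixed_volume_stop_rate:
  fixes v K :: "nat \<Rightarrow> real"
  assumes K: "\<And>n. K n > 0" and Klim: "K \<longlonglongrightarrow> k" and k: "k > 0"
    and vlim: "(\<lambda>n. sqrt (real n) * v n powr (1 / real p)) \<longlonglongrightarrow> c" and c: "c > 0"
    and lu: "l < (c / k)\<^sup>2" "(c / k)\<^sup>2 < u"
  shows "\<forall>\<^sub>F \<epsilon> in at_right 0. \<exists>n. fixed_volume_stop p nstar v K \<epsilon> = enat n \<and> l < \<epsilon>\<^sup>2 * real n \<and> \<epsilon>\<^sup>2 * real n < u"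
proof -
  let ?T = "fixed_volume_stop p nstar v K"
  define s where "s = c / k"
  have s: "s > 0" using c k by (simp add: s_def)
  \<comment> \<open>\<open>l\<close> may be negative while squares are compared below, hence the
    maximum with 0 in the witness.\<close>
  obtain s1 where s1: "0 \<le> s1" "s1 < s" "l \<le> s1\<^sup>2"
  proof (rule that[of "sqrt (max 0 l)"])
    show "sqrt (max 0 l) < s" using lu s by (intro real_less_lsqrt) (auto simp: s_def[symmetric])
  qed auto
  obtain z where z: "s\<^sup>2 < z" "z < u" using dense[OF lu(2)] by (auto simp: s_def)
  define s2 where "s2 = sqrt z"
  have z0: "z > 0" using z s by (smt (verit) zero_le_power2)
  have s2: "s < s2" "s2\<^sup>2 < u" using z z0 s by (auto simp: s2_def intro: real_less_rsqrt)
  define g where "g n = (sqrt (real n) * v n powr (1 / real p) + 1 / sqrt (real n)) / K n" for n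
  have "(\<lambda>n. 1 / sqrt (real n)) \<longlonglongrightarrow> 0" by real_asymp
  then have "g \<longlonglongrightarrow> (c + 0) / k" unfolding g_def using k by (intro tendsto_divide tendsto_add vlim Klim) auto
  then have glim: "g \<longlonglongrightarrow> s" by (simp add: s_def)
  have "\<forall>\<^sub>F n in sequentially. g n > s1 \<and> g n < s2"
    using order_tendstoD[OF glim] s1 s2 by (intro eventually_conj) auto
  then obtain N where N: "\<And>n. n \<ge> N \<Longrightarrow> g n > s1 \<and> g n < s2" by (auto simp: eventually_sequentially)
  have cond: "ereal (v n powr (1 / real p) + \<epsilon> * K n * indicator {..<nstar} n) + inverse (ereal (real n)) \<le> ereal (\<epsilon> * K n)
     \<longleftrightarrow> n \<ge> 1 \<and> n \<ge> nstar \<and> g n \<le> \<epsilon> * sqrt (real n)" if "\<epsilon> > 0" for \<epsilon> n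
  proof -
    have "v n powr (1 / real p) + 1 / real n \<le> \<epsilon> * K n \<longleftrightarrow> g n \<le> \<epsilon> * sqrt (real n)" if n: "n \<ge> 1"
    proof -
      have r: "sqrt (real n) > 0" using n by simp
      have "v n powr (1 / real p) + 1 / real n \<le> \<epsilon> * K n \<longleftrightarrow> sqrt (real n) * (v n powr (1 / real p) + 1 / real n) \<le> sqrt (real n) * (\<epsilon> * K n)"
        using r by simp
      also have "sqrt (real n) * (v n powr (1 / real p) + 1 / real n) = g n * K n"
        using K[of n] r n by (simp add: g_def distrib_left real_div_sqrt field_simps)
      also have "g n * K n \<le> sqrt (real n) * (\<epsilon> * K n) \<longleftrightarrow> g n \<le> \<epsilon> * sqrt (real n)"
        using K[of n] by (simp add: mult.left_commute mult.assoc[symmetric] mult.commute[of "sqrt (real n)"])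
      finally show ?thesis .
    qed
    then show ?thesis unfolding stop_condition_iff[where K=K, OF K that] by blast
  qed
  have pos: "\<forall>\<^sub>F \<epsilon> in at_right (0::real). \<epsilon> > 0" by (rule eventually_at_right_less)
  have ev1: "\<forall>\<^sub>F \<epsilon> in at_right 0. ?T \<epsilon> > enat N"
    using order_tendstoD(1)[OF fixed_volume_stop_tendsto_infinity[OF K], of "enat N"] by simp
  have "((\<lambda>\<epsilon>::real. s2\<^sup>2 + \<epsilon>\<^sup>2) \<longlongrightarrow> s2\<^sup>2 + 0\<^sup>2) (at_right 0)" by (intro tendsto_intros)
  then have ev2: "\<forall>\<^sub>F \<epsilon> in at_right 0. s2\<^sup>2 + \<epsilon>\<^sup>2 < u" using s2 by (intro order_tendstoD) auto
  have "filterlim (\<lambda>\<epsilon>. (s2 / \<epsilon>)\<^sup>2) at_top (at_right (0::real))" using s s2 by real_asymp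
  then have ev3: "\<forall>\<^sub>F \<epsilon> in at_right 0. (s2 / \<epsilon>)\<^sup>2 \<ge> real (N + nstar + 1)" by (simp add: filterlim_at_top)
  show ?thesis using pos ev1 ev2 ev3
  proof eventually_elim
    case (elim \<epsilon>)
    \<comment> \<open>A qualifying index, hence an upper bound for the stopping time; rounding up
      costs at most \<open>\<epsilon>\<^sup>2\<close> after scaling. The lower bound comes from
      \<open>g n > s1\<close> at the stopping time itself, which exceeds \<open>N\<close>.\<close>
    define n0 where "n0 = nat \<lceil>(s2 / \<epsilon>)\<^sup>2\<rceil>"
    have n0: "real n0 \<ge> (s2 / \<epsilon>)\<^sup>2" "real n0 < (s2 / \<epsilon>)\<^sup>2 + 1" unfolding n0_def by (simp_all add: real_nat_ceiling_ge) linarith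
    have "real n0 \<ge> real (N + nstar + 1)" using n0 elim by linarith
    then have n0': "n0 \<ge> N + nstar + 1" by (simp only: of_nat_le_iff)
    have "s2 / \<epsilon> \<le> sqrt (real n0)" using n0 by (intro real_le_rsqrt)
    then have "s2 \<le> \<epsilon> * sqrt (real n0)" using elim by (simp add: field_simps)
    then have "g n0 \<le> \<epsilon> * sqrt (real n0)" using N[of n0] n0' by simp
    then have "n0 \<ge> 1 \<and> n0 \<ge> nstar \<and> g n0 \<le> \<epsilon> * sqrt (real n0)" using n0' by simp
    then have "?T \<epsilon> \<le> enat n0" unfolding fixed_volume_stop_def
      by (intro Inf_lower CollectI exI[of _ n0] conjI refl iffD2[OF cond[OF elim(1)]]) simp_all
    then obtain n where n: "?T \<epsilon> = enat n" "n \<le> n0" by (cases "?T \<epsilon>") auto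
    then have "n > N" using elim(2) by simp
    have "g n \<le> \<epsilon> * sqrt (real n)"
      using n(1) unfolding fixed_volume_stop_def Inf_enat_eq cond[OF elim(1)] by simp
    then have "s1 < \<epsilon> * sqrt (real n)" using N[of n] \<open>n > N\<close> by force
    then have "s1\<^sup>2 < (\<epsilon> * sqrt (real n))\<^sup>2" using s1 by (intro power_strict_mono) auto
    then have low: "l < \<epsilon>\<^sup>2 * real n" using s1 by (simp add: power_mult_distrib)
    have "\<epsilon>\<^sup>2 * real n \<le> \<epsilon>\<^sup>2 * ((s2 / \<epsilon>)\<^sup>2 + 1)" using n n0 by (intro mult_left_mono) auto
    also have "\<dots> = s2\<^sup>2 + \<epsilon>\<^sup>2" using elim by (simp add: power_divide distrib_left)
    finally show ?case using n low elim by auto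
  qed
qed

section \<open>Randomly indexed sums\<close>

lemma norm_tail_small:
  fixes N :: "'v::euclidean_space measure"
  assumes N: "prob_space N" and s: "sets N = sets borel" and \<epsilon>: "\<epsilon> > 0"
  shows "\<exists>k::nat. measure N {v. norm v > real k} < \<epsilon>"
proof -
  interpret prob_space N by fact
  have [measurable]: "{v. norm v > real k} \<in> sets N" for k unfolding s by measurable
  have "(\<lambda>k. measure N {v. norm v > real k}) \<longlonglongrightarrow> measure N (\<Inter>k. {v. norm v > real k})"
    by (rule finite_Lim_measure_decseq) (auto simp: decseq_def intro: order_le_less_trans)
  also have "(\<Inter>k. {v::'v. norm v > real k}) = {}"
  proof -
    have "\<exists>k. \<not> norm v > real k" for v :: 'v using real_arch_simple[of "norm v"] by (auto simp: not_less)
    then show ?thesis by auto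
  qed
  finally have "(\<lambda>k. measure N {v. norm v > real k}) \<longlonglongrightarrow> 0" by simp
  then have "\<forall>\<^sub>F k in sequentially. measure N {v. norm v > real k} < \<epsilon>" using \<epsilon> by (rule order_tendstoD)
  then show ?thesis by (auto simp: eventually_sequentially)
qed

text \<open>Weak convergence, tested with a continuous ramp between the radii \<open>k\<close> and
  \<open>k + 1\<close>, handles all large \<open>n\<close>; each of the finitely many others has a
  radius of its own.\<close>

lemma weakly_converges_tight:
  fixes Z :: "nat \<Rightarrow> 'w \<Rightarrow> real^'p"
  assumes M: "prob_space M" and Z [measurable]: "\<And>n. Z n \<in> borel_measurable M"
    and N: "prob_space N" "sets N = sets borel"
    and w: "weakly_converges (\<lambda>n. distr M borel (Z n)) N" and \<epsilon>: "\<epsilon> > 0"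
  shows "\<exists>a>0. \<forall>n. \<P>(w in M. norm (Z n w) > a) \<le> \<epsilon>"
proof -
  interpret prob_space M by fact
  interpret N: prob_space N by fact
  have [measurable_cong]: "sets N = sets borel" by fact
  have Pn: "prob_space (distr M borel (Z n))" for n by (rule prob_space_distr) measurable
  have tail: "measure (distr M borel (Z n)) {v. norm v > b} = \<P>(w in M. norm (Z n w) > b)" for n b
    by (subst measure_distr) (auto intro!: arg_cong[where f=prob])
  have "\<forall>n. \<exists>k::nat. measure (distr M borel (Z n)) {v. norm v > real k} < \<epsilon>"
    by (intro allI norm_tail_small[OF Pn _ \<epsilon>]) simp
  then obtain b :: "nat \<Rightarrow> nat" where b: "\<And>n. \<P>(w in M. norm (Z n w) > real (b n)) < \<epsilon>"
    unfolding tail by metis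
  obtain k :: nat where k: "measure N {v. norm v > real k} < \<epsilon>" using norm_tail_small[OF N \<epsilon>] by blast
  define \<phi> where "\<phi> v = min 1 (max 0 (norm v - real k))" for v :: "real^'p"
  have \<phi>01: "0 \<le> \<phi> v" "\<phi> v \<le> 1" for v by (auto simp: \<phi>_def)
  have \<phi>c: "continuous_on UNIV \<phi>" unfolding \<phi>_def by (intro continuous_intros)
  have \<phi>m [measurable]: "\<phi> \<in> borel_measurable borel" by (rule borel_measurable_continuous_onI[OF \<phi>c])
  have "bounded (range \<phi>)" by (rule boundedI[where B=1]) (auto simp: \<phi>01)
  then have lim: "(\<lambda>n. \<integral>v. \<phi> v \<partial>distr M borel (Z n)) \<longlonglongrightarrow> (\<integral>v. \<phi> v \<partial>N)"
    using w \<phi>c unfolding weakly_converges_def by blast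
  have "(\<integral>v. \<phi> v \<partial>N) \<le> (\<integral>v. indicator {v. norm v > real k} v \<partial>N)"
    by (intro integral_mono N.integrable_const_bound[where B=1]) (auto simp: \<phi>01, auto simp: \<phi>_def indicator_def)
  also have "\<dots> = measure N {v. norm v > real k}" using sets_eq_imp_space_eq[OF N(2)] by simp
  also note k
  finally have "\<forall>\<^sub>F n in sequentially. (\<integral>v. \<phi> v \<partial>distr M borel (Z n)) < \<epsilon>" using lim by (intro order_tendstoD)
  then obtain n0 where n0: "\<And>n. n \<ge> n0 \<Longrightarrow> (\<integral>v. \<phi> v \<partial>distr M borel (Z n)) < \<epsilon>" by (auto simp: eventually_sequentially)
  have big: "\<P>(w in M. norm (Z n w) > real k + 1) < \<epsilon>" if "n \<ge> n0" for n
  proof -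
    have "\<P>(w in M. norm (Z n w) > real k + 1) = expectation (indicator {w \<in> space M. norm (Z n w) > real k + 1})" by simp
    also have "\<dots> \<le> expectation (\<lambda>w. \<phi> (Z n w))"
      by (intro integral_mono integrable_const_bound[where B=1]) (auto simp: \<phi>01, auto simp: \<phi>_def indicator_def)
    also have "\<dots> = (\<integral>v. \<phi> v \<partial>distr M borel (Z n))" by (rule integral_distr[symmetric]) measurable
    finally show ?thesis using n0[OF that] by simp
  qed
  define a where "a = real k + 1 + (\<Sum>n<n0. real (b n))"
  have "\<P>(w in M. norm (Z n w) > a) \<le> \<epsilon>" for n
  proof (cases "n < n0")
    case True
    then have "real (b n) \<le> (\<Sum>n<n0. real (b n))" by (intro member_le_sum) auto
    then have "\<P>(w in M. norm (Z n w) > a) \<le> \<P>(w in M. norm (Z n w) > real (b n))"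
      by (intro finite_measure_mono) (auto simp: a_def)
    then show ?thesis using b[of n] by simp
  next
    case False
    have "real k + 1 \<le> a" by (simp add: a_def sum_nonneg)
    then have "\<P>(w in M. norm (Z n w) > a) \<le> \<P>(w in M. norm (Z n w) > real k + 1)"
      by (intro finite_measure_mono) auto
    then show ?thesis using big[of n] False by simp
  qed
  moreover have "a > 0" by (simp add: a_def sum_nonneg add_pos_nonneg)
  ultimately show ?thesis by blast
qed

text \<open>With S for the partial sums, \<open>Z k - Z n\<close> is (S k - S n) / sqrt k plus (sqrt
  n / sqrt k - 1) times \<open>Z n\<close>: the oscillation of the sums controls the first part,
  tightness of \<open>Z n\<close> and a narrow window the second.\<close>

lemma (in poly_chain) anscombe_normalized:
  fixes f :: "'a \<Rightarrow> 'v::euclidean_space"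
  defines "Z \<equiv> \<lambda>n w. (1 / sqrt (real n)) *\<^sub>R inc f 0 n w"
  assumes f [measurable]: "f \<in> borel_measurable F" and \<delta>: "\<delta> > 0" and int: "integrable F (\<lambda>x. norm (f x) powr (2 + \<delta>))"
    and m: "m > 1 + 2 / \<delta>"
    and tight: "\<And>\<epsilon>. \<epsilon> > 0 \<Longrightarrow> \<exists>a>0. \<forall>n. \<P>(w in M. norm (Z n w) > a) \<le> \<epsilon>"
    and \<tau>: "\<tau> > 0" and \<epsilon>: "\<epsilon> > 0"
  shows "\<exists>d>0. \<forall>\<^sub>F n in sequentially.
     \<P>(w in M. oscillates Z d n \<tau> w) \<le> \<epsilon>"
proof -
  have Zm [measurable]: "Z n \<in> borel_measurable M" for n unfolding Z_def by measurable
  have incZ: "norm (inc f 0 n w) = sqrt (real n) * norm (Z n w)" for n w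
    by (cases "n = 0") (simp_all add: Z_def)
  have tight': "\<exists>a>0. \<forall>n. \<P>(w in M. norm (inc f 0 n w) > a * sqrt (real n)) \<le> \<epsilon>'" if pos: "\<epsilon>' > 0" for \<epsilon>'
  proof -
    obtain a where a: "a > 0" "\<And>n. \<P>(w in M. norm (Z n w) > a) \<le> \<epsilon>'" using tight[OF pos] by blast
    have "\<P>(w in M. norm (inc f 0 n w) > a * sqrt (real n)) \<le> \<P>(w in M. norm (Z n w) > a)" for n
      by (intro finite_measure_mono) (auto simp: incZ mult.commute[of a] intro: mult_left_less_imp_less[of "sqrt (real n)"])
    then show ?thesis using a order_trans by blast
  qed
  have e2: "\<epsilon> / 2 > 0" using \<epsilon> by simp
  obtain R where R: "R > 0" "\<And>n. \<P>(w in M. norm (Z n w) > R) \<le> \<epsilon> / 2" using tight[OF e2] by blast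
  have "\<tau> / 4 > 0" using \<tau> by simp
  from anscombe[OF f \<delta> int m tight' this e2] obtain d0 where d0: "d0 > 0"
    and ev: "\<forall>\<^sub>F n in sequentially. \<P>(w in M. oscillates (inc f 0) d0 n (\<tau> / 4 * sqrt (real n)) w) \<le> \<epsilon> / 2"
    by blast
  \<comment> \<open>\<open>d \<le> 1/2\<close> gives \<open>k \<ge> n / 2\<close>, hence the scale
    factor \<open>s\<close> below is at most 2 and differs from 1 by at most \<open>2 * d\<close>;
    each of the two parts is then at most \<open>\<tau> / 2\<close>.\<close>
  define d where "d = min (min d0 (1/2)) (\<tau> / (4 * R))"
  have d: "d > 0" "d \<le> d0" "d \<le> 1/2" "d \<le> \<tau> / (4 * R)" using d0 \<tau> R by (auto simp: d_def)
  have dR: "2 * d * R \<le> \<tau> / 2" using d(4) R by (simp add: field_simps)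
  have "\<forall>\<^sub>F n in sequentially. \<P>(w in M. oscillates Z d n \<tau> w) \<le> \<epsilon>"
    using ev eventually_gt_at_top[of 0]
  proof eventually_elim
    case (elim n)
    let ?A = "{w \<in> space M. oscillates (inc f 0) d0 n (\<tau> / 4 * sqrt (real n)) w}"
    let ?B = "{w \<in> space M. norm (Z n w) > R}"
    have "{w \<in> space M. oscillates Z d n \<tau> w} \<subseteq> ?A \<union> ?B"
    proof (intro subsetI, rule ccontr)
      fix w assume "w \<in> {w \<in> space M. oscillates Z d n \<tau> w}" and nw: "w \<notin> ?A \<union> ?B"
      then obtain k where w: "w \<in> space M" and k: "\<bar>real k - real n\<bar> \<le> d * real n" "norm (Z k w - Z n w) > \<tau>" by auto
      have "d * real n \<le> d0 * real n" using d by (intro mult_right_mono) auto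
      then have "\<bar>real k - real n\<bar> \<le> d0 * real n" using k(1) by linarith
      then have iA: "norm (inc f 0 k w - inc f 0 n w) \<le> \<tau> / 4 * sqrt (real n)" using nw w by (auto simp: not_less)
      have zR: "norm (Z n w) \<le> R" using nw w by auto
      have "d * real n \<le> 1/2 * real n" using d by (intro mult_right_mono) auto
      then have kn: "real k \<ge> real n / 2" using k(1) by linarith
      have n0: "real n > 0" "real k > 0" using elim kn by auto
      define s where "s = sqrt (real n) / sqrt (real k)"
      have s0: "s \<ge> 0" by (simp add: s_def)
      have s2: "s\<^sup>2 = real n / real k" using n0 by (simp add: s_def power_divide)
      have "s\<^sup>2 \<le> 2" unfolding s2 using kn n0 by (simp add: field_simps)
      then have "s\<^sup>2 \<le> 2\<^sup>2" by simp
      then have sle: "s \<le> 2" by (rule power2_le_imp_le) simp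
      have "\<bar>s - 1\<bar> * 1 \<le> \<bar>s - 1\<bar> * (s + 1)" using s0 by (intro mult_left_mono) auto
      also have "\<dots> = \<bar>(s - 1) * (s + 1)\<bar>" using s0 by (simp add: abs_mult)
      also have "(s - 1) * (s + 1) = s\<^sup>2 - 1" by (simp add: power2_eq_square algebra_simps)
      also have "s\<^sup>2 - 1 = (real n - real k) / real k" unfolding s2 using n0 by (simp add: field_simps)
      also have "\<bar>(real n - real k) / real k\<bar> = \<bar>real k - real n\<bar> / real k" by (simp add: abs_minus_commute)
      also have "\<dots> \<le> d * real n / (real n / 2)" using k(1) kn n0 d by (intro frac_le) auto
      also have "\<dots> = 2 * d" using n0 by simp
      finally have s1: "\<bar>s - 1\<bar> \<le> 2 * d" by simp
      have "Z k w - Z n w = (1 / sqrt (real k)) *\<^sub>R (inc f 0 k w - inc f 0 n w) + (s - 1) *\<^sub>R Z n w"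
        using n0 by (simp add: Z_def s_def algebra_simps)
      then have "norm (Z k w - Z n w) \<le> norm ((1 / sqrt (real k)) *\<^sub>R (inc f 0 k w - inc f 0 n w)) + norm ((s - 1) *\<^sub>R Z n w)"
        using norm_triangle_ineq by metis
      also have "norm ((1 / sqrt (real k)) *\<^sub>R (inc f 0 k w - inc f 0 n w)) \<le> (1 / sqrt (real k)) * (\<tau> / 4 * sqrt (real n))"
        unfolding norm_scaleR using iA by (intro mult_mono) auto
      also have "\<dots> = \<tau> / 4 * s" by (simp add: s_def)
      also have "\<dots> \<le> \<tau> / 4 * 2" using sle \<tau> by (intro mult_left_mono) auto
      also have "norm ((s - 1) *\<^sub>R Z n w) \<le> 2 * d * R" using s1 zR by (auto intro!: mult_mono)
      finally show False using k(2) dR by simp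
    qed
    then have "\<P>(w in M. oscillates Z d n \<tau> w) \<le> prob (?A \<union> ?B)"
      by (intro finite_measure_mono) measurable
    also have "\<dots> \<le> prob ?A + prob ?B" by (intro measure_Un_le) measurable
    also have "\<dots> \<le> \<epsilon>" using elim(1) R(2)[of n] by linarith
    finally show ?case .
  qed
  then show ?thesis using d by blast
qed

text \<open>Outside an event of small probability, \<open>E k\<close> lies between two inequalities
  for the form with the fixed matrix \<open>\<Sigma>\<close> at the deterministic index
  \<open>a k\<close>, and to these weak convergence applies. Singular estimates occur on the
  exceptional event only, so \<open>EE\<close> may leave \<open>E k\<close> open there.\<close>

lemma (in prob_space) random_index_ellipsoid:
  fixes Z :: "nat \<Rightarrow> 'a \<Rightarrow> real^'p" and B :: "nat \<Rightarrow> 'a \<Rightarrow> real^'p^'p" and T :: "nat \<Rightarrow> 'a \<Rightarrow> enat"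
  assumes Z [measurable]: "\<And>n. Z n \<in> borel_measurable M" and B [measurable]: "\<And>n. B n \<in> borel_measurable M"
    and T [measurable]: "\<And>k n. {w \<in> space M. T k w = enat n} \<in> sets M" and E [measurable]: "\<And>k. E k \<in> sets M"
    and det: "det \<Sigma> \<noteq> 0"
    and weak: "\<And>\<psi>::real \<Rightarrow> real. continuous_on UNIV \<psi> \<Longrightarrow> bounded (range \<psi>) \<Longrightarrow>
       (\<lambda>n. expectation (\<lambda>w. \<psi> (inv_form \<Sigma> (Z n w)))) \<longlonglongrightarrow> (\<integral>x. \<psi> x \<partial>\<nu>)"
    and chi: "real_distribution \<nu>" and cont: "isCont (cdf \<nu>) c"
    and tight: "\<And>\<epsilon>. \<epsilon> > 0 \<Longrightarrow> \<exists>a>0. \<forall>n. \<P>(w in M. norm (Z n w) > a) \<le> \<epsilon>"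
    and ans: "\<And>\<tau> \<epsilon>. \<tau> > 0 \<Longrightarrow> \<epsilon> > 0 \<Longrightarrow> \<exists>d>0. \<forall>\<^sub>F n in sequentially.
       \<P>(w in M. oscillates Z d n \<tau> w) \<le> \<epsilon>"
    and a: "filterlim a at_top sequentially"
    and conv: "AE w in M. \<forall>d>0. \<forall>\<^sub>F k in sequentially. \<exists>n. T k w = enat n \<and>
       \<bar>real n - real (a k)\<bar> \<le> d * real (a k) \<and> norm (B n w - \<Sigma>) \<le> d \<and> \<bar>t n - c\<bar> \<le> d"
    and EE: "\<And>k n w. w \<in> space M \<Longrightarrow> T k w = enat n \<Longrightarrow> det (B n w) \<noteq> 0 \<Longrightarrow>
       w \<in> E k \<longleftrightarrow> inv_form (B n w) (Z n w) < t n"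
  shows "(\<lambda>k. prob (E k)) \<longlonglongrightarrow> cdf \<nu> c"
proof -
  interpret chi: real_distribution \<nu> by fact
  have bounds: "\<forall>\<^sub>F k in sequentially. prob (E k) \<le> cdf \<nu> (c + 3 * \<eta>) + 4 * \<eta> \<and> cdf \<nu> (c - 3 * \<eta>) - 4 * \<eta> \<le> prob (E k)"
    if \<eta>: "\<eta> > 0" for \<eta>
  proof -
    obtain R where R: "R > 0" "\<And>n. \<P>(w in M. norm (Z n w) > R) \<le> \<eta>" using tight[OF \<eta>] by blast
    obtain \<tau> where \<tau>: "\<tau> > 0" "\<And>B z z'. norm z \<le> R \<Longrightarrow> norm (z' - z) \<le> \<tau> \<Longrightarrow> norm (B - \<Sigma>) \<le> \<tau> \<Longrightarrow>
        det B \<noteq> 0 \<and> \<bar>inv_form B z' - inv_form \<Sigma> z\<bar> < \<eta>"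
      using inv_form_local[OF det \<eta>, of R] by blast
    obtain d0 where d0: "d0 > 0" "\<forall>\<^sub>F n in sequentially.
       \<P>(w in M. oscillates Z d0 n \<tau> w) \<le> \<eta>"
      using ans[OF \<tau>(1) \<eta>] by blast
    define d where "d = min d0 (min \<tau> \<eta>)"
    have d: "d > 0" "d \<le> d0" "d \<le> \<tau>" "d \<le> \<eta>" using d0 \<tau> \<eta> by (auto simp: d_def)
    define G where "G k = {w \<in> space M. \<exists>n. T k w = enat n \<and>
       \<bar>real n - real (a k)\<bar> \<le> d * real (a k) \<and> norm (B n w - \<Sigma>) \<le> d \<and> \<bar>t n - c\<bar> \<le> d}" for k
    have G [measurable]: "G k \<in> sets M" for k
    proof -
      have "G k = (\<Union>n. {w \<in> space M. T k w = enat n} \<inter> {w \<in> space M. \<bar>real n - real (a k)\<bar> \<le> d * real (a k) \<and> norm (B n w - \<Sigma>) \<le> d \<and> \<bar>t n - c\<bar> \<le> d})"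
        by (auto simp: G_def)
      also have "\<dots> \<in> sets M" by (intro sets.countable_UN image_subsetI sets.Int T) measurable
      finally show ?thesis .
    qed
    \<comment> \<open>Dominated convergence turns the almost sure statement \<open>conv\<close> into
      one on probabilities.\<close>
    have "(\<lambda>k. expectation (indicator (space M - G k) :: _ \<Rightarrow> real)) \<longlonglongrightarrow> expectation (\<lambda>w. 0)"
    proof (rule integral_dominated_convergence[where w="\<lambda>_. 1"])
      show "AE w in M. (\<lambda>k. indicator (space M - G k) w :: real) \<longlonglongrightarrow> 0"
        using conv AE_space
      proof eventually_elim
        case (elim w)
        then have "\<forall>\<^sub>F k in sequentially. w \<in> G k" using d(1) by (auto simp: G_def)
        then have "\<forall>\<^sub>F k in sequentially. (indicator (space M - G k) w :: real) = 0" by eventually_elim simp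
        then show ?case by (rule tendsto_eventually)
      qed
    qed (auto simp: indicator_def)
    then have "(\<lambda>k. prob (space M - G k)) \<longlonglongrightarrow> 0" by (simp add: Int_absorb1)
    then have evG: "\<forall>\<^sub>F k in sequentially. prob (space M - G k) < \<eta>" using \<eta> by (rule order_tendstoD)
    have evA: "\<forall>\<^sub>F k in sequentially. \<P>(w in M. oscillates Z d0 (a k) \<tau> w) \<le> \<eta>"
      using d0(2) a by (rule eventually_compose_filterlim)
    \<comment> \<open>Continuous ramps in place of indicators of half-lines: 1 up to
      \<open>u\<close>, 0 from \<open>u + \<eta>\<close> on.\<close>
    define \<psi> where "\<psi> u x = max 0 (min 1 ((u + \<eta> - x) / \<eta>))" for u x :: real
    have \<psi>c: "continuous_on UNIV (\<psi> u)" for u unfolding \<psi>_def using \<eta> by (intro continuous_intros) auto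
    have [measurable]: "\<psi> u \<in> borel_measurable borel" for u by (rule borel_measurable_continuous_onI[OF \<psi>c])
    have \<psi>01: "0 \<le> \<psi> u x" "\<psi> u x \<le> 1" for u x by (auto simp: \<psi>_def)
    have \<psi>b: "bounded (range (\<psi> u))" for u by (rule boundedI[where B=1]) (auto simp: \<psi>01)
    have \<psi>1: "\<psi> u x = 1" if "x \<le> u" for u x
    proof -
      have "1 \<le> (u + \<eta> - x) / \<eta>" using that \<eta> by (simp add: field_simps)
      then show ?thesis by (simp add: \<psi>_def)
    qed
    have \<psi>0: "\<psi> u x = 0" if "x \<ge> u + \<eta>" for u x
    proof -
      have "(u + \<eta> - x) / \<eta> \<le> 0" using that \<eta> by (simp add: divide_nonpos_pos)
      then show ?thesis by (simp add: \<psi>_def)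
    qed
    have wk: "(\<lambda>k. expectation (\<lambda>w. \<psi> u (inv_form \<Sigma> (Z (a k) w)))) \<longlonglongrightarrow> (\<integral>x. \<psi> u x \<partial>\<nu>)" for u
      using filterlim_compose[OF weak[OF \<psi>c \<psi>b] a] .
    have mz [measurable]: "(\<lambda>w. inv_form \<Sigma> (Z n w)) \<in> borel_measurable M" for n by measurable
    have "(\<integral>x. \<psi> (c + 2 * \<eta>) x \<partial>\<nu>) \<le> (\<integral>x. indicator {..c + 3 * \<eta>} x \<partial>\<nu>)"
      using \<psi>0[of "c + 2 * \<eta>"] by (intro integral_mono chi.integrable_const_bound[where B=1]) (auto simp: \<psi>01 indicator_def)
    then have up1: "(\<integral>x. \<psi> (c + 2 * \<eta>) x \<partial>\<nu>) < cdf \<nu> (c + 3 * \<eta>) + \<eta>" using \<eta> by (simp add: cdf_def2)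
    have evU: "\<forall>\<^sub>F k in sequentially. expectation (\<lambda>w. \<psi> (c + 2 * \<eta>) (inv_form \<Sigma> (Z (a k) w))) < cdf \<nu> (c + 3 * \<eta>) + \<eta>"
      by (rule order_tendstoD(2)[OF wk up1])
    have "(\<integral>x. indicator {..c - 3 * \<eta>} x \<partial>\<nu>) \<le> (\<integral>x. \<psi> (c - 3 * \<eta>) x \<partial>\<nu>)"
      using \<psi>1[of _ "c - 3 * \<eta>"] by (intro integral_mono chi.integrable_const_bound[where B=1]) (auto simp: \<psi>01 indicator_def)
    then have lo1: "cdf \<nu> (c - 3 * \<eta>) - \<eta> < (\<integral>x. \<psi> (c - 3 * \<eta>) x \<partial>\<nu>)" using \<eta> by (simp add: cdf_def2)
    have evL: "\<forall>\<^sub>F k in sequentially. cdf \<nu> (c - 3 * \<eta>) - \<eta> < expectation (\<lambda>w. \<psi> (c - 3 * \<eta>) (inv_form \<Sigma> (Z (a k) w)))"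
      by (rule order_tendstoD(1)[OF wk lo1])
    show ?thesis using evG evA evU evL
    proof eventually_elim
      case (elim k)
      define q where "q w = inv_form \<Sigma> (Z (a k) w)" for w
      have [measurable]: "q \<in> borel_measurable M" unfolding q_def by measurable
      let ?A = "{w \<in> space M. oscillates Z d0 (a k) \<tau> w}"
      let ?R = "{w \<in> space M. norm (Z (a k) w) > R}"
      let ?bad = "(space M - G k) \<union> (?A \<union> ?R)"
      have bad: "prob ?bad \<le> 3 * \<eta>"
      proof -
        have "prob ?bad \<le> prob (space M - G k) + (prob ?A + prob ?R)"
          by (intro order_trans[OF measure_Un_le] add_left_mono measure_Un_le) measurable
        then show ?thesis using elim(1,2) R(2)[of "a k"] by linarith
      qed
      \<comment> \<open>One \<open>\<eta>\<close> is for the moving threshold \<open>t n\<close>,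
        one for the change of the form; the ramp adds a third. Of the \<open>4 * \<eta>\<close> in
        the bounds, three are for the exceptional event and one for the limit of
        expectations.\<close>
      have key: "(w \<in> E k \<longrightarrow> q w < c + 2 * \<eta>) \<and> (q w < c - 2 * \<eta> \<longrightarrow> w \<in> E k)" if w: "w \<in> space M" "w \<notin> ?bad" for w
      proof -
        have "w \<in> G k" using w by auto
        then obtain n where n: "T k w = enat n" "\<bar>real n - real (a k)\<bar> \<le> d * real (a k)" "norm (B n w - \<Sigma>) \<le> d" "\<bar>t n - c\<bar> \<le> d"
          by (auto simp: G_def)
        have "d * real (a k) \<le> d0 * real (a k)" using d by (intro mult_right_mono) auto
        then have "\<bar>real n - real (a k)\<bar> \<le> d0 * real (a k)" using n(2) by linarith
        then have "norm (Z n w - Z (a k) w) \<le> \<tau>" using w by (auto simp: not_less)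
        moreover have "norm (Z (a k) w) \<le> R" using w by auto
        moreover have "norm (B n w - \<Sigma>) \<le> \<tau>" using n d by linarith
        ultimately have "det (B n w) \<noteq> 0" "\<bar>inv_form (B n w) (Z n w) - q w\<bar> < \<eta>" using \<tau>(2) unfolding q_def by blast+
        moreover from this have "w \<in> E k \<longleftrightarrow> inv_form (B n w) (Z n w) < t n" by (intro EE w n)
        moreover have "\<bar>t n - c\<bar> \<le> \<eta>" using n d by linarith
        ultimately show ?thesis by linarith
      qed
      have "prob (E k) \<le> prob ({w \<in> space M. q w < c + 2 * \<eta>} \<union> ?bad)"
        using key sets.sets_into_space[OF E, of k] by (intro finite_measure_mono) (blast, measurable)
      also have "\<dots> \<le> \<P>(w in M. q w < c + 2 * \<eta>) + prob ?bad" by (intro measure_Un_le) measurable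
      also have "\<P>(w in M. q w < c + 2 * \<eta>) = expectation (indicator {w \<in> space M. q w < c + 2 * \<eta>})" by simp
      also have "\<dots> \<le> expectation (\<lambda>w. \<psi> (c + 2 * \<eta>) (q w))"
        by (intro integral_mono integrable_const_bound[where B=1]) (auto simp: \<psi>01 \<psi>1 indicator_def)
      finally have 1: "prob (E k) \<le> cdf \<nu> (c + 3 * \<eta>) + 4 * \<eta>" using elim(3) bad unfolding q_def by linarith
      have "expectation (\<lambda>w. \<psi> (c - 3 * \<eta>) (q w)) \<le> expectation (indicator {w \<in> space M. q w < c - 2 * \<eta>})"
        by (intro integral_mono integrable_const_bound[where B=1]) (auto simp: \<psi>01 \<psi>0 indicator_def)
      also have "\<dots> = \<P>(w in M. q w < c - 2 * \<eta>)" by simp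
      also have "\<dots> \<le> prob (E k \<union> ?bad)"
        using key by (intro finite_measure_mono) (blast, measurable)
      also have "\<dots> \<le> prob (E k) + prob ?bad" by (intro measure_Un_le) measurable
      finally have 2: "cdf \<nu> (c - 3 * \<eta>) - 4 * \<eta> \<le> prob (E k)" using elim(4) bad unfolding q_def by linarith
      show ?case using 1 2 by simp
    qed
  qed
  have lim: "((\<lambda>\<eta>. cdf \<nu> (c + s * \<eta>) + b * \<eta>) \<longlongrightarrow> cdf \<nu> c) (at_right 0)" for s b :: real
  proof -
    have "((\<lambda>\<eta>. c + s * \<eta>) \<longlongrightarrow> c + s * 0) (at_right 0)" by (intro tendsto_intros)
    then have "((\<lambda>\<eta>. cdf \<nu> (c + s * \<eta>)) \<longlongrightarrow> cdf \<nu> c) (at_right 0)"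
      using isCont_tendsto_compose[OF cont] by simp
    moreover have "((\<lambda>\<eta>. b * \<eta>) \<longlongrightarrow> b * 0) (at_right 0)" by (intro tendsto_intros)
    ultimately have "((\<lambda>\<eta>. cdf \<nu> (c + s * \<eta>) + b * \<eta>) \<longlongrightarrow> cdf \<nu> c + b * 0) (at_right 0)" by (rule tendsto_add)
    then show ?thesis by simp
  qed
  have pos: "\<forall>\<^sub>F \<eta> in at_right (0::real). \<eta> > 0" by (rule eventually_at_right_less)
  show ?thesis
  proof (rule order_tendstoI)
    fix y assume y: "y < cdf \<nu> c"
    have "\<forall>\<^sub>F \<eta> in at_right 0. \<eta> > 0 \<and> cdf \<nu> (c + (- 3) * \<eta>) + (- 4) * \<eta> > y"
      by (rule eventually_conj[OF pos order_tendstoD(1)[OF lim y]])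
    then obtain \<eta> where "\<eta> > 0" "cdf \<nu> (c - 3 * \<eta>) - 4 * \<eta> > y" by (auto dest!: eventually_happens'[rotated])
    then show "\<forall>\<^sub>F k in sequentially. y < prob (E k)" using bounds[of \<eta>] by (auto elim!: eventually_mono)
  next
    fix y assume y: "y > cdf \<nu> c"
    have "\<forall>\<^sub>F \<eta> in at_right 0. \<eta> > 0 \<and> cdf \<nu> (c + 3 * \<eta>) + 4 * \<eta> < y"
      by (rule eventually_conj[OF pos order_tendstoD(2)[OF lim y]])
    then obtain \<eta> where "\<eta> > 0" "cdf \<nu> (c + 3 * \<eta>) + 4 * \<eta> < y" by (auto dest!: eventually_happens'[rotated])
    then show "\<forall>\<^sub>F k in sequentially. prob (E k) < y" using bounds[of \<eta>] by (auto elim!: eventually_mono)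
  qed
qed

text \<open>The \<open>p\<close>-th root reduces the volume to a constant times the square root of
  quantile over \<open>n\<close>. Positivity of the limits makes the algebra with roots valid for
  large \<open>n\<close>.\<close>

lemma conf_volume_rate:
  fixes A :: "nat \<Rightarrow> real^'p^'p"
  defines "C \<equiv> 2 * pi powr (real CARD('p) / 2) / (real CARD('p) * Gamma (real CARD('p) / 2))"
  assumes A: "A \<longlonglongrightarrow> \<Sigma>" and det: "det \<Sigma> > 0"
    and t: "(\<lambda>n. Hotelling_quantile (1 - \<alpha>) CARD('p) (q n)) \<longlonglongrightarrow> c" and c: "c > 0"
  shows "(\<lambda>n. sqrt (real n) * conf_volume \<alpha> (q n) n (A n) powr (1 / real CARD('p)))
     \<longlonglongrightarrow> C powr (1 / real CARD('p)) * sqrt c * sqrt (det \<Sigma>) powr (1 / real CARD('p))"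
    and "C powr (1 / real CARD('p)) * sqrt c * sqrt (det \<Sigma>) powr (1 / real CARD('p)) > 0"
proof -
  let ?p = "real CARD('p)" and ?t = "\<lambda>n. Hotelling_quantile (1 - \<alpha>) CARD('p) (q n)"
  have C: "C > 0" unfolding C_def using Gamma_real_pos[of "?p / 2"] by simp
  show "C powr (1 / ?p) * sqrt c * sqrt (det \<Sigma>) powr (1 / ?p) > 0" using C c det by simp
  have "isCont det \<Sigma>" using continuous_on_det[OF continuous_on_id, of UNIV] by (auto simp: continuous_on_eq_continuous_at)
  then have dl: "(\<lambda>n. det (A n)) \<longlonglongrightarrow> det \<Sigma>" using A by (rule isCont_tendsto_compose)
  have "(\<lambda>n. C powr (1 / ?p) * sqrt (?t n) * sqrt (det (A n)) powr (1 / ?p)) \<longlonglongrightarrow> C powr (1 / ?p) * sqrt c * sqrt (det \<Sigma>) powr (1 / ?p)"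
    using det by (intro tendsto_mult tendsto_const tendsto_real_sqrt tendsto_powr t dl) auto
  moreover have "\<forall>\<^sub>F n in sequentially. C powr (1 / ?p) * sqrt (?t n) * sqrt (det (A n)) powr (1 / ?p)
     = sqrt (real n) * conf_volume \<alpha> (q n) n (A n) powr (1 / ?p)"
    using order_tendstoD(1)[OF dl det] order_tendstoD(1)[OF t c] eventually_gt_at_top[of 0]
  proof eventually_elim
    case (elim n)
    have "((?t n / real n) powr (?p / 2)) powr (1 / ?p) = (?t n / real n) powr (1 / 2)" by (simp add: powr_powr)
    also have "\<dots> = sqrt (?t n) / sqrt (real n)" using elim by (simp add: powr_half_sqrt real_sqrt_divide)
    finally have e: "((?t n / real n) powr (?p / 2)) powr (1 / ?p) = sqrt (?t n) / sqrt (real n)" .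
    have "conf_volume \<alpha> (q n) n (A n) powr (1 / ?p) = C powr (1 / ?p) * (sqrt (?t n) / sqrt (real n)) * sqrt (det (A n)) powr (1 / ?p)"
      unfolding conf_volume_def C_def[symmetric] powr_mult e ..
    then show ?case using elim by simp
  qed
  ultimately show "(\<lambda>n. sqrt (real n) * conf_volume \<alpha> (q n) n (A n) powr (1 / ?p)) \<longlonglongrightarrow> C powr (1 / ?p) * sqrt c * sqrt (det \<Sigma>) powr (1 / ?p)"
    by (rule Lim_transform_eventually)
qed

theorem theorem1:
  fixes F :: "'a measure" and P :: "'a \<Rightarrow> 'a measure"
    and M :: "'w measure" and X :: "nat \<Rightarrow> 'w \<Rightarrow> 'a"
    and g :: "'a \<Rightarrow> real^'p"
    and Y :: "nat \<Rightarrow> 'w \<Rightarrow> real^'p" and \<theta> :: "real^'p" and \<theta>n :: "nat \<Rightarrow> 'w \<Rightarrow> real^'p"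
    and \<Sigma> :: "real^'p^'p" and S :: "nat \<Rightarrow> (nat \<Rightarrow> real^'p) \<Rightarrow> real^'p^'p"
    and \<Sigma>n :: "nat \<Rightarrow> 'w \<Rightarrow> real^'p^'p"
    and K :: real and Kn :: "nat \<Rightarrow> 'w \<Rightarrow> real"
    and \<delta> \<epsilon>\<^sub>1 m \<alpha> :: real and nstar :: nat and q :: "nat \<Rightarrow> nat"
    and C D :: "nat \<Rightarrow> 'w \<Rightarrow> (real^'p) set"
    and Tstar :: "real \<Rightarrow> 'w \<Rightarrow> enat"
  assumes "prob_space F" and "P \<in> F \<rightarrow>\<^sub>M prob_algebra F"
    and "invariant_dist F P" and "Harris_recurrent F P"
    and "prob_space M" and "markov_chain M F P X"
    and "g \<in> borel_measurable F" and "\<delta> > 0"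
    and "integrable F (\<lambda>x. norm (g x) powr (2 + \<delta>))"
    and "\<epsilon>\<^sub>1 > 0" and "m > (1 + \<epsilon>\<^sub>1) * (1 + 2 / \<delta>)" and "polynomially_ergodic F P m"
    and Y_def: "Y = (\<lambda>t w. g (X t w))"
    and \<theta>_def: "\<theta> = (\<integral>x. g x \<partial>F)"
    and \<theta>n_def: "\<theta>n = (\<lambda>n w. sample_mean (\<lambda>t. Y t w) n)"
    and "pos_definite \<Sigma>"
    and CLT: "weakly_converges
          (\<lambda>n. distr M borel (\<lambda>w. sqrt (real n) *\<^sub>R (\<theta>n n w - \<theta>))) (centered_normal \<Sigma>)"
    and "\<And>n. S n \<in> borel_measurable (PiM {1..n} (\<lambda>_. borel))"
    and \<Sigma>n_def: "\<Sigma>n = (\<lambda>n w. S n (\<lambda>t\<in>{1..n}. Y t w))"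
    and "\<And>n w. w \<in> space M \<Longrightarrow> nonneg_definite (\<Sigma>n n w)"
    and "AE w in M. (\<lambda>n. \<Sigma>n n w) \<longlonglongrightarrow> \<Sigma>"
    and "K > 0" and "\<And>n. Kn n \<in> borel_measurable M"
    and "\<And>n w. w \<in> space M \<Longrightarrow> Kn n w > 0"
    and "AE w in M. (\<lambda>n. Kn n w) \<longlonglongrightarrow> K"
    and "0 < \<alpha>" and "\<alpha> < 1"
    and "\<And>n. n \<ge> nstar \<Longrightarrow> q n > 0" and "filterlim q at_top sequentially"
    and "\<And>n v. {w \<in> space M. v \<in> D n w} \<in> sets M"
    and C_def: "C = (\<lambda>n w. if invertible (\<Sigma>n n w)
                           then conf_ellipsoid \<alpha> (q n) n (\<theta>n n w) (\<Sigma>n n w) else D n w)"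
    and Tstar_def: "Tstar = (\<lambda>\<epsilon> w. fixed_volume_stop CARD('p) nstar
                      (\<lambda>n. conf_volume \<alpha> (q n) n (\<Sigma>n n w)) (\<lambda>n. Kn n w) \<epsilon>)"
  shows "(AE w in M. ((\<lambda>\<epsilon>. Tstar \<epsilon> w) \<longlongrightarrow> \<infinity>) (at_right 0)) \<and>
         ((\<lambda>\<epsilon>. measure M {w \<in> space M. \<exists>n. Tstar \<epsilon> w = enat n \<and> \<theta> \<in> C n w})
            \<longlongrightarrow> 1 - \<alpha>) (at_right 0)"
proof -
  interpret F: prob_space F by fact
  interpret M: prob_space M by fact
  let ?p = "CARD('p)"
  have p0: "?p > 0" by simp
  obtain V where V: "\<And>x. x \<in> space F \<Longrightarrow> 0 \<le> V x" "integrable F V" and m0: "m > 0"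
    and erg: "\<And>x n. x \<in> space F \<Longrightarrow> n \<ge> 1 \<Longrightarrow> tv_dist (kernel_pow F P n x) F \<le> V x * real n powr - m"
    using \<open>polynomially_ergodic F P m\<close> unfolding polynomially_ergodic_def by blast
  interpret poly_chain M F P X V m
    by (intro poly_chain.intro kernel_chain.intro kernel_chain_axioms.intro poly_chain_axioms.intro) fact+
  have m1: "m > 1 + 2 / \<delta>"
  proof -
    have "1 * (1 + 2 / \<delta>) \<le> (1 + \<epsilon>\<^sub>1) * (1 + 2 / \<delta>)" using \<open>\<delta> > 0\<close> \<open>\<epsilon>\<^sub>1 > 0\<close> by (intro mult_right_mono) auto
    also note assms(11)
    finally show ?thesis by simp
  qed
  note gm [measurable] = \<open>g \<in> borel_measurable F\<close>
  define f where "f x = g x - \<theta>" for x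
  have fm [measurable]: "f \<in> borel_measurable F" unfolding f_def by measurable
  have f_int: "integrable F (\<lambda>x. norm (f x) powr (2 + \<delta>))"
  proof (rule Bochner_Integration.integrable_bound)
    show "integrable F (\<lambda>x. 2 powr (2 + \<delta>) * (norm (g x) powr (2 + \<delta>) + norm \<theta> powr (2 + \<delta>)))"
      using assms(9) by simp
    show "AE x in F. norm (norm (f x) powr (2 + \<delta>)) \<le> norm (2 powr (2 + \<delta>) * (norm (g x) powr (2 + \<delta>) + norm \<theta> powr (2 + \<delta>)))"
    proof (rule AE_I2)
      fix x
      have "norm (f x) \<le> 2 * max (norm (g x)) (norm \<theta>)"
        unfolding f_def using norm_triangle_ineq4[of "g x" \<theta>] by linarith
      then have "norm (f x) powr (2 + \<delta>) \<le> (2 * max (norm (g x)) (norm \<theta>)) powr (2 + \<delta>)"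
        using \<open>\<delta> > 0\<close> by (intro powr_mono2) auto
      also have "\<dots> = 2 powr (2 + \<delta>) * max (norm (g x)) (norm \<theta>) powr (2 + \<delta>)" by (rule powr_mult)
      also have "max (norm (g x)) (norm \<theta>) powr (2 + \<delta>) \<le> norm (g x) powr (2 + \<delta>) + norm \<theta> powr (2 + \<delta>)"
        by (simp add: max_def)
      finally show "norm (norm (f x) powr (2 + \<delta>)) \<le> norm (2 powr (2 + \<delta>) * (norm (g x) powr (2 + \<delta>) + norm \<theta> powr (2 + \<delta>)))" by simp
    qed
  qed measurable
  define Z where "Z n w = sqrt (real n) *\<^sub>R (\<theta>n n w - \<theta>)" for n w
  have Z_inc: "Z = (\<lambda>n w. (1 / sqrt (real n)) *\<^sub>R inc f 0 n w)"
  proof (intro ext)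
    fix n w
    show "Z n w = (1 / sqrt (real n)) *\<^sub>R inc f 0 n w"
    proof (cases "n = 0")
      case False
      have "inc f 0 n w = (\<Sum>i\<in>{0<..n}. g (X i w)) - real n *\<^sub>R \<theta>"
        by (simp add: inc_def f_def sum_subtractf scaleR_conv_of_real sum_constant_scaleR)
      moreover have "{0<..n} = {1..n}" by auto
      ultimately have "inc f 0 n w = real n *\<^sub>R (\<theta>n n w - \<theta>)"
        using False by (simp add: \<theta>n_def sample_mean_def Y_def scaleR_diff_right)
      then show ?thesis using False by (simp add: Z_def real_div_sqrt)
    qed (simp add: Z_def)
  qed
  have Zm [measurable]: "Z n \<in> borel_measurable M" for n unfolding Z_inc by measurable
  have CLT': "weakly_converges (\<lambda>n. distr M borel (Z n)) (centered_normal \<Sigma>)"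
    using CLT unfolding Z_def[abs_def] .
  have distr_integral: "(\<integral>v. \<psi> v \<partial>distr M borel (Z n)) = M.expectation (\<lambda>w. \<psi> (Z n w))"
    if "\<psi> \<in> borel_measurable borel" for \<psi> :: "real^'p \<Rightarrow> real" and n
    using that by (intro integral_distr) auto
  \<comment> \<open>The mass is read off from the limit theorem itself, with the constant test
    function 1. From \<open>measure\<close> to \<open>emeasure\<close> one uses that an infinite
    mass would have \<open>measure\<close> 0.\<close>
  have mass: "emeasure (centered_normal \<Sigma>) UNIV = 1"
  proof -
    have "(\<lambda>n. \<integral>v. (1::real) \<partial>distr M borel (Z n)) \<longlonglongrightarrow> (\<integral>v. 1 \<partial>centered_normal \<Sigma>)"
      using CLT'[unfolded weakly_converges_def, rule_format, of "\<lambda>_. 1"] by auto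
    then have "(\<lambda>n::nat. 1::real) \<longlonglongrightarrow> (\<integral>v. 1 \<partial>centered_normal \<Sigma>)"
      by (subst (asm) distr_integral) (auto simp: M.prob_space)
    then have "(\<integral>v. (1::real) \<partial>centered_normal \<Sigma>) = 1" by (simp add: LIMSEQ_const_iff)
    then have "measure (centered_normal \<Sigma>) UNIV = 1" by (simp add: centered_normal_def)
    then show ?thesis by (metis emeasure_eq_ennreal_measure ennreal_1 measure_zero_top zero_neq_one)
  qed
  have N: "prob_space (centered_normal \<Sigma>)" "sets (centered_normal \<Sigma>) = sets borel"
    using mass by (auto intro!: prob_spaceI simp: centered_normal_def)
  note det = distr_centered_normal(1)[OF \<open>pos_definite \<Sigma>\<close> mass]
  have inv: "invertible \<Sigma>" using det by (simp add: invertible_det_nz)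
  have form: "v \<bullet> (matrix_inv A *v v) = inv_form A v" if "invertible A" for A :: "real^'p^'p" and v
    by (intro inv_form_eq that matrix_mult_matrix_inv)
  have law: "distr (centered_normal \<Sigma>) borel (inv_form \<Sigma>) = chi_law ?p"
    using distr_centered_normal(2)[OF \<open>pos_definite \<Sigma>\<close> mass] by (simp add: form[OF inv])
  have form_c: "continuous_on UNIV (inv_form \<Sigma>)"
    using det by (intro continuous_on_inv_form[where f="\<lambda>_. \<Sigma>" and g="\<lambda>v. v"] continuous_intros) auto
  have weak: "(\<lambda>n. M.expectation (\<lambda>w. \<psi> (inv_form \<Sigma> (Z n w)))) \<longlonglongrightarrow> (\<integral>x. \<psi> x \<partial>chi_law ?p)"
    if c: "continuous_on UNIV \<psi>" and b: "bounded (range \<psi>)" for \<psi> :: "real \<Rightarrow> real"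
  proof -
    have c': "continuous_on UNIV (\<lambda>v. \<psi> (inv_form \<Sigma> v))"
      using continuous_on_compose2[OF c form_c] by simp
    have "bounded (range (\<lambda>v. \<psi> (inv_form \<Sigma> v)))" by (rule bounded_subset[OF b]) auto
    with CLT' c' have "(\<lambda>n. \<integral>v. \<psi> (inv_form \<Sigma> v) \<partial>distr M borel (Z n)) \<longlonglongrightarrow> (\<integral>v. \<psi> (inv_form \<Sigma> v) \<partial>centered_normal \<Sigma>)"
      unfolding weakly_converges_def by blast
    also have "(\<integral>v. \<psi> (inv_form \<Sigma> v) \<partial>centered_normal \<Sigma>) = (\<integral>x. \<psi> x \<partial>distr (centered_normal \<Sigma>) borel (inv_form \<Sigma>))"
    proof (rule integral_distr[symmetric])
      show "inv_form \<Sigma> \<in> borel_measurable (centered_normal \<Sigma>)"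
        using borel_measurable_continuous_onI[OF form_c] by (simp add: centered_normal_def)
      show "\<psi> \<in> borel_measurable borel" by (rule borel_measurable_continuous_onI[OF c])
    qed
    finally show ?thesis unfolding law distr_integral[OF borel_measurable_continuous_onI[OF c']] .
  qed
  have tight: "\<exists>a>0. \<forall>n. \<P>(w in M. norm (Z n w) > a) \<le> \<epsilon>" if "\<epsilon> > 0" for \<epsilon>
    by (rule weakly_converges_tight[OF M.prob_space_axioms Zm N CLT' that])
  obtain c where c: "c > 0" "cdf (chi_law ?p) c = 1 - \<alpha>"
    "\<And>x. x < c \<Longrightarrow> cdf (chi_law ?p) x < 1 - \<alpha>" "\<And>x. x > c \<Longrightarrow> cdf (chi_law ?p) x > 1 - \<alpha>"
    using chi_quantile[OF p0, of "1 - \<alpha>"] \<open>0 < \<alpha>\<close> \<open>\<alpha> < 1\<close> by auto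
  define t where "t n = Hotelling_quantile (1 - \<alpha>) ?p (q n)" for n
  have "(\<lambda>n. Hotelling_quantile (1 - \<alpha>) ?p n) \<longlonglongrightarrow> c"
    using \<open>\<alpha> < 1\<close> by (intro Hotelling_quantile_LIMSEQ[OF p0 _ c(3,4)]) auto
  then have t: "t \<longlonglongrightarrow> c" unfolding t_def[abs_def]
    using assms(29) by (rule filterlim_compose)
  \<comment> \<open>The limit of \<open>sqrt n\<close> times the \<open>p\<close>-th root of the
    volume, divided by \<open>K\<close>: thus \<open>\<epsilon>\<^sup>2 * Tstar\<close> tends to
    \<open>s\<^sup>2\<close> almost surely.\<close>
  define s where "s = (2 * pi powr (real ?p / 2) / (real ?p * Gamma (real ?p / 2))) powr (1 / real ?p) * sqrt c * sqrt (det \<Sigma>) powr (1 / real ?p) / K"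
  have vol_rate: "(\<lambda>n. sqrt (real n) * conf_volume \<alpha> (q n) n (A n) powr (1 / real ?p)) \<longlonglongrightarrow> s * K" "s * K > 0"
    if "A \<longlonglongrightarrow> \<Sigma>" for A
    using conf_volume_rate[OF that det t[unfolded t_def[abs_def]] c(1)] \<open>K > 0\<close> by (simp_all add: s_def)
  have s: "s > 0" using vol_rate(2)[of "\<lambda>_. \<Sigma>"] \<open>K > 0\<close> by (simp add: zero_less_mult_iff)
  have T_inf: "((\<lambda>\<epsilon>. Tstar \<epsilon> w) \<longlongrightarrow> \<infinity>) (at_right 0)" if "w \<in> space M" for w
    unfolding Tstar_def using assms(24)[OF that] by (intro fixed_volume_stop_tendsto_infinity)
  have Sm [measurable]: "\<Sigma>n n \<in> borel_measurable M" for n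
  proof -
    have "(\<lambda>w. \<lambda>t\<in>{1..n}. Y t w) \<in> M \<rightarrow>\<^sub>M PiM {1..n} (\<lambda>_. borel)"
      by (rule measurable_restrict) (auto simp: Y_def intro!: measurable_compose[OF X_measurable gm])
    then show ?thesis unfolding \<Sigma>n_def using assms(18)[of n] by (rule measurable_compose)
  qed
  note Km [measurable] = assms(23)
  have tnm [measurable]: "\<theta>n n \<in> borel_measurable M" for n
    unfolding \<theta>n_def sample_mean_def Y_def
    by (intro borel_measurable_scaleR borel_measurable_const borel_measurable_sum measurable_compose[OF X_measurable gm]) auto
  have Tm: "{w \<in> space M. Tstar \<epsilon> w = enat n} \<in> sets M" if \<epsilon>: "\<epsilon> > 0" for \<epsilon> n
  proof -
    define Q where "Q j w \<longleftrightarrow> j \<ge> 1 \<and> j \<ge> nstar \<and> conf_volume \<alpha> (q j) j (\<Sigma>n j w) powr (1 / real ?p) + 1 / real j \<le> \<epsilon> * Kn j w" for j w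
    have [measurable]: "Measurable.pred M (Q j)" for j unfolding Q_def conf_volume_def by measurable
    have "Tstar \<epsilon> w = enat n \<longleftrightarrow> Q n w \<and> (\<forall>j<n. \<not> Q j w)" if w: "w \<in> space M" for w
      unfolding Tstar_def fixed_volume_stop_def Inf_enat_eq Q_def
      by (subst (1 2) stop_condition_iff[where K="\<lambda>n. Kn n w"]) (use assms(24)[OF w] \<epsilon> in auto)
    then have "{w \<in> space M. Tstar \<epsilon> w = enat n} = {w \<in> space M. Q n w \<and> (\<forall>j<n. \<not> Q j w)}" by auto
    also have "\<dots> \<in> sets M" by measurable
    finally show ?thesis .
  qed
  have Cm: "{w \<in> space M. \<theta> \<in> C n w} \<in> sets M" for n
  proof -
    \<comment> \<open>For singular estimates \<open>C\<close> is the prescribed choice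
      \<open>D\<close>; the determinant separates the two cases measurably.\<close>
    have "{w \<in> space M. \<theta> \<in> C n w} = {w \<in> space M. det (\<Sigma>n n w) \<noteq> 0 \<and> real n * inv_form (\<Sigma>n n w) (\<theta>n n w - \<theta>) < t n}
        \<union> ({w \<in> space M. det (\<Sigma>n n w) = 0} \<inter> {w \<in> space M. \<theta> \<in> D n w})"
      by (auto simp: C_def conf_ellipsoid_def t_def form invertible_det_nz)
    also have "\<dots> \<in> sets M" by (intro sets.Un sets.Int assms(30)) measurable
    finally show ?thesis .
  qed
  define E where "E \<epsilon> = {w \<in> space M. \<exists>n. Tstar \<epsilon> w = enat n \<and> \<theta> \<in> C n w}" for \<epsilon>
  have Em: "E \<epsilon> \<in> sets M" if "\<epsilon> > 0" for \<epsilon>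
  proof -
    have "E \<epsilon> = (\<Union>n. {w \<in> space M. Tstar \<epsilon> w = enat n} \<inter> {w \<in> space M. \<theta> \<in> C n w})" by (auto simp: E_def)
    also have "\<dots> \<in> sets M" by (intro sets.countable_UN image_subsetI sets.Int Tm Cm that)
    finally show ?thesis .
  qed
  \<comment> \<open>By homogeneity of the form the factor \<open>n\<close> is absorbed into its
    argument, which turns the deviation of the mean into \<open>Z n\<close>.\<close>
  have EE: "w \<in> E \<epsilon> \<longleftrightarrow> inv_form (\<Sigma>n n w) (Z n w) < t n"
    if "w \<in> space M" "Tstar \<epsilon> w = enat n" "det (\<Sigma>n n w) \<noteq> 0" for \<epsilon> n w
  proof -
    have i: "invertible (\<Sigma>n n w)" using that by (simp add: invertible_det_nz)
    show ?thesis using that(1,2) i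
      by (simp add: E_def C_def conf_ellipsoid_def t_def form Z_def inv_form_scaleR)
  qed
  have "((\<lambda>\<epsilon>. M.prob (E \<epsilon>)) \<longlongrightarrow> 1 - \<alpha>) (at_right 0)"
  \<comment> \<open>Dominated convergence is available along sequences, so the limit is taken along
    a sequence tending to 0.\<close>
  proof (rule tendsto_at_right_sequentially[of 0 1])
    fix \<epsilon> :: "nat \<Rightarrow> real" assume pos: "\<And>n. 0 < \<epsilon> n" and lim: "\<epsilon> \<longlonglongrightarrow> 0"
    have fl: "filterlim \<epsilon> (at_right 0) sequentially"
      using lim pos by (intro tendsto_imp_filterlim_at_right always_eventually allI)
    \<comment> \<open>The deterministic index that stands in for the stopping time.\<close>
    define a where "a k = nat \<lceil>(s / \<epsilon> k)\<^sup>2\<rceil>" for k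
    have a1: "s\<^sup>2 \<le> (\<epsilon> k)\<^sup>2 * real (a k)" "(\<epsilon> k)\<^sup>2 * real (a k) \<le> s\<^sup>2 + (\<epsilon> k)\<^sup>2" for k
    proof -
      have "(s / \<epsilon> k)\<^sup>2 \<le> real (a k)" "real (a k) \<le> (s / \<epsilon> k)\<^sup>2 + 1" unfolding a_def by (simp_all add: real_nat_ceiling_ge)
      then have "(\<epsilon> k)\<^sup>2 * (s / \<epsilon> k)\<^sup>2 \<le> (\<epsilon> k)\<^sup>2 * real (a k)" "(\<epsilon> k)\<^sup>2 * real (a k) \<le> (\<epsilon> k)\<^sup>2 * ((s / \<epsilon> k)\<^sup>2 + 1)"
        by (auto intro!: mult_left_mono)
      then show "s\<^sup>2 \<le> (\<epsilon> k)\<^sup>2 * real (a k)" "(\<epsilon> k)\<^sup>2 * real (a k) \<le> s\<^sup>2 + (\<epsilon> k)\<^sup>2"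
        using pos[of k] by (simp_all add: power_divide distrib_left)
    qed
    have "filterlim (\<lambda>x. nat \<lceil>(s / x)\<^sup>2\<rceil>) at_top (at_right (0::real))" using s by real_asymp
    then have a_top: "filterlim a at_top sequentially" unfolding a_def[abs_def] using fl by (rule filterlim_compose)
    have conv: "AE w in M. \<forall>d>0. \<forall>\<^sub>F k in sequentially. \<exists>n. Tstar (\<epsilon> k) w = enat n \<and>
       \<bar>real n - real (a k)\<bar> \<le> d * real (a k) \<and> norm (\<Sigma>n n w - \<Sigma>) \<le> d \<and> \<bar>t n - c\<bar> \<le> d"
      using assms(21,25) AE_space
    proof eventually_elim
      case (elim w)
      show ?case
      proof (intro allI impI)
        fix d :: real assume d: "d > 0"
        have "\<forall>\<^sub>F n in sequentially. norm (\<Sigma>n n w - \<Sigma>) < d \<and> \<bar>t n - c\<bar> < d"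
          using tendstoD[OF elim(1) d] tendstoD[OF t d] by eventually_elim (simp add: dist_norm)
        then obtain n0 where n0: "\<And>n. n \<ge> n0 \<Longrightarrow> norm (\<Sigma>n n w - \<Sigma>) < d \<and> \<bar>t n - c\<bar> < d" by (auto simp: eventually_sequentially)
        have sK: "s * K / K = s" using \<open>K > 0\<close> by simp
        \<comment> \<open>Half of the tolerance \<open>d\<close> goes to the limit of
          \<open>\<epsilon>\<^sup>2 * Tstar\<close>, the other half to the rounding in
          \<open>a k\<close>.\<close>
        have "\<forall>\<^sub>F x in at_right 0. \<exists>n. Tstar x w = enat n \<and> s\<^sup>2 * (1 - d / 2) < x\<^sup>2 * real n \<and> x\<^sup>2 * real n < s\<^sup>2 * (1 + d / 2)"
          unfolding Tstar_def
          by (rule fixed_volume_stop_rate[OF assms(24)[OF elim(3)] elim(2) \<open>K > 0\<close> vol_rate[OF elim(1)]])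
            (use s d in \<open>simp_all add: sK\<close>)
        then have 1: "\<forall>\<^sub>F k in sequentially. \<exists>n. Tstar (\<epsilon> k) w = enat n \<and> s\<^sup>2 * (1 - d / 2) < (\<epsilon> k)\<^sup>2 * real n \<and> (\<epsilon> k)\<^sup>2 * real n < s\<^sup>2 * (1 + d / 2)"
          using fl by (rule eventually_compose_filterlim)
        have "\<forall>\<^sub>F x in at_right 0. Tstar x w > enat n0" using T_inf[OF elim(3)] by (rule order_tendstoD) simp
        then have 2: "\<forall>\<^sub>F k in sequentially. Tstar (\<epsilon> k) w > enat n0" using fl by (rule eventually_compose_filterlim)
        have "(\<lambda>k. (\<epsilon> k)\<^sup>2) \<longlonglongrightarrow> 0\<^sup>2" by (intro tendsto_power lim)
        then have 3: "\<forall>\<^sub>F k in sequentially. (\<epsilon> k)\<^sup>2 < s\<^sup>2 * d / 2" by (rule order_tendstoD(2)) (use s d in simp)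
        show "\<forall>\<^sub>F k in sequentially. \<exists>n. Tstar (\<epsilon> k) w = enat n \<and>
          \<bar>real n - real (a k)\<bar> \<le> d * real (a k) \<and> norm (\<Sigma>n n w - \<Sigma>) \<le> d \<and> \<bar>t n - c\<bar> \<le> d"
          using 1 2 3
        proof eventually_elim
          case (elim k)
          then obtain n where n: "Tstar (\<epsilon> k) w = enat n" "s\<^sup>2 * (1 - d / 2) < (\<epsilon> k)\<^sup>2 * real n" "(\<epsilon> k)\<^sup>2 * real n < s\<^sup>2 * (1 + d / 2)" by blast
          then have "n > n0" using elim(2) by simp
          moreover have "\<bar>real n - real (a k)\<bar> \<le> d * real (a k)"
          proof -
            have e0: "(\<epsilon> k)\<^sup>2 > 0" using pos[of k] by simp
            have "\<bar>(\<epsilon> k)\<^sup>2 * real n - (\<epsilon> k)\<^sup>2 * real (a k)\<bar> \<le> d * s\<^sup>2"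
              using n(2,3) a1[of k] elim(3) by (simp add: abs_le_iff algebra_simps)
            also have "\<dots> \<le> d * ((\<epsilon> k)\<^sup>2 * real (a k))" using a1(1)[of k] d by (intro mult_left_mono) auto
            also have "\<bar>(\<epsilon> k)\<^sup>2 * real n - (\<epsilon> k)\<^sup>2 * real (a k)\<bar> = (\<epsilon> k)\<^sup>2 * \<bar>real n - real (a k)\<bar>"
              using e0 by (simp add: abs_mult flip: right_diff_distrib)
            finally have "(\<epsilon> k)\<^sup>2 * \<bar>real n - real (a k)\<bar> \<le> (\<epsilon> k)\<^sup>2 * (d * real (a k))" by (simp add: mult_ac)
            then show ?thesis using e0 by (rule mult_left_le_imp_le)
          qed
          ultimately show ?case using n(1) n0[of n] by (intro exI[of _ n]) auto
        qed
      qed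
    qed
    have "(\<lambda>k. M.prob (E (\<epsilon> k))) \<longlonglongrightarrow> cdf (chi_law ?p) c"
    proof (rule M.random_index_ellipsoid[where Z=Z and B=\<Sigma>n and T="\<lambda>k. Tstar (\<epsilon> k)" and \<Sigma>=\<Sigma> and a=a and t=t])
      show "\<exists>d>0. \<forall>\<^sub>F n in sequentially. \<P>(w in M. oscillates Z d n \<tau> w) \<le> \<epsilon>'"
        if "\<tau> > 0" "\<epsilon>' > 0" for \<tau> \<epsilon>'
        using anscombe_normalized[OF fm \<open>\<delta> > 0\<close> f_int m1 _ that] tight unfolding Z_inc by blast
      show "w \<in> E (\<epsilon> k) \<longleftrightarrow> inv_form (\<Sigma>n n w) (Z n w) < t n"
        if "w \<in> space M" "Tstar (\<epsilon> k) w = enat n" "det (\<Sigma>n n w) \<noteq> 0" for k n w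
        using that by (rule EE)
    qed (use det pos in \<open>auto intro: Tm Em weak tight a_top conv real_distribution_chi_law isCont_cdf_chi_law\<close>)
    then show "(\<lambda>n. M.prob (E (\<epsilon> n))) \<longlonglongrightarrow> 1 - \<alpha>" by (simp add: c)
  qed simp
  then show ?thesis using T_inf unfolding E_def by (auto intro: AE_I2)
qed

end
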